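(* Let $d,n\ge 2$. For each domain $\mathcal D$ in $Q_0(d,n)$ whose closure $\overline{\mathcal D}$ is a compact subset of $Q_0(d,n)$, and for each reduction $\mathfrak P$ of $\mathcal V(d,n)$ to a principal $K$-bundle over $\overline{\mathcal D}$, the Shilov boundary ideal of $\Gamma_c(\partial\mathcal D,\mathfrak M^*(\mathfrak P;d,n))$ for $\mathbb S(\mathcal D,\mathfrak P;d,n)$ vanishes, so $\Gamma_c(\partial\mathcal D,\mathfrak M^*(\mathfrak P;d,n))$ is the $C^*$-envelope of $\mathbb S(\mathcal D,\mathfrak P;d,n)$.
   Context: Setting. $G=PGL(n,\mathbb C)$, $K=PU(n,\mathbb C)$, acting on $M_n(\mathbb C)$ by $s\cdot A=sAs^{-1}$ and on $M_n(\mathbb C)^d$ on the right by $\mathfrak z\cdot s=s^{-1}\mathfrak z s=(s^{-1}Z_1s,\dots,s^{-1}Z_ds)$. $\mathcal V(d,n)$ is the set of $\mathfrak z=(Z_1,\dots,Z_d)\in M_n(\mathbb C)^d$ such that $Z_1,\dots,Z_d$ generate the algebra $M_n(\mathbb C)$. $\mathbb I_0(d,n)$ is the algebra of $G$-invariant polynomial functions $M_n(\mathbb C)^d\to\mathbb C$; $p\in\mathbb I_0(d,n)$ is also identified with the matrix-valued function $\mathfrak z\mapsto p(\mathfrak z)I_n$. $\mathbb G_0(d,n)$ is the algebra of functions $M_n(\mathbb C)^d\to M_n(\mathbb C)$ generated by the coordinate functions $\mathcal Z_i(\mathfrak z)=Z_i$, and $\mathbb S_0(d,n)$ (the trace algebra)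 is the algebra generated by $\mathbb G_0(d,n)$ and $\mathbb I_0(d,n)$; its elements $\phi$ satisfy $\phi(s^{-1}\mathfrak z s)=s^{-1}\phi(\mathfrak z)s$. $Q(d,n)$ is the spectrum of the finitely generated algebra $\mathbb I_0(d,n)$, with its analytic topology, $\pi_0:M_n(\mathbb C)^d\to Q(d,n)$ is the surjection dual to the inclusion of $\mathbb I_0(d,n)$ in the polynomial functions, and $Q_0(d,n)=\pi_0(\mathcal V(d,n))$. By a theorem of Procesi (may be assumed), $Q_0(d,n)$ is an open subset of the smooth points of $Q(d,n)$ and $\pi_0:\mathcal V(d,n)\to Q_0(d,n)$ is a holomorphic principal $G$-bundle; write $[\mathfrak z]=\pi_0(\mathfrak z)$. Elements of $\mathbb I_0(d,n)$ are regarded as regular functions on $Q(d,n)$. Function algebra. $\mathbb I(\mathcal D;d,n)$ is the sup-norm closure of (the restrictions to $\overline{\mathcal D}$ of) $\mathbb I_0(d,n)$ in $C(\overline{\mathcal D})$; it is a function algebra on $\overline{\mathcal D}$, and $\partial\mathcal D\subseteq\overline{\mathcal D}$ is its Shilov boundary. Reductions and bundles. A reduction $\mathfrak P$ of $\mathcal V(d,n)$ to a principal $K$-bundle over $\overline{\mathcal D}$ is the principal $K$-bundle given by a compact $K$-invariant subset $\mathcal P\subseteq\mathcal V(d,n)$ which $\pi_0$ maps onto $\overline{\mathcal D}$ and for which $\pi_0$ identifies $\mathcal P/K$ with $\overline{\mathcal D}$. $\mathfrak M^*(\mathfrak P;d,n)$ is the associated $M_n(\mathbb C)$-bundle, with total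 space $\mathcal P\times_K M_n(\mathbb C)$ (quotient of $\mathcal P\times M_n(\mathbb C)$ by $(\mathfrak z,A)\cdot k=(k^{-1}\mathfrak z k,k^{-1}Ak)$) and projection $\pi([\mathfrak z,A])=[\mathfrak z]$; each fibre $\pi^{-1}(\mathfrak u)$ is a $C^*$-algebra isomorphic to $M_n(\mathbb C)$ via $A\mapsto[\mathfrak z,A]$ for any $\mathfrak z\in\mathcal P$ with $\pi_0(\mathfrak z)=\mathfrak u$. $\Gamma_c(\partial\mathcal D,\mathfrak M^*(\mathfrak P;d,n))$ is the $C^*$-algebra of continuous cross sections over $\partial\mathcal D$, with fibrewise operations and the supremum norm. For $\phi\in\mathbb S_0(d,n)$, $\Psi(\phi)$ is the section $\Psi(\phi)([\mathfrak z])=[\mathfrak z,\phi(\mathfrak z)]$, $\mathfrak z\in\mathcal P$. $\mathbb S(\mathcal D,\mathfrak P;d,n)$ (the tracial function algebra) is the norm closure of $\Psi(\mathbb S_0(d,n))$ in $\Gamma_c(\partial\mathcal D,\mathfrak M^*(\mathfrak P;d,n))$. Boundary notions. Let $B$ be a unital $C^*$-algebra and $A$ a norm-closed subalgebra containing the unit of $B$ and generating $B$ as a $C^*$-algebra. An irreducible representation $\rho:B\to B(H_\rho)$ is a boundary representation for $A$ if $\rho$ is the only unital completely positive map $\omega:B\to B(H_\rho)$ with $\omega|_A=\rho|_A$. An ideal $\mathfrak I$ of $B$ is a boundary ideal if the restriction to $A$ of the quotient map $B\to B/\mathfrak I$ is completely isometric. The intersection of the kernels of the boundary representations of $B$ for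 $A$ is the largest boundary ideal; it is called the Shilov boundary ideal of $B$ for $A$, and the quotient of $B$ by it is the $C^*$-envelope of $A$. *)

theory Defs
  imports "HOL-Analysis.Analysis" "HOL-Algebra.Module" "HOL-Algebra.QuotRing"
begin

section \<open>Hilbert spaces and unital C*-algebras\<close>

definition complex_alg :: "(complex, complex) module"
  where "complex_alg =
    \<lparr>carrier = UNIV, mult = (*), one = 1, zero = 0, add = (+), smult = (*)\<rparr>"

definition fun_alg :: "(complex, 'b, 'm) module_scheme \<Rightarrow> (complex, 'x \<Rightarrow> 'b) module"
  where "fun_alg B =
    \<lparr>carrier = UNIV \<rightarrow> carrier B,
     mult = (\<lambda>f g x. f x \<otimes>\<^bsub>B\<^esub> g x), one = (\<lambda>x. \<one>\<^bsub>B\<^esub>),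
     zero = (\<lambda>x. \<zero>\<^bsub>B\<^esub>), add = (\<lambda>f g x. f x \<oplus>\<^bsub>B\<^esub> g x),
     smult = (\<lambda>c f x. c \<odot>\<^bsub>B\<^esub> f x)\<rparr>"

text \<open>The unital complex subalgebra generated by \<open>X\<close>.\<close>

inductive_set generated_algebra :: "(complex, 'b, 'm) module_scheme \<Rightarrow> 'b set \<Rightarrow> 'b set"
  for B (structure) and X :: "'b set" where
  gen_one: "\<one> \<in> generated_algebra B X"
| gen_base: "x \<in> X \<Longrightarrow> x \<in> generated_algebra B X"
| gen_add: "\<lbrakk>x \<in> generated_algebra B X; y \<in> generated_algebra B X\<rbrakk>
            \<Longrightarrow> x \<oplus> y \<in> generated_algebra B X"
| gen_mult: "\<lbrakk>x \<in> generated_algebra B X; y \<in> generated_algebra B X\<rbrakk>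
            \<Longrightarrow> x \<otimes> y \<in> generated_algebra B X"
| gen_smult: "x \<in> generated_algebra B X \<Longrightarrow> c \<odot> x \<in> generated_algebra B X"

record 'b cstar_struct = "(complex, 'b) module" +
  star :: "'b \<Rightarrow> 'b"
  cnorm :: "'b \<Rightarrow> real"

text \<open>The library's metric spaces need a distance that is symmetric and nonnegative on the whole
  type, hence the guard; it has no effect on the carrier.\<close>

definition cdist :: "'b cstar_struct \<Rightarrow> 'b \<Rightarrow> 'b \<Rightarrow> real"
  where "cdist B x y =
    (if x \<in> carrier B \<and> y \<in> carrier B then cnorm B (x \<ominus>\<^bsub>B\<^esub> y) else 0)"

definition norm_topology :: "'b cstar_struct \<Rightarrow> 'b topology"
  where "norm_topology B = Metric_space.mtopology (carrier B) (cdist B)"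

definition unital_cstar_algebra :: "'b cstar_struct \<Rightarrow> bool"
  where "unital_cstar_algebra B \<longleftrightarrow>
    Ring.ring B \<and> Module.module complex_alg B \<and>
    (\<forall>c. \<forall>x\<in>carrier B. \<forall>y\<in>carrier B.
       (c \<odot>\<^bsub>B\<^esub> x) \<otimes>\<^bsub>B\<^esub> y = c \<odot>\<^bsub>B\<^esub> (x \<otimes>\<^bsub>B\<^esub> y) \<and>
       x \<otimes>\<^bsub>B\<^esub> (c \<odot>\<^bsub>B\<^esub> y) = c \<odot>\<^bsub>B\<^esub> (x \<otimes>\<^bsub>B\<^esub> y)) \<and>
    star B \<in> carrier B \<rightarrow> carrier B \<and>
    (\<forall>x\<in>carrier B. star B (star B x) = x) \<and>
    (\<forall>x\<in>carrier B. \<forall>y\<in>carrier B.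
       star B (x \<oplus>\<^bsub>B\<^esub> y) = star B x \<oplus>\<^bsub>B\<^esub> star B y \<and>
       star B (x \<otimes>\<^bsub>B\<^esub> y) = star B y \<otimes>\<^bsub>B\<^esub> star B x) \<and>
    (\<forall>c. \<forall>x\<in>carrier B. star B (c \<odot>\<^bsub>B\<^esub> x) = cnj c \<odot>\<^bsub>B\<^esub> star B x) \<and>
    (\<forall>x\<in>carrier B. 0 \<le> cnorm B x \<and> (cnorm B x = 0 \<longleftrightarrow> x = \<zero>\<^bsub>B\<^esub>)) \<and>
    (\<forall>c. \<forall>x\<in>carrier B. cnorm B (c \<odot>\<^bsub>B\<^esub> x) = cmod c * cnorm B x) \<and>
    (\<forall>x\<in>carrier B. \<forall>y\<in>carrier B.
       cnorm B (x \<oplus>\<^bsub>B\<^esub> y) \<le> cnorm B x + cnorm B y \<and>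
       cnorm B (x \<otimes>\<^bsub>B\<^esub> y) \<le> cnorm B x * cnorm B y) \<and>
    (\<forall>x\<in>carrier B. cnorm B (star B x \<otimes>\<^bsub>B\<^esub> x) = (cnorm B x)\<^sup>2) \<and>
    Metric_space.mcomplete (carrier B) (cdist B)"

definition star_hom :: "'b cstar_struct \<Rightarrow> 'c cstar_struct \<Rightarrow> ('b \<Rightarrow> 'c) \<Rightarrow> bool"
  where "star_hom B C f \<longleftrightarrow>
    f \<in> ring_hom B C \<and>
    (\<forall>c. \<forall>x\<in>carrier B. f (c \<odot>\<^bsub>B\<^esub> x) = c \<odot>\<^bsub>C\<^esub> f x) \<and>
    (\<forall>x\<in>carrier B. f (star B x) = star C (f x))"

definition star_iso :: "'b cstar_struct \<Rightarrow> 'c cstar_struct \<Rightarrow> ('b \<Rightarrow> 'c) \<Rightarrow> bool"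
  where "star_iso B C f \<longleftrightarrow> star_hom B C f \<and> bij_betw f (carrier B) (carrier C)"

text \<open>As for every HOL-Algebra module, the fields \<open>mult\<close> and \<open>one\<close> of a Hilbert space carry no
  meaning. The inner product is linear in its first argument.\<close>

record 'h hilbert_struct = "(complex, 'h) module" +
  hinner :: "'h \<Rightarrow> 'h \<Rightarrow> complex"

definition hnorm :: "'h hilbert_struct \<Rightarrow> 'h \<Rightarrow> real"
  where "hnorm H x = sqrt (Re (hinner H x x))"

definition hdist :: "'h hilbert_struct \<Rightarrow> 'h \<Rightarrow> 'h \<Rightarrow> real"
  where "hdist H x y =
    (if x \<in> carrier H \<and> y \<in> carrier H then hnorm H (x \<ominus>\<^bsub>H\<^esub> y) else 0)"

definition hilbert_space :: "'h hilbert_struct \<Rightarrow> bool"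
  where "hilbert_space H \<longleftrightarrow>
    Module.module complex_alg H \<and>
    (\<forall>x\<in>carrier H. \<forall>y\<in>carrier H. \<forall>z\<in>carrier H.
       hinner H (x \<oplus>\<^bsub>H\<^esub> y) z = hinner H x z + hinner H y z) \<and>
    (\<forall>c. \<forall>x\<in>carrier H. \<forall>y\<in>carrier H. hinner H (c \<odot>\<^bsub>H\<^esub> x) y = c * hinner H x y) \<and>
    (\<forall>x\<in>carrier H. \<forall>y\<in>carrier H. hinner H y x = cnj (hinner H x y)) \<and>
    (\<forall>x\<in>carrier H. x \<noteq> \<zero>\<^bsub>H\<^esub> \<longrightarrow> 0 < Re (hinner H x x)) \<and>
    Metric_space.mcomplete (carrier H) (hdist H)"

definition bounded_ops :: "'h hilbert_struct \<Rightarrow> ('h \<Rightarrow> 'h) set"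
  where "bounded_ops H = {T \<in> carrier H \<rightarrow>\<^sub>E carrier H.
    (\<forall>x\<in>carrier H. \<forall>y\<in>carrier H. T (x \<oplus>\<^bsub>H\<^esub> y) = T x \<oplus>\<^bsub>H\<^esub> T y) \<and>
    (\<forall>c. \<forall>x\<in>carrier H. T (c \<odot>\<^bsub>H\<^esub> x) = c \<odot>\<^bsub>H\<^esub> T x) \<and>
    (\<exists>b. \<forall>x\<in>carrier H. hnorm H (T x) \<le> b * hnorm H x)}"

text \<open>The C*-algebra \<open>B(H)\<close>.\<close>

definition op_alg :: "'h hilbert_struct \<Rightarrow> ('h \<Rightarrow> 'h) cstar_struct"
  where "op_alg H =
    \<lparr>carrier = bounded_ops H,
     mult = (\<lambda>S T. \<lambda>x\<in>carrier H. S (T x)),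
     one = (\<lambda>x\<in>carrier H. x),
     zero = (\<lambda>x\<in>carrier H. \<zero>\<^bsub>H\<^esub>),
     add = (\<lambda>S T. \<lambda>x\<in>carrier H. S x \<oplus>\<^bsub>H\<^esub> T x),
     smult = (\<lambda>c T. \<lambda>x\<in>carrier H. c \<odot>\<^bsub>H\<^esub> T x),
     star = (\<lambda>T. THE S. S \<in> bounded_ops H \<and>
       (\<forall>x\<in>carrier H. \<forall>y\<in>carrier H. hinner H (T x) y = hinner H x (S y))),
     cnorm = (\<lambda>T. SUP x\<in>{x \<in> carrier H. hnorm H x \<le> 1}. hnorm H (T x))\<rparr>"


section \<open>Completely positive and completely isometric maps\<close>

text \<open>\<open>M\<^sub>m(B)\<close>. Its C*-norm is the operator norm of its (faithful) action on the Hilbert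
  \<open>B\<close>-module \<open>B\<^sup>m\<close> of columns, where \<open>\<parallel>x\<parallel>\<^sup>2 = \<parallel>\<Sum>\<^sub>i x\<^sub>i\<^sup>* x\<^sub>i\<parallel>\<close>.\<close>

definition column_norm :: "nat \<Rightarrow> 'b cstar_struct \<Rightarrow> (nat \<Rightarrow> 'b) \<Rightarrow> real"
  where "column_norm m B x =
    sqrt (cnorm B (\<Oplus>\<^bsub>B\<^esub>i\<in>{..<m}. star B (x i) \<otimes>\<^bsub>B\<^esub> x i))"

definition mat_over :: "nat \<Rightarrow> 'b cstar_struct \<Rightarrow> (nat \<times> nat \<Rightarrow> 'b) cstar_struct"
  where "mat_over m B =
    \<lparr>carrier = {..<m} \<times> {..<m} \<rightarrow>\<^sub>E carrier B,
     mult = (\<lambda>a b. \<lambda>(i, j)\<in>{..<m} \<times> {..<m}. \<Oplus>\<^bsub>B\<^esub>k\<in>{..<m}. a (i, k) \<otimes>\<^bsub>B\<^esub> b (k, j)),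
     one = (\<lambda>(i, j)\<in>{..<m} \<times> {..<m}. if i = j then \<one>\<^bsub>B\<^esub> else \<zero>\<^bsub>B\<^esub>),
     zero = (\<lambda>(i, j)\<in>{..<m} \<times> {..<m}. \<zero>\<^bsub>B\<^esub>),
     add = (\<lambda>a b. \<lambda>(i, j)\<in>{..<m} \<times> {..<m}. a (i, j) \<oplus>\<^bsub>B\<^esub> b (i, j)),
     smult = (\<lambda>c a. \<lambda>(i, j)\<in>{..<m} \<times> {..<m}. c \<odot>\<^bsub>B\<^esub> a (i, j)),
     star = (\<lambda>a. \<lambda>(i, j)\<in>{..<m} \<times> {..<m}. star B (a (j, i))),
     cnorm = (\<lambda>a. SUP x\<in>{x \<in> {..<m} \<rightarrow>\<^sub>E carrier B. column_norm m B x \<le> 1}.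
       column_norm m B (\<lambda>i. \<Oplus>\<^bsub>B\<^esub>j\<in>{..<m}. a (i, j) \<otimes>\<^bsub>B\<^esub> x j))\<rparr>"

definition entrywise :: "nat \<Rightarrow> ('b \<Rightarrow> 'c) \<Rightarrow> (nat \<times> nat \<Rightarrow> 'b) \<Rightarrow> (nat \<times> nat \<Rightarrow> 'c)"
  where "entrywise m f a = (\<lambda>ij\<in>{..<m} \<times> {..<m}. f (a ij))"

definition cstar_positive :: "'b cstar_struct \<Rightarrow> 'b \<Rightarrow> bool"
  where "cstar_positive B a \<longleftrightarrow> (\<exists>x\<in>carrier B. a = star B x \<otimes>\<^bsub>B\<^esub> x)"

definition unital_completely_positive ::
    "'b cstar_struct \<Rightarrow> 'c cstar_struct \<Rightarrow> ('b \<Rightarrow> 'c) \<Rightarrow> bool"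
  where "unital_completely_positive B C f \<longleftrightarrow>
    f \<in> carrier B \<rightarrow> carrier C \<and>
    (\<forall>x\<in>carrier B. \<forall>y\<in>carrier B. f (x \<oplus>\<^bsub>B\<^esub> y) = f x \<oplus>\<^bsub>C\<^esub> f y) \<and>
    (\<forall>c. \<forall>x\<in>carrier B. f (c \<odot>\<^bsub>B\<^esub> x) = c \<odot>\<^bsub>C\<^esub> f x) \<and>
    f \<one>\<^bsub>B\<^esub> = \<one>\<^bsub>C\<^esub> \<and>
    (\<forall>m a. cstar_positive (mat_over m B) a \<longrightarrow> cstar_positive (mat_over m C) (entrywise m f a))"

definition completely_isometric_on ::
    "'b cstar_struct \<Rightarrow> 'c cstar_struct \<Rightarrow> 'b set \<Rightarrow> ('b \<Rightarrow> 'c) \<Rightarrow> bool"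
  where "completely_isometric_on B C A f \<longleftrightarrow>
    (\<forall>m. \<forall>a\<in>{..<m} \<times> {..<m} \<rightarrow>\<^sub>E A.
       cnorm (mat_over m C) (entrywise m f a) = cnorm (mat_over m B) a)"


section \<open>Boundary representations, boundary ideals, C*-envelope\<close>

definition generating_subalgebra :: "'b cstar_struct \<Rightarrow> 'b set \<Rightarrow> bool"
  where "generating_subalgebra B A \<longleftrightarrow>
    unital_cstar_algebra B \<and> A \<subseteq> carrier B \<and> generated_algebra B A \<subseteq> A \<and>
    closedin (norm_topology B) A \<and>
    norm_topology B closure_of generated_algebra B (A \<union> star B ` A) = carrier B"

definition irreducible_representation ::
    "'b cstar_struct \<Rightarrow> 'h hilbert_struct \<Rightarrow> ('b \<Rightarrow> 'h \<Rightarrow> 'h) \<Rightarrow> bool"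
  where "irreducible_representation B H \<rho> \<longleftrightarrow>
    hilbert_space H \<and> carrier H \<noteq> {\<zero>\<^bsub>H\<^esub>} \<and> star_hom B (op_alg H) \<rho> \<and>
    (\<forall>W. submodule W complex_alg H \<and>
         closedin (Metric_space.mtopology (carrier H) (hdist H)) W \<and>
         (\<forall>b\<in>carrier B. \<rho> b ` W \<subseteq> W)
       \<longrightarrow> W = {\<zero>\<^bsub>H\<^esub>} \<or> W = carrier H)"

definition boundary_representation ::
    "'b cstar_struct \<Rightarrow> 'b set \<Rightarrow> 'h hilbert_struct \<Rightarrow> ('b \<Rightarrow> 'h \<Rightarrow> 'h) \<Rightarrow> bool"
  where "boundary_representation B A H \<rho> \<longleftrightarrow>
    irreducible_representation B H \<rho> \<and>
    (\<forall>\<omega>. unital_completely_positive B (op_alg H) \<omega> \<and> (\<forall>a\<in>A. \<omega> a = \<rho> a)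
       \<longrightarrow> (\<forall>b\<in>carrier B. \<omega> b = \<rho> b))"

text \<open>The Hilbert spaces range over all those whose underlying set lies in the type of the elements
  of \<open>B\<close>. Up to unitary equivalence this is no restriction: if \<open>\<rho>\<close> is irreducible on \<open>H\<close> and
  \<open>\<xi> \<noteq> 0\<close>, then \<open>H = \<rho>(B)\<xi>\<close> by Kadison's transitivity theorem, so the set \<open>H\<close> injects into \<open>B\<close>.
  Kernels and the boundary property are invariant under unitary equivalence.\<close>

definition boundary_kernel_intersection :: "'b cstar_struct \<Rightarrow> 'b set \<Rightarrow> 'b set"
  where "boundary_kernel_intersection B A =
    {b \<in> carrier B. \<forall>(H :: 'b hilbert_struct) \<rho>.
       boundary_representation B A H \<rho> \<longrightarrow> \<rho> b = \<zero>\<^bsub>op_alg H\<^esub>}"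

text \<open>\<open>B/J\<close> for a closed ideal \<open>J\<close>; the elements are the cosets. A scalar or the star is
  applied to a coset elementwise, and \<open>J\<close> is added because, for example, \<open>0 \<cdot> X = {0}\<close>.\<close>

definition cstar_quot :: "'b cstar_struct \<Rightarrow> 'b set \<Rightarrow> 'b set cstar_struct"
  where "cstar_quot B J =
    \<lparr>carrier = carrier (B Quot J), mult = mult (B Quot J), one = one (B Quot J),
     zero = zero (B Quot J), add = add (B Quot J),
     smult = (\<lambda>c X. J <+>\<^bsub>B\<^esub> (smult B c ` X)),
     star = (\<lambda>X. J <+>\<^bsub>B\<^esub> (star B ` X)),
     cnorm = (\<lambda>X. Inf (cnorm B ` X))\<rparr>"

definition boundary_ideal :: "'b cstar_struct \<Rightarrow> 'b set \<Rightarrow> 'b set \<Rightarrow> bool"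
  where "boundary_ideal B A J \<longleftrightarrow>
    ideal J B \<and> closedin (norm_topology B) J \<and>
    completely_isometric_on B (cstar_quot B J) A (\<lambda>b. J +>\<^bsub>B\<^esub> b)"

text \<open>By general theory the intersection of the kernels is always the largest boundary ideal. Both
  descriptions are demanded here, and so is the standing hypothesis on the pair \<open>B\<close>, \<open>A\<close>.\<close>

definition is_shilov_boundary_ideal :: "'b cstar_struct \<Rightarrow> 'b set \<Rightarrow> 'b set \<Rightarrow> bool"
  where "is_shilov_boundary_ideal B A J \<longleftrightarrow>
    generating_subalgebra B A \<and>
    J = boundary_kernel_intersection B A \<and>
    boundary_ideal B A J \<and> (\<forall>J'. boundary_ideal B A J' \<longrightarrow> J' \<subseteq> J)"

text \<open>\<open>E\<close>, with the embedding \<open>j\<close> of \<open>A\<close>, is the C*-envelope of \<open>A \<subseteq> B\<close>: it is the quotient of \<open>B\<close>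
  by the Shilov boundary ideal, up to a *-isomorphism compatible with the maps from \<open>A\<close>.\<close>

definition is_cstar_envelope ::
    "'b cstar_struct \<Rightarrow> 'b set \<Rightarrow> 'c cstar_struct \<Rightarrow> ('b \<Rightarrow> 'c) \<Rightarrow> bool"
  where "is_cstar_envelope B A E j \<longleftrightarrow>
    (\<exists>J \<theta>. is_shilov_boundary_ideal B A J \<and> star_iso (cstar_quot B J) E \<theta> \<and>
       (\<forall>a\<in>A. \<theta> (J +>\<^bsub>B\<^esub> a) = j a))"


section \<open>Tuples of matrices and their invariants\<close>

text \<open>The star and norm make \<open>M\<^sub>n(\<complex>)\<close> the C*-algebra of operators on \<open>\<complex>\<^sup>n\<close>. The library's \<open>*\<close> on
  vectors is componentwise, so the matrix product has to be \<open>**\<close>.\<close>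

definition mat_alg :: "(complex^'n^'n) cstar_struct"
  where "mat_alg =
    \<lparr>carrier = UNIV, mult = (**), one = mat 1, zero = 0, add = (+),
     smult = (\<lambda>c A. \<chi> i j. c * A $ i $ j),
     star = (\<lambda>A. \<chi> i j. cnj (A $ j $ i)),
     cnorm = (\<lambda>A. onorm ((*v) A))\<rparr>"

type_synonym ('n, 'd) mtuple = "(((complex, 'n) vec, 'n) vec, 'd) vec"
type_synonym ('n, 'd) mpoint = "(('n, 'd) mtuple \<Rightarrow> complex) \<Rightarrow> complex"

definition conj_mat :: "complex^'n^'n \<Rightarrow> complex^'n^'n \<Rightarrow> complex^'n^'n"
  where "conj_mat s A = matrix_inv s ** A ** s"

definition conj_tuple :: "complex^'n^'n \<Rightarrow> complex^'n^'n^'d \<Rightarrow> complex^'n^'n^'d"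
  where "conj_tuple s z = (\<chi> i. conj_mat s (z $ i))"

text \<open>Scalar matrices act trivially by conjugation, so the orbits of \<open>PU(n)\<close> and the invariants of
  \<open>PGL(n)\<close> are those of \<open>U(n)\<close> and \<open>GL(n)\<close>.\<close>

definition unitary_group :: "(complex^'n^'n) set"
  where "unitary_group = {k. star mat_alg k ** k = mat 1}"

definition gen_tuples :: "(complex^'n^'n^'d) set"  \<comment> \<open>\<open>\<V>(d,n)\<close>\<close>
  where "gen_tuples = {z. generated_algebra mat_alg (range (($) z)) = UNIV}"

definition polynomial_functions :: "(complex^'n^'n^'d \<Rightarrow> complex) set"
  where "polynomial_functions =
    generated_algebra (fun_alg complex_alg) {f. \<exists>i j k. f = (\<lambda>z. z $ i $ j $ k)}"

definition invariants :: "(complex^'n^'n^'d \<Rightarrow> complex) set"  \<comment> \<open>\<open>\<I>\<^sub>0(d,n)\<close>\<close>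
  where "invariants =
    {p \<in> polynomial_functions. \<forall>s z. invertible s \<longrightarrow> p (conj_tuple s z) = p z}"

definition generic_matrix_algebra :: "(complex^'n^'n^'d \<Rightarrow> complex^'n^'n) set"
    \<comment> \<open>\<open>\<G>\<^sub>0(d,n)\<close>\<close>
  where "generic_matrix_algebra =
    generated_algebra (fun_alg mat_alg) {f. \<exists>i. f = (\<lambda>z. z $ i)}"

definition trace_algebra :: "(complex^'n^'n^'d \<Rightarrow> complex^'n^'n) set"  \<comment> \<open>\<open>\<S>\<^sub>0(d,n)\<close>\<close>
  where "trace_algebra =
    generated_algebra (fun_alg mat_alg)
      (generic_matrix_algebra \<union> (\<lambda>p z. mat (p z)) ` invariants)"


section \<open>The quotient variety, domains and Shilov boundaries\<close>

text \<open>The points of \<open>Q(d,n)\<close> are the complex characters of \<open>\<I>\<^sub>0(d,n)\<close>, which by the Nullstellensatz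
  are its maximal ideals. The analytic topology is the weakest one making all regular functions
  continuous, that is, the topology of pointwise convergence on \<open>\<I>\<^sub>0(d,n)\<close>.\<close>

definition Q_points :: "('n::finite, 'd::finite) mpoint set"
  where "Q_points = {u \<in> extensional invariants.
    u (\<lambda>z. 1) = 1 \<and>
    (\<forall>p\<in>invariants. \<forall>q\<in>invariants. u (\<lambda>z. p z + q z) = u p + u q) \<and>
    (\<forall>p\<in>invariants. \<forall>q\<in>invariants. u (\<lambda>z. p z * q z) = u p * u q) \<and>
    (\<forall>c. \<forall>p\<in>invariants. u (\<lambda>z. c * p z) = c * u p)}"

definition Q_space :: "('n::finite, 'd::finite) mpoint topology"
  where "Q_space = subtopology (product_topology (\<lambda>p. euclidean) invariants) Q_points"

definition pi0 :: "complex^'n^'n^'d \<Rightarrow> ('n::finite, 'd::finite) mpoint"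
  where "pi0 z = (\<lambda>p\<in>invariants. p z)"

definition Q0 :: "('n::finite, 'd::finite) mpoint set"
  where "Q0 = pi0 ` gen_tuples"

definition domain_in :: "'a topology \<Rightarrow> 'a set \<Rightarrow> bool"
  where "domain_in X D \<longleftrightarrow> openin X D \<and> connectedin X D \<and> D \<noteq> {}"

definition function_algebra ::
    "('n::finite, 'd::finite) mpoint set \<Rightarrow> (('n, 'd) mpoint \<Rightarrow> complex) set"
    \<comment> \<open>\<open>\<I>(\<D>;d,n)\<close>\<close>
  where "function_algebra D = (let X = Q_space closure_of D in
    {f \<in> extensional X. continuous_map (subtopology Q_space X) euclidean f \<and>
       (\<forall>\<epsilon>>0. \<exists>p\<in>invariants. \<forall>u\<in>X. cmod (f u - u p) < \<epsilon>)})"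

text \<open>The smallest closed subset on which every function of \<open>\<A>\<close> attains its maximum modulus; by
  Shilov's theorem it is the intersection of all such subsets.\<close>

definition shilov_boundary :: "'a topology \<Rightarrow> ('a \<Rightarrow> complex) set \<Rightarrow> 'a set"
  where "shilov_boundary X \<A> =
    \<Inter>{F. closedin X F \<and> (\<forall>f\<in>\<A>. \<forall>x\<in>topspace X. \<exists>y\<in>F. cmod (f x) \<le> cmod (f y))}"

definition boundary :: "('n::finite, 'd::finite) mpoint set \<Rightarrow> ('n, 'd) mpoint set"
    \<comment> \<open>\<open>\<partial>\<D>\<close>, not the topological boundary\<close>
  where "boundary D =
    shilov_boundary (subtopology Q_space (Q_space closure_of D)) (function_algebra D)"


section \<open>Reductions, the associated matrix bundle and its sections\<close>

definition quotient_topology :: "'a topology \<Rightarrow> ('a \<Rightarrow> 'b) \<Rightarrow> 'b topology"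
  where "quotient_topology X f =
    topology (\<lambda>U. U \<subseteq> f ` topspace X \<and> openin X {x \<in> topspace X. f x \<in> U})"

lemma openin_quotient_topology:
  "openin (quotient_topology X f) U \<longleftrightarrow>
     U \<subseteq> f ` topspace X \<and> openin X {x \<in> topspace X. f x \<in> U}"
proof -
  have "openin X {x \<in> topspace X. f x \<in> \<Union>\<K>}"
    if "\<forall>K\<in>\<K>. openin X {x \<in> topspace X. f x \<in> K}" for \<K>
  proof -
    have "{x \<in> topspace X. f x \<in> \<Union>\<K>} = \<Union>((\<lambda>K. {x \<in> topspace X. f x \<in> K}) ` \<K>)"
      by blast
    then show ?thesis
      using that by (auto intro: openin_Union)
  qed
  moreover have "openin X {x \<in> topspace X. f x \<in> S \<inter> T}"
    if "openin X {x \<in> topspace X. f x \<in> S}" "openin X {x \<in> topspace X. f x \<in> T}" for S T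
  proof -
    have "{x \<in> topspace X. f x \<in> S \<inter> T}
        = {x \<in> topspace X. f x \<in> S} \<inter> {x \<in> topspace X. f x \<in> T}"
      by blast
    then show ?thesis
      using that by auto
  qed
  ultimately have "istopology (\<lambda>U. U \<subseteq> f ` topspace X \<and> openin X {x \<in> topspace X. f x \<in> U})"
    unfolding istopology_def by (smt (verit) Sup_least inf.coboundedI1)
  then show ?thesis
    by (simp add: quotient_topology_def)
qed

definition is_reduction ::
    "(complex^'n^'n^'d) set \<Rightarrow> ('n::finite, 'd::finite) mpoint set \<Rightarrow> bool"
  where "is_reduction P X \<longleftrightarrow>
    compact P \<and> P \<subseteq> gen_tuples \<and>
    (\<forall>k\<in>unitary_group. \<forall>z\<in>P. conj_tuple k z \<in> P) \<and>
    quotient_map (top_of_set P) (subtopology Q_space X) pi0 \<and>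
    (\<forall>z\<in>P. \<forall>w\<in>P. pi0 z = pi0 w \<longrightarrow> (\<exists>k\<in>unitary_group. w = conj_tuple k z))"

text \<open>The point \<open>[z, A]\<close> of \<open>\<P> \<times>\<^sub>K M\<^sub>n(\<complex>)\<close>, as an orbit.\<close>

definition bundle_point ::
    "complex^'n^'n^'d \<Rightarrow> complex^'n^'n \<Rightarrow> ((complex^'n^'n^'d) \<times> (complex^'n^'n)) set"
  where "bundle_point z A = (\<lambda>k. (conj_tuple k z, conj_mat k A)) ` unitary_group"

type_synonym ('n, 'd) bundle_section =
  "('n, 'd) mpoint \<Rightarrow> (('n, 'd) mtuple \<times> ((complex, 'n) vec, 'n) vec) set"

definition bundle_space ::
    "(complex^'n^'n^'d) set \<Rightarrow> ((complex^'n^'n^'d) \<times> (complex^'n^'n)) set topology"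
  where "bundle_space P =
    quotient_topology (top_of_set (P \<times> UNIV)) (\<lambda>(z, A). bundle_point z A)"

definition bundle_proj ::
    "((complex^'n^'n^'d) \<times> (complex^'n^'n)) set \<Rightarrow> ('n::finite, 'd::finite) mpoint"
  where "bundle_proj e = the_elem ((pi0 \<circ> fst) ` e)"

text \<open>\<open>\<Gamma>\<^sub>c(Y, \<MM>\<^sup>*(\<PP>;d,n))\<close>. An element of a fibre is an orbit \<open>e\<close>; as \<open>K\<close> acts freely on \<open>\<P>\<close>, it is
  the graph of a function on a fibre of \<open>\<P>\<close>, and the operations on \<open>e = [z, A]\<close>, \<open>e' = [z, A']\<close> are
  the pointwise operations on these graphs: \<open>e + e' = {(z, A + A') | (z, A) \<in> e \<and> (z, A') \<in> e'}\<close>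
  and so on. Sections are extended by \<open>undefined\<close> outside \<open>Y\<close>.\<close>

definition section_algebra ::
    "('n::finite, 'd::finite) mpoint set \<Rightarrow> (complex^'n^'n^'d) set \<Rightarrow> ('n, 'd) bundle_section cstar_struct"
  where "section_algebra Y P =
    \<lparr>carrier = {\<sigma> \<in> extensional Y.
       continuous_map (subtopology Q_space Y) (bundle_space P) \<sigma> \<and>
       (\<forall>u\<in>Y. bundle_proj (\<sigma> u) = u)},
     mult = (\<lambda>\<sigma> \<tau>. \<lambda>u\<in>Y.
       {(z, A ** A') | z A A'. (z, A) \<in> \<sigma> u \<and> (z, A') \<in> \<tau> u}),
     one = (\<lambda>u\<in>Y. {(z, mat 1) | z. z \<in> P \<and> pi0 z = u}),
     zero = (\<lambda>u\<in>Y. {(z, 0) | z. z \<in> P \<and> pi0 z = u}),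
     add = (\<lambda>\<sigma> \<tau>. \<lambda>u\<in>Y.
       {(z, A + A') | z A A'. (z, A) \<in> \<sigma> u \<and> (z, A') \<in> \<tau> u}),
     smult = (\<lambda>c \<sigma>. \<lambda>u\<in>Y. {(z, c \<odot>\<^bsub>mat_alg\<^esub> A) | z A. (z, A) \<in> \<sigma> u}),
     star = (\<lambda>\<sigma>. \<lambda>u\<in>Y. {(z, star mat_alg A) | z A. (z, A) \<in> \<sigma> u}),
     cnorm = (\<lambda>\<sigma>. SUP u\<in>Y. the_elem ((cnorm mat_alg \<circ> snd) ` \<sigma> u))\<rparr>"

definition Psi ::
    "('n::finite, 'd::finite) mpoint set \<Rightarrow> (complex^'n^'n^'d) set \<Rightarrow>
     (complex^'n^'n^'d \<Rightarrow> complex^'n^'n) \<Rightarrow> ('n, 'd) bundle_section"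
  where "Psi Y P \<phi> = (\<lambda>u\<in>Y. the_elem ((\<lambda>z. bundle_point z (\<phi> z)) ` {z \<in> P. pi0 z = u}))"

definition tracial_function_algebra ::
    "('n::finite, 'd::finite) mpoint set \<Rightarrow> (complex^'n^'n^'d) set \<Rightarrow> ('n, 'd) bundle_section set"
    \<comment> \<open>\<open>\<S>(\<D>,\<PP>;d,n)\<close>\<close>
  where "tracial_function_algebra D P =
    norm_topology (section_algebra (boundary D) P) closure_of
      (Psi (boundary D) P ` trace_algebra)"

end

theory Submission
  imports Defs
begin

text \<open>
  Since the unitary group acts on each fibre of the reduction with stabilisers that act trivially on
  matrices, a continuous section of the matrix bundle over the Shilov boundary \<open>Y\<close> is the same
  thing as a continuous equivariant matrix function on the part of \<open>P\<close> over \<open>Y\<close>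
  (\<open>carrier_sec\<close>). In this picture the section algebra is visibly a C*-algebra (\<open>B_cstar\<close>).
  The trace algebra generates it (\<open>generating\<close>): by Stone--Weierstrass the invariants and their
  conjugates approximate all scalar functions, the polynomials in the coordinates take all matrix
  values at each point, and a partition of unity combines the two.

  The link to the Shilov boundary is a supply of peak points. If \<open>q = \<Sum>\<^sub>i c\<^sub>i \<bar>f\<^sub>i\<bar>\<^sup>2\<close> for a separating
  sequence of invariants, then every maximum point of \<open>q + t Re g\<close>, with \<open>g\<close> an invariant, is a peak
  point (\<open>peak_point_near_maximum\<close>). For large \<open>t\<close> it lies near the maximum of \<open>Re g\<close>.
  Hence the Shilov boundary is the closure of the peak points (\<open>peak_point_in_boundary\<close>,
  \<open>boundary_subset_closure\<close>).

  Evaluation at a peak point is a boundary representation (\<open>peak_evaluation_unique\<close>,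
  \<open>eval_rep_boundary\<close>). A completely positive extension \<open>\<omega>\<close> of its restriction maps
  invariants to their values, so it kills the nonnegative scalar functions vanishing at the peak point. A section that
  vanishes there is a product \<open>h c'\<close> of such a scalar function \<open>h\<close> with a section \<open>c'\<close>, and positivity of
  the 2 by 2 matrix with entries \<open>\<omega>(h\<^sup>2)\<close>, \<open>\<omega>(h c')\<close> and \<open>\<omega>(c'\<^sup>* c')\<close> forces \<open>\<omega>(h c') = 0\<close>. As peak points are
  dense, the kernels of these representations intersect in 0 (\<open>kernel_intersection\<close>).

  That 0 is also the largest boundary ideal (\<open>boundary_ideal_trivial\<close>) is shown directly: a nonzero
  closed ideal contains a section close to the unit over an open set, and modulo the ideal an
  invariant that peaks in this set has strictly smaller norm.
\<close>

section \<open>The operator norm on matrices\<close>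

text \<open>Operator norm, conjugate transpose and complex scalar multiplication of matrices: names for the
  fields \<open>cnorm\<close>, \<open>star\<close> and \<open>smult\<close> of \<open>mat_alg\<close>.\<close>

definition opn :: "complex^'n^'n \<Rightarrow> real" where "opn A = onorm ((*v) A)"

definition adj :: "complex^'n^'n \<Rightarrow> complex^'n^'n" where "adj A = (\<chi> i j. cnj (A $ j $ i))"

definition cscale :: "complex \<Rightarrow> complex^'n^'n \<Rightarrow> complex^'n^'n"
  where "cscale c A = (\<chi> i j. c * A $ i $ j)"

lemma mat_alg_simps [simp]:
  "carrier mat_alg = UNIV" "mult mat_alg = (**)" "one mat_alg = mat 1" "zero mat_alg = 0"
  "add mat_alg = (+)" "smult mat_alg = cscale" "star mat_alg = adj" "cnorm mat_alg = opn"
  by (auto simp: mat_alg_def fun_eq_iff opn_def adj_def cscale_def)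

lemma adj_adj [simp]: "adj (adj A) = A"
  by (simp add: adj_def vec_eq_iff)
lemma adj_add [simp]: "adj (A + B) = adj A + adj B"
  by (simp add: adj_def vec_eq_iff)
lemma adj_diff [simp]: "adj (A - B) = adj A - adj B"
  by (simp add: adj_def vec_eq_iff)
lemma adj_zero [simp]: "adj 0 = 0"
  by (simp add: adj_def vec_eq_iff)
lemma adj_mat [simp]: "adj (mat c) = mat (cnj c)"
  by (auto simp add: adj_def vec_eq_iff mat_def)
lemma adj_mult [simp]: "adj (A ** B) = adj B ** adj A"
  by (simp add: adj_def vec_eq_iff matrix_matrix_mult_def mult.commute)
lemma adj_cscale [simp]: "adj (cscale c A) = cscale (cnj c) (adj A)"
  by (simp add: adj_def vec_eq_iff cscale_def)

lemma cscale_eq_mult: "cscale c A = mat c ** A" "cscale c A = A ** mat c"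
  by (simp_all add: cscale_def mat_def matrix_matrix_mult_def vec_eq_iff if_distrib if_distribR
      sum.delta' mult.commute cong: if_cong)

lemma cscale_simps [simp]:
  "cscale 0 A = 0" "cscale 1 A = A" "cscale c 0 = 0" "cscale c (cscale d A) = cscale (c * d) A"
  "cscale c (mat d) = mat (c * d)" "cscale c (mat 1) = mat c"
  by (simp_all add: cscale_def vec_eq_iff mat_def)
lemma matrix_mult_add_left: "(A + B) ** C = A ** C + B ** C" for C :: "complex^'n^'n"
  by (simp add: matrix_matrix_mult_def vec_eq_iff algebra_simps sum.distrib)
lemma matrix_mult_diff:
  "(A - B) ** C = A ** C - B ** C" "C ** (A - B) = C ** A - C ** B" for C :: "complex^'n^'n"
  by (simp_all add: matrix_matrix_mult_def vec_eq_iff algebra_simps sum_subtractf)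
lemma cscale_add: "cscale c (A + B) = cscale c A + cscale c B"
  by (simp add: cscale_def vec_eq_iff algebra_simps)
lemma cscale_add_left: "cscale (c + d) A = cscale c A + cscale d A"
  by (simp add: cscale_def vec_eq_iff algebra_simps)
lemma cscale_diff: "cscale c (A - B) = cscale c A - cscale c B"
  by (simp add: cscale_def vec_eq_iff algebra_simps)
lemma cscale_diff_left: "cscale (c - d) A = cscale c A - cscale d A"
  by (simp add: cscale_def vec_eq_iff algebra_simps)
lemma cscale_mult_left: "cscale c A ** B = cscale c (A ** B)"
  by (simp add: cscale_eq_mult(1) matrix_mul_assoc)
lemma cscale_mult_right: "A ** cscale c B = cscale c (A ** B)"
  by (metis cscale_eq_mult(2) matrix_mul_assoc)
lemma cscale_of_real: "cscale (of_real r) A = r *\<^sub>R A"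
  unfolding cscale_def vec_eq_iff vector_scaleR_component by (simp add: scaleR_conv_of_real)
lemma cscale_vec: "cscale c A *v v = c *s (A *v v)"
  by (simp add: cscale_def matrix_vector_mult_def vec_eq_iff sum_distrib_left mult.assoc)
lemma mat_vec: "mat c *v v = c *s v" for v :: "complex^'n"
  using cscale_vec[of c "mat 1" v] by simp
lemma norm_smult: "norm (c *s (v::complex^'n)) = cmod c * norm v"
  by (simp add: norm_vec_def L2_set_def norm_mult power_mult_distrib
      flip: sum_distrib_left real_sqrt_mult) (simp add: real_sqrt_mult)

text \<open>The real inner product of the library is the real part of the Hermitian one; the adjoint is the
  same for both, and the real one suffices for all norm estimates.\<close>

lemma inner_adj: "(A *v x) \<bullet> y = x \<bullet> (adj A *v y)" for A :: "complex^'n^'n"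
proof -
  have "(A *v x) \<bullet> y = (\<Sum>i\<in>UNIV. \<Sum>j\<in>UNIV. Re (A$i$j * x$j * cnj (y$i)))"
    by (simp add: inner_vec_def matrix_vector_mult_def inner_complex_def sum_distrib_right
        flip: sum.distrib)
  also have "\<dots> = (\<Sum>j\<in>UNIV. \<Sum>i\<in>UNIV. Re (A$i$j * x$j * cnj (y$i)))"
    by (rule sum.swap)
  also have "\<dots> = x \<bullet> (adj A *v y)"
    by (simp add: inner_vec_def matrix_vector_mult_def inner_complex_def sum_distrib_left
        adj_def algebra_simps flip: sum.distrib)
  finally show ?thesis .
qed

lemma bl_mv [simp]: "bounded_linear ((*v) A)" for A :: "complex^'n^'n"
  by (rule matrix_vector_mul_bounded_linear)

lemma opn_bound: "norm (A *v v) \<le> opn A * norm v"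
  unfolding opn_def by (rule onorm) simp
lemma opn_le: "(\<And>v. norm (A *v v) \<le> b * norm v) \<Longrightarrow> opn A \<le> b"
  unfolding opn_def by (rule onorm_le)
lemma opn_nonneg [simp]: "0 \<le> opn A"
  unfolding opn_def by (rule onorm_pos_le) simp
lemma opn_eq_0 [simp]: "opn A = 0 \<longleftrightarrow> A = 0"
  unfolding opn_def by (simp add: onorm_eq_0) (metis matrix_vector_mult_0 matrix_vector_mul_lid matrix_eq)
lemma opn_zero [simp]: "opn 0 = 0" by simp
lemma opn_triangle: "opn (A + B) \<le> opn A + opn B"
  unfolding opn_def matrix_vector_mult_add_rdistrib[abs_def] by (rule onorm_triangle) simp_all
lemma opn_cscale: "opn (cscale c A) = cmod c * opn A"
proof (cases "c = 0")
  case False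
  have le: "opn (cscale c A) \<le> cmod c * opn A" for c and A :: "complex^'n^'n"
    by (rule opn_le) (simp add: cscale_vec norm_smult opn_bound mult_left_mono mult.assoc)
  from le[of "1/c" "cscale c A"] False have "cmod c * opn A \<le> opn (cscale c A)"
    by (simp add: norm_divide field_simps)
  then show ?thesis using le[of c A] by linarith
qed simp
lemma opn_minus: "opn (A - B) = opn (B - A)"
  using opn_cscale[of "-1" "A - B"] cscale_of_real[of "-1" "A - B"] by simp
lemma opn_mult: "opn (A ** B) \<le> opn A * opn B"
proof (rule opn_le)
  fix v show "norm (A ** B *v v) \<le> opn A * opn B * norm v"
    using opn_bound[of A "B *v v"] mult_left_mono[OF opn_bound[of B v] opn_nonneg[of A]]
    by (simp add: matrix_vector_mul_assoc mult.assoc)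
qed
lemma opn_mat [simp]: "opn (mat c :: complex^'n^'n) = cmod c"
proof -
  have "opn (mat 1 :: complex^'n^'n) \<le> 1" by (rule opn_le) simp
  moreover have "norm (axis undefined 1 :: complex^'n) \<le> opn (mat 1 :: complex^'n^'n)"
    using opn_bound[of "mat 1" "axis undefined 1 :: complex^'n"] by simp
  ultimately have "opn (mat 1 :: complex^'n^'n) = 1" by simp
  then show ?thesis using opn_cscale[of c "mat 1 :: complex^'n^'n"] by (simp del: cscale_simps(5))
qed

lemma norm_mv_sq: "(norm (A *v v))\<^sup>2 = v \<bullet> (adj A ** A *v v)"
  by (simp add: power2_norm_eq_inner inner_adj matrix_vector_mul_assoc)

lemma opn_adj_mult_ge: "(opn A)\<^sup>2 \<le> opn (adj A ** A)"
proof -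
  have "norm (A *v v) \<le> sqrt (opn (adj A ** A)) * norm v" for v
  proof (rule power2_le_imp_le)
    have "(norm (A *v v))\<^sup>2 \<le> norm v * norm (adj A ** A *v v)"
      unfolding norm_mv_sq by (rule norm_cauchy_schwarz)
    also have "\<dots> \<le> norm v * (opn (adj A ** A) * norm v)"
      by (intro mult_left_mono opn_bound) simp
    finally show "(norm (A *v v))\<^sup>2 \<le> (sqrt (opn (adj A ** A)) * norm v)\<^sup>2"
      by (simp add: power_mult_distrib power2_eq_square algebra_simps)
  qed simp
  then have "opn A \<le> sqrt (opn (adj A ** A))" by (rule opn_le)
  then have "(opn A)\<^sup>2 \<le> (sqrt (opn (adj A ** A)))\<^sup>2" by (intro power_mono) simp_all
  then show ?thesis by simp
qed

lemma opn_adj [simp]: "opn (adj A) = opn A"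
proof -
  have le: "opn B \<le> opn (adj B)" for B :: "complex^'n^'n"
  proof (cases "opn B = 0")
    case False
    have "opn B * opn B \<le> opn (adj B) * opn B"
      using opn_adj_mult_ge[of B] opn_mult[of "adj B" B] by (simp add: power2_eq_square)
    then show ?thesis using False opn_nonneg[of B] by (metis mult_right_le_imp_le order_le_less)
  qed (metis opn_nonneg)
  show ?thesis using le[of A] le[of "adj A"] by simp
qed

lemma opn_cstar: "opn (adj A ** A) = (opn A)\<^sup>2"
  using opn_adj_mult_ge[of A] opn_mult[of "adj A" A] by (simp add: power2_eq_square)

lemma mv_axis: "(A *v axis j 1) $ i = (A::complex^'n^'n) $ i $ j"
  by (simp add: matrix_vector_mult_def axis_def if_distrib cong: if_cong)

lemma entry_le_opn: "cmod (A $ i $ j) \<le> opn A"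
proof -
  have "cmod ((A *v axis j 1) $ i) \<le> norm (A *v axis j 1)" by (rule Finite_Cartesian_Product.norm_nth_le)
  also have "\<dots> \<le> opn A" using opn_bound[of A "axis j 1"] by simp
  finally show ?thesis by (simp add: mv_axis)
qed

lemma norm_le_opn: "norm A \<le> real (CARD('n))^2 * opn A" for A :: "complex^'n^'n"
proof -
  have "norm A \<le> (\<Sum>i\<in>UNIV. \<Sum>j\<in>UNIV. norm (A$i$j))"
    unfolding norm_vec_def[where x=A]
    by (rule order_trans[OF L2_set_le_sum[OF norm_ge_zero]])
      (intro sum_mono, simp add: norm_vec_def L2_set_le_sum)
  also have "\<dots> \<le> (\<Sum>i\<in>(UNIV::'n set). \<Sum>j\<in>(UNIV::'n set). opn A)"
    by (intro sum_mono entry_le_opn)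
  finally show ?thesis by (simp add: power2_eq_square)
qed

lemma opn_le_norm: "opn A \<le> real (CARD('n)) * norm A" for A :: "complex^'n^'n"
proof (rule opn_le)
  fix v :: "complex^'n"
  have "norm (A *v v) \<le> (\<Sum>i\<in>UNIV. norm ((A *v v)$i))"
    unfolding norm_vec_def by (rule L2_set_le_sum) simp
  also have "\<dots> \<le> (\<Sum>i\<in>(UNIV::'n set). norm A * norm v)"
  proof (rule sum_mono)
    fix i
    have "(A *v v)$i = (\<Sum>j\<in>UNIV. A$i$j * v$j)" by (simp add: matrix_vector_mult_def)
    then have "norm ((A *v v)$i) \<le> (\<Sum>j\<in>UNIV. \<bar>norm (A$i$j)\<bar> * \<bar>norm (v$j)\<bar>)"
      by (simp add: norm_mult sum_norm_le)
    also have "\<dots> \<le> norm (A$i) * norm v"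
      unfolding norm_vec_def by (rule L2_set_mult_ineq)
    also have "\<dots> \<le> norm A * norm v"
      by (intro mult_right_mono Finite_Cartesian_Product.norm_nth_le) simp
    finally show "norm ((A *v v)$i) \<le> norm A * norm v" .
  qed
  finally show "norm (A *v v) \<le> real (CARD('n)) * norm A * norm v" by (simp add: mult.assoc)
qed

lemma opn_lipschitz: "\<bar>opn A - opn B\<bar> \<le> opn (A - B)"
  using opn_triangle[of "A - B" B] opn_triangle[of "B - A" A] opn_minus[of A B] by simp

lemma continuous_on_opn [continuous_intros]:
  fixes f :: "'a::topological_space \<Rightarrow> complex^'n^'n"
  assumes "continuous_on S f" shows "continuous_on S (\<lambda>x. opn (f x))"
proof -
  have "continuous_on UNIV (opn :: complex^'n^'n \<Rightarrow> real)"
  proof (rule continuous_onI)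
    fix A :: "complex^'n^'n" and e :: real assume e: "0 < e"
    have "dist (opn B) (opn A) \<le> e" if "dist B A < e / real CARD('n)" for B :: "complex^'n^'n"
    proof -
      have "\<bar>opn B - opn A\<bar> \<le> real CARD('n) * norm (B - A)"
        using opn_lipschitz[of B A] opn_le_norm[of "B - A"] by linarith
      also have "\<dots> \<le> real CARD('n) * (e / real CARD('n))"
        using that by (intro mult_left_mono) (simp_all add: dist_norm)
      also have "\<dots> = e" by simp
      finally show ?thesis by (simp add: dist_real_def)
    qed
    then show "\<exists>d>0. \<forall>x'\<in>UNIV. dist x' A < d \<longrightarrow> dist (opn x') (opn A) \<le> e"
      using e by (intro exI[of _ "e / real CARD('n)"]) simp
  qed
  then show ?thesis using assms by (rule continuous_on_compose2) auto
qed

lemma continuous_on_mult_mat [continuous_intros]: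
  fixes f g :: "'a::topological_space \<Rightarrow> complex^'n^'n"
  assumes "continuous_on S f" "continuous_on S g" shows "continuous_on S (\<lambda>x. f x ** g x)"
  unfolding matrix_matrix_mult_def by (intro continuous_intros assms)
lemma continuous_on_adj [continuous_intros]:
  fixes f :: "'a::topological_space \<Rightarrow> complex^'n^'n"
  assumes "continuous_on S f" shows "continuous_on S (\<lambda>x. adj (f x))"
  unfolding adj_def by (intro continuous_intros assms)
lemma continuous_on_cscale [continuous_intros]:
  fixes f :: "'a::topological_space \<Rightarrow> complex^'n^'n"
  assumes "continuous_on S f" "continuous_on S c" shows "continuous_on S (\<lambda>x. cscale (c x) (f x))"
  unfolding cscale_def by (intro continuous_intros assms)
lemma continuous_on_mat [continuous_intros]:
  fixes c :: "'a::topological_space \<Rightarrow> complex"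
  assumes "continuous_on S c" shows "continuous_on S (\<lambda>x. mat (c x) :: complex^'n^'n)"
proof -
  have "continuous_on S (\<lambda>x. cscale (c x) (mat 1 :: complex^'n^'n))"
    by (intro continuous_intros assms)
  then show ?thesis by simp
qed

section \<open>Unitary conjugation\<close>

lemma unitary_iff: "k \<in> unitary_group \<longleftrightarrow> adj k ** k = mat 1"
  by (simp add: unitary_group_def)
lemma unitary_right: "k \<in> unitary_group \<Longrightarrow> k ** adj k = mat 1"
  by (simp add: unitary_iff matrix_left_right_inverse)
lemma matrix_inv_eq:
  fixes s :: "complex^'n^'n"
  assumes "invertible s" shows "s ** matrix_inv s = mat 1" "matrix_inv s ** s = mat 1"
  using someI_ex[OF assms[unfolded invertible_def]] unfolding matrix_inv_def by auto
lemma unitary_invertible: "k \<in> unitary_group \<Longrightarrow> invertible k"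
  unfolding invertible_def using unitary_iff unitary_right by blast
lemma unitary_inv: "k \<in> unitary_group \<Longrightarrow> matrix_inv k = adj k"
  by (metis unitary_iff matrix_inv_eq(1) matrix_mul_assoc matrix_mul_lid matrix_mul_rid unitary_invertible)
lemma unitary_one [simp]: "mat 1 \<in> unitary_group" by (simp add: unitary_iff)
lemma unitary_adj: "k \<in> unitary_group \<Longrightarrow> adj k \<in> unitary_group"
  by (simp add: unitary_iff unitary_right[unfolded unitary_iff])
lemma unitary_mult: "k \<in> unitary_group \<Longrightarrow> l \<in> unitary_group \<Longrightarrow> k ** l \<in> unitary_group"
  by (metis (no_types, lifting) adj_mult matrix_mul_assoc matrix_mul_lid unitary_iff)
lemma conj_unitary: "k \<in> unitary_group \<Longrightarrow> conj_mat k A = adj k ** A ** k"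
  by (simp add: conj_mat_def unitary_inv)
lemma conj_one [simp]: "conj_mat (mat 1) A = A" "conj_tuple (mat 1) z = z"
proof -
  show *: "conj_mat (mat 1) A = A" for A :: "complex^'m^'m" by (subst conj_unitary) auto
  show "conj_tuple (mat 1) z = z" by (simp add: conj_tuple_def *)
qed

lemma conj_mat_invertible:
  assumes "invertible s"
  shows "conj_mat s (A + B) = conj_mat s A + conj_mat s B"
    "conj_mat s (A ** B) = conj_mat s A ** conj_mat s B"
    "conj_mat s (cscale c A) = cscale c (conj_mat s A)" "conj_mat s (mat c) = mat c"
proof -
  note i = matrix_inv_eq[OF assms]
  show "conj_mat s (A + B) = conj_mat s A + conj_mat s B"
    by (simp add: conj_mat_def matrix_add_ldistrib matrix_mult_add_left)
  show "conj_mat s (A ** B) = conj_mat s A ** conj_mat s B"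
    unfolding conj_mat_def by (metis i(1) matrix_mul_assoc matrix_mul_rid)
  show "conj_mat s (cscale c A) = cscale c (conj_mat s A)"
    by (simp add: conj_mat_def cscale_mult_left cscale_mult_right)
  show "conj_mat s (mat c) = mat c"
    unfolding conj_mat_def by (metis cscale_eq_mult cscale_simps(6) i(2) matrix_mul_assoc)
qed

lemma conj_conj: 
  assumes "k \<in> unitary_group" "l \<in> unitary_group"
  shows "conj_mat l (conj_mat k A) = conj_mat (k ** l) A"
    "conj_tuple l (conj_tuple k z) = conj_tuple (k ** l) z"
proof -
  show *: "conj_mat l (conj_mat k A) = conj_mat (k ** l) A" for A
    using assms by (simp add: conj_unitary unitary_mult matrix_mul_assoc)
  show "conj_tuple l (conj_tuple k z) = conj_tuple (k ** l) z"
    by (simp add: conj_tuple_def *)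
qed

lemma conj_adj: "k \<in> unitary_group \<Longrightarrow> conj_mat k (adj A) = adj (conj_mat k A)"
  by (simp add: conj_unitary matrix_mul_assoc)

lemma opn_unitary: "k \<in> unitary_group \<Longrightarrow> opn k = 1"
  using opn_cstar[of k] by (simp add: unitary_iff power2_eq_1_iff) (smt (verit) opn_nonneg)

lemma opn_conj: 
  assumes k: "k \<in> unitary_group" shows "opn (conj_mat k A) = opn A"
proof -
  have le: "opn (conj_mat k A) \<le> opn A" if "k \<in> unitary_group" for k and A :: "complex^'n^'n"
  proof -
    have "opn (conj_mat k A) \<le> opn (adj k ** A) * opn k"
      unfolding conj_unitary[OF that] by (rule opn_mult)
    also have "\<dots> \<le> opn (adj k) * opn A"
      using opn_mult[of "adj k" A] by (simp add: opn_unitary[OF that])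
    finally show ?thesis by (simp add: opn_unitary[OF that])
  qed
  have "A = conj_mat (adj k) (conj_mat k A)"
    by (simp add: conj_conj unitary_adj k unitary_right)
  then show ?thesis using le[OF k, of A] le[OF unitary_adj[OF k], of "conj_mat k A"] by simp
qed

section \<open>Polynomial invariants and the trace algebra\<close>

lemma complex_alg_simps [simp]:
  "carrier complex_alg = UNIV" "mult complex_alg = (*)" "one complex_alg = 1"
  "zero complex_alg = 0" "add complex_alg = (+)" "smult complex_alg = (*)"
  by (auto simp: complex_alg_def)

lemma cring_complex_alg: "cring complex_alg"
  by (rule cringI)
    (auto intro!: abelian_groupI comm_monoidI exI[of _ "- x" for x] simp: algebra_simps)

lemma fun_alg_simps [simp]:
  "mult (fun_alg B) = (\<lambda>f g x. f x \<otimes>\<^bsub>B\<^esub> g x)" "one (fun_alg B) = (\<lambda>x. \<one>\<^bsub>B\<^esub>)"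
  "add (fun_alg B) = (\<lambda>f g x. f x \<oplus>\<^bsub>B\<^esub> g x)"
  "smult (fun_alg B) = (\<lambda>c f x. c \<odot>\<^bsub>B\<^esub> f x)"
  by (auto simp: fun_alg_def)

lemma polynomial_functions_intros:
  "p \<in> polynomial_functions \<Longrightarrow> q \<in> polynomial_functions \<Longrightarrow> (\<lambda>z. p z + q z) \<in> polynomial_functions"
  "p \<in> polynomial_functions \<Longrightarrow> q \<in> polynomial_functions \<Longrightarrow> (\<lambda>z. p z * q z) \<in> polynomial_functions"
  "p \<in> polynomial_functions \<Longrightarrow> (\<lambda>z. c * p z) \<in> polynomial_functions"
  "(\<lambda>z. c) \<in> polynomial_functions"
  using generated_algebra.intros(3,4,5)[of _ "fun_alg complex_alg"]
    generated_algebra.gen_smult[OF generated_algebra.gen_one[of "fun_alg complex_alg"], of c]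
  by (auto simp: polynomial_functions_def)

lemma polynomial_functions_continuous:
  assumes "p \<in> polynomial_functions" shows "continuous_on S p"
  using assms unfolding polynomial_functions_def
  by (induction rule: generated_algebra.induct) (auto intro!: continuous_intros)

lemma invariants_intros:
  "p \<in> invariants \<Longrightarrow> q \<in> invariants \<Longrightarrow> (\<lambda>z. p z + q z) \<in> invariants"
  "p \<in> invariants \<Longrightarrow> q \<in> invariants \<Longrightarrow> (\<lambda>z. p z * q z) \<in> invariants"
  "p \<in> invariants \<Longrightarrow> (\<lambda>z. c * p z) \<in> invariants"
  "(\<lambda>z. c) \<in> invariants"
  using polynomial_functions_intros by (auto simp: invariants_def)

lemma invariants_sum:
  "(\<And>i. i \<in> I \<Longrightarrow> p i \<in> invariants) \<Longrightarrow> (\<lambda>z. \<Sum>i\<in>I. p i z) \<in> invariants"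
  by (induction I rule: infinite_finite_induct) (auto intro: invariants_intros)

lemma invariants_continuous: "p \<in> invariants \<Longrightarrow> continuous_on S p"
  by (simp add: invariants_def polynomial_functions_continuous)

lemma invariants_conj: "p \<in> invariants \<Longrightarrow> k \<in> unitary_group \<Longrightarrow> p (conj_tuple k z) = p z"
  using unitary_invertible by (auto simp: invariants_def)

lemma pi0_apply: "p \<in> invariants \<Longrightarrow> pi0 z p = p z"
  by (simp add: pi0_def)

lemma pi0_conj: "k \<in> unitary_group \<Longrightarrow> pi0 (conj_tuple k z) = pi0 z"
  by (auto simp: pi0_def fun_eq_iff invariants_conj)

lemma pi0_separates: "pi0 z \<noteq> pi0 w \<Longrightarrow> \<exists>p\<in>invariants. p z \<noteq> p w"
  by (auto simp: pi0_def fun_eq_iff split: if_splits)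

lemma generic_subset_trace: "generic_matrix_algebra \<subseteq> trace_algebra"
  by (auto simp: trace_algebra_def intro: generated_algebra.gen_base)

lemma trace_algebra_intros:
  "p \<in> invariants \<Longrightarrow> (\<lambda>z. mat (p z)) \<in> trace_algebra"
  "(\<lambda>z. mat 1) \<in> trace_algebra"
  "f \<in> trace_algebra \<Longrightarrow> g \<in> trace_algebra \<Longrightarrow> (\<lambda>z. f z + g z) \<in> trace_algebra"
  "f \<in> trace_algebra \<Longrightarrow> g \<in> trace_algebra \<Longrightarrow> (\<lambda>z. f z ** g z) \<in> trace_algebra"
  "f \<in> trace_algebra \<Longrightarrow> (\<lambda>z. cscale c (f z)) \<in> trace_algebra"
  using generated_algebra.intros(1,3,4,5)[where B="fun_alg mat_alg"]
  by (auto simp: trace_algebra_def intro: generated_algebra.gen_base)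

lemma generic_matrix_continuous:
  assumes "f \<in> generic_matrix_algebra" shows "continuous_on S f"
  using assms unfolding generic_matrix_algebra_def
  by (induction rule: generated_algebra.induct) (auto intro!: continuous_intros)

lemma trace_algebra_continuous:
  assumes "f \<in> trace_algebra" shows "continuous_on S f"
  using assms unfolding trace_algebra_def
  by (induction rule: generated_algebra.induct)
    (auto simp: generic_matrix_continuous invariants_continuous intro!: continuous_intros)

lemma generic_matrix_equivariant:
  assumes "f \<in> generic_matrix_algebra" "k \<in> unitary_group"
  shows "f (conj_tuple k z) = conj_mat k (f z)"
  using assms(1) unfolding generic_matrix_algebra_def
  by (induction rule: generated_algebra.induct)
    (auto simp: conj_mat_invertible[OF unitary_invertible[OF assms(2)]] conj_tuple_def)

lemma trace_algebra_equivariant: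
  assumes "f \<in> trace_algebra" and k: "k \<in> unitary_group"
  shows "f (conj_tuple k z) = conj_mat k (f z)"
  using assms(1) unfolding trace_algebra_def
  by (induction rule: generated_algebra.induct)
    (auto simp: conj_mat_invertible[OF unitary_invertible[OF k]] generic_matrix_equivariant[OF _ k]
      invariants_conj[OF _ k])

text \<open>At a generating tuple every matrix is the value of a polynomial in the coordinates. This is the
  only way in which the generation hypothesis enters.\<close>

lemma generic_matrix_surj:
  assumes "z \<in> gen_tuples" obtains f where "f \<in> generic_matrix_algebra" "f z = M"
proof -
  have "M \<in> generated_algebra mat_alg (range (($) z))"
    using assms by (auto simp: gen_tuples_def)
  then have "\<exists>f\<in>generic_matrix_algebra. f z = M"
  proof (induction rule: generated_algebra.induct)
    case gen_one
    show ?case by (rule bexI[of _ "\<lambda>z. mat 1"])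
      (use generated_algebra.gen_one[of "fun_alg mat_alg"] in \<open>auto simp: generic_matrix_algebra_def\<close>)
  next
    case (gen_base x)
    then obtain i where "x = z $ i" by auto
    then show ?case
      by (intro bexI[of _ "\<lambda>z. z $ i"])
        (auto simp: generic_matrix_algebra_def intro: generated_algebra.gen_base)
  next
    case (gen_add x y)
    then obtain f g where "f \<in> generic_matrix_algebra" "f z = x" "g \<in> generic_matrix_algebra" "g z = y"
      by blast
    then show ?case
      using generated_algebra.gen_add[of f "fun_alg mat_alg" _ g]
      by (intro bexI[of _ "\<lambda>z. f z + g z"]) (auto simp: generic_matrix_algebra_def)
  next
    case (gen_mult x y)
    then obtain f g where "f \<in> generic_matrix_algebra" "f z = x" "g \<in> generic_matrix_algebra" "g z = y"
      by blast
    then show ?case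
      using generated_algebra.gen_mult[of f "fun_alg mat_alg" _ g]
      by (intro bexI[of _ "\<lambda>z. f z ** g z"]) (auto simp: generic_matrix_algebra_def)
  next
    case (gen_smult x c)
    then obtain f where "f \<in> generic_matrix_algebra" "f z = x" by blast
    then show ?case
      using generated_algebra.gen_smult[of f "fun_alg mat_alg" _ c]
      by (intro bexI[of _ "\<lambda>z. cscale c (f z)"]) (auto simp: generic_matrix_algebra_def)
  qed
  then show ?thesis using that by blast
qed

text \<open>The stabiliser of a generating tuple consists of scalars, so it acts trivially on matrices.\<close>

lemma conj_mat_stabilizer:
  assumes "z \<in> gen_tuples" "k \<in> unitary_group" "conj_tuple k z = z"
  shows "conj_mat k A = A"
proof -
  obtain f where "f \<in> generic_matrix_algebra" "f z = A" using generic_matrix_surj[OF assms(1)] .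
  then show ?thesis using generic_matrix_equivariant[OF _ assms(2), of f z] assms(3) by simp
qed

text \<open>A countable family of invariants separates whatever the invariants separate, by the
  Lindelof property of the space of pairs of tuples. It takes the place of a finite set of
  generators of the ring of invariants.\<close>

lemma countable_separating_invariants:
  obtains g :: "nat \<Rightarrow> complex^'n::finite^'n^'d::finite \<Rightarrow> complex"
  where "\<And>i. g i \<in> invariants" "\<And>z w. pi0 z \<noteq> pi0 w \<Longrightarrow> \<exists>i. g i z \<noteq> g i w"
proof -
  define V where "V p = {x :: (complex^'n^'n^'d) \<times> (complex^'n^'n^'d). p (fst x) \<noteq> p (snd x)}"
    for p :: "complex^'n^'n^'d \<Rightarrow> complex"
  have op: "openin (top_of_set UNIV) (V p)" if "p \<in> invariants" for p
  proof -
    have "closed {x :: (complex^'n^'n^'d) \<times> (complex^'n^'n^'d). p (fst x) = p (snd x)}"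
      by (intro closed_Collect_eq continuous_on_compose2[OF invariants_continuous[OF that, of UNIV]]
          continuous_intros) auto
    moreover have "V p = - {x. p (fst x) = p (snd x)}" by (auto simp: V_def)
    ultimately show ?thesis by (simp add: open_Compl)
  qed
  obtain F where F: "F \<subseteq> V ` invariants" "countable F" "\<Union>F = \<Union>(V ` invariants)"
    using Lindelof_openin[of "V ` invariants" UNIV] op by blast
  then obtain I where I: "countable I" "I \<subseteq> invariants" "F = V ` I"
    using countable_subset_image by (metis)
  define g where "g i = (if I = {} then (\<lambda>z. 0) else from_nat_into I i)" for i
  have "g i \<in> invariants" for i
    using I(2) from_nat_into[of I i] invariants_intros(4)[of 0] by (auto simp: g_def)
  moreover have "\<exists>i. g i z \<noteq> g i w" if ne: "pi0 z \<noteq> pi0 w" for z w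
  proof -
    obtain p where "p \<in> invariants" "p z \<noteq> p w" using pi0_separates[OF ne] by blast
    then have "(z, w) \<in> \<Union>F" unfolding F(3) by (auto simp: V_def)
    then obtain q where q: "q \<in> I" "q z \<noteq> q w" using I(3) by (auto simp: V_def)
    obtain i where "from_nat_into I i = q" using from_nat_into_surj[OF I(1) q(1)] by blast
    then show ?thesis using q by (intro exI[of _ i]) (auto simp: g_def)
  qed
  ultimately show ?thesis using that by blast
qed

section \<open>Sections as equivariant matrix functions\<close>

lemma topspace_quotient_topology: "topspace (quotient_topology X f) = f ` topspace X"
proof (rule antisym)
  show "topspace (quotient_topology X f) \<subseteq> f ` topspace X"
    using openin_topspace[of "quotient_topology X f"] unfolding openin_quotient_topology by blast
  have "{x \<in> topspace X. f x \<in> f ` topspace X} = topspace X" by auto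
  then have "openin (quotient_topology X f) (f ` topspace X)"
    by (simp add: openin_quotient_topology)
  then show "f ` topspace X \<subseteq> topspace (quotient_topology X f)" by (rule openin_subset)
qed

lemma quotient_map_quotient_topology: "quotient_map X (quotient_topology X f) f"
  unfolding quotient_map_def by (auto simp: topspace_quotient_topology openin_quotient_topology)

lemma bundle_point_self: "(z, A) \<in> bundle_point z A"
  unfolding bundle_point_def by (rule image_eqI[of _ _ "mat 1"]) auto

lemma bundle_point_conj_mem:
  "(w, B) \<in> bundle_point z A \<Longrightarrow> l \<in> unitary_group \<Longrightarrow> (conj_tuple l w, conj_mat l B) \<in> bundle_point z A"
  unfolding bundle_point_def by (auto simp: conj_conj unitary_mult)

lemma bundle_point_conj:
  assumes "k \<in> unitary_group"
  shows "bundle_point (conj_tuple k z) (conj_mat k A) = bundle_point z A"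
proof
  show "bundle_point (conj_tuple k z) (conj_mat k A) \<subseteq> bundle_point z A"
    unfolding bundle_point_def using assms by (auto simp: conj_conj unitary_mult)
  show "bundle_point z A \<subseteq> bundle_point (conj_tuple k z) (conj_mat k A)"
  proof
    fix x assume "x \<in> bundle_point z A"
    then obtain l where l: "l \<in> unitary_group" "x = (conj_tuple l z, conj_mat l A)"
      by (auto simp: bundle_point_def)
    have "k ** (adj k ** l) = l" by (simp add: matrix_mul_assoc unitary_right assms)
    then show "x \<in> bundle_point (conj_tuple k z) (conj_mat k A)"
      unfolding bundle_point_def using l assms
      by (intro image_eqI[of _ _ "adj k ** l"]) (simp_all add: conj_conj unitary_mult unitary_adj)
  qed
qed

text \<open>A point of the bundle, being an orbit, is the graph of a function on a fibre of \<open>P\<close>.\<close>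

lemma bundle_point_graph:
  assumes "z \<in> gen_tuples" "(w, B) \<in> bundle_point z A" "(w, B') \<in> bundle_point z A"
  shows "B = B'"
proof -
  obtain k l where k: "k \<in> unitary_group" "w = conj_tuple k z" "B = conj_mat k A"
    and l: "l \<in> unitary_group" "w = conj_tuple l z" "B' = conj_mat l A"
    using assms(2,3) by (auto simp: bundle_point_def)
  have "conj_tuple (k ** adj l) z = conj_tuple (adj l) w"
    using k l by (simp add: conj_conj unitary_adj)
  also have "\<dots> = conj_tuple (l ** adj l) z" using l by (simp add: conj_conj unitary_adj)
  also have "\<dots> = z" using l by (simp add: unitary_right)
  finally have "conj_mat (k ** adj l) A = A"
    using conj_mat_stabilizer[OF assms(1)] k l by (simp add: unitary_mult unitary_adj)
  then have "B' = conj_mat l (conj_mat (k ** adj l) A)" using l by simp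
  also have "\<dots> = conj_mat (k ** (adj l ** l)) A"
    using k l by (simp add: conj_conj unitary_mult unitary_adj matrix_mul_assoc)
  also have "\<dots> = B" using k l by (simp add: unitary_iff)
  finally show ?thesis by simp
qed

lemma trace_conj: "k \<in> unitary_group \<Longrightarrow> trace (conj_mat k A) = trace A"
  by (metis conj_unitary matrix_mul_assoc matrix_mul_lid trace_mul_sym unitary_right)

lemma cmod_trace_le: "cmod (trace A) \<le> real CARD('n) * opn A" for A :: "complex^'n^'n"
proof -
  have "cmod (trace A) \<le> (\<Sum>i\<in>(UNIV::'n set). opn A)"
    unfolding trace_def by (rule sum_norm_le) (rule entry_le_opn)
  then show ?thesis by simp
qed

lemma trace_matrix_unit:
  "trace (A ** (\<chi> i j. if i = a \<and> j = b then 1 else 0)) = (A :: complex^'n^'n) $ b $ a"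
proof -
  have *: "(A ** (\<chi> i j. if i = a \<and> j = b then 1 else 0)) $ i $ i = (if i = b then A $ i $ a else 0)" for i
    by (simp add: matrix_matrix_mult_def if_distrib cong: if_cong)
  show ?thesis by (simp add: trace_def *)
qed

text \<open>A reduction \<open>P\<close> over a base \<open>X\<close>, and a nonempty closed part \<open>Y\<close> of the base over which
  sections are taken.\<close>

locale reduced_bundle =
  fixes P :: "(complex^'n::finite^'n^'d::finite) set" and X Y :: "('n, 'd) mpoint set"
  assumes reduction: "is_reduction P X"
    and closed_Y: "closedin (subtopology Q_space X) Y"
    and Y_nonempty: "Y \<noteq> {}"
begin

lemma compact_P: "compact P" and P_gen: "z \<in> P \<Longrightarrow> z \<in> gen_tuples"
  and P_conj: "k \<in> unitary_group \<Longrightarrow> z \<in> P \<Longrightarrow> conj_tuple k z \<in> P"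
  and P_quotient: "quotient_map (top_of_set P) (subtopology Q_space X) pi0"
  and P_orbit: "z \<in> P \<Longrightarrow> w \<in> P \<Longrightarrow> pi0 z = pi0 w \<Longrightarrow> \<exists>k\<in>unitary_group. w = conj_tuple k z"
  using reduction by (auto simp: is_reduction_def)

text \<open>The part of \<open>P\<close> over \<open>Y\<close>.\<close>

definition PY :: "(complex^'n^'n^'d) set" where "PY = {z \<in> P. pi0 z \<in> Y}"

lemma PY_conj: "k \<in> unitary_group \<Longrightarrow> z \<in> PY \<Longrightarrow> conj_tuple k z \<in> PY"
  by (simp add: PY_def P_conj pi0_conj)

lemma PY_gen: "z \<in> PY \<Longrightarrow> z \<in> gen_tuples"
  by (simp add: PY_def P_gen)

lemma pi0_P: "pi0 ` P = topspace (subtopology Q_space X)"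
  using quotient_imp_surjective_map[OF P_quotient] by simp

lemma Y_subset: "Y \<subseteq> X" "Y \<subseteq> pi0 ` P"
  using closedin_subset[OF closed_Y] pi0_P by auto

lemma pi0_PY: "pi0 ` PY = Y"
  using Y_subset by (auto simp: PY_def)

lemma in_Y_E: assumes "u \<in> Y" obtains z where "z \<in> PY" "u = pi0 z"
proof -
  have "u \<in> pi0 ` PY" using assms by (simp only: pi0_PY)
  then show ?thesis using that by auto
qed

lemma PY_nonempty: "PY \<noteq> {}"
  using pi0_PY Y_nonempty by auto

lemma closedin_PY: "closedin (top_of_set P) PY"
  using P_quotient closed_Y unfolding quotient_map_closedin PY_def
  by (metis (no_types, lifting) closedin_subset topspace_euclidean_subtopology Collect_cong)

lemma compact_PY: "compact PY"
  using closedin_PY compact_P closedin_compact by blast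

lemma PY_quotient: "quotient_map (top_of_set PY) (subtopology Q_space Y) pi0"
proof -
  have "quotient_map (subtopology (top_of_set P) PY) (subtopology (subtopology Q_space X) Y) pi0"
    by (rule quotient_map_restriction[OF P_quotient])
      (use closed_Y in \<open>auto simp: PY_def\<close>)
  moreover have "P \<inter> PY = PY" "X \<inter> Y = Y" using Y_subset by (auto simp: PY_def)
  ultimately show ?thesis by (simp add: subtopology_subtopology)
qed

text \<open>The equivariant continuous matrix functions on \<open>PY\<close>, and the invariant continuous scalar
  functions. Their values off \<open>PY\<close> are arbitrary.\<close>

definition EF :: "(complex^'n^'n^'d \<Rightarrow> complex^'n^'n) set" where
  "EF = {F. continuous_on PY F \<and>
     (\<forall>z\<in>PY. \<forall>k\<in>unitary_group. F (conj_tuple k z) = conj_mat k (F z))}"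

definition IF :: "(complex^'n^'n^'d \<Rightarrow> complex) set" where
  "IF = {h. continuous_on PY h \<and> (\<forall>z\<in>PY. \<forall>k\<in>unitary_group. h (conj_tuple k z) = h z)}"

text \<open>The section defined by an equivariant function: over \<open>u\<close> it is the graph of \<open>F\<close> on the fibre
  of \<open>P\<close>, which is a single orbit.\<close>

definition sec :: "(complex^'n^'n^'d \<Rightarrow> complex^'n^'n) \<Rightarrow> ('n, 'd) bundle_section" where
  "sec F = (\<lambda>u\<in>Y. {(z, F z) | z. z \<in> P \<and> pi0 z = u})"

text \<open>The algebra of continuous sections over \<open>Y\<close>.\<close>

abbreviation B where "B \<equiv> section_algebra Y P"

lemma sec_eq_iff: "sec F = sec G \<longleftrightarrow> (\<forall>z\<in>PY. F z = G z)"
proof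
  assume eq: "sec F = sec G"
  show "\<forall>z\<in>PY. F z = G z"
  proof
    fix z assume z: "z \<in> PY"
    then have "(z, F z) \<in> sec F (pi0 z)" by (auto simp: sec_def PY_def)
    then show "F z = G z" unfolding eq using z by (auto simp: sec_def PY_def)
  qed
next
  assume "\<forall>z\<in>PY. F z = G z"
  then have "{(z, F z) | z. z \<in> P \<and> pi0 z = u} = {(z, G z) | z. z \<in> P \<and> pi0 z = u}" if "u \<in> Y" for u
    using that by (auto simp: PY_def)
  then show "sec F = sec G" by (auto simp: sec_def fun_eq_iff)
qed

lemma sec_mult: "sec F \<otimes>\<^bsub>B\<^esub> sec G = sec (\<lambda>z. F z ** G z)"
  by (auto simp: section_algebra_def sec_def fun_eq_iff)
lemma sec_add: "sec F \<oplus>\<^bsub>B\<^esub> sec G = sec (\<lambda>z. F z + G z)"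
  by (auto simp: section_algebra_def sec_def fun_eq_iff)
lemma sec_one: "\<one>\<^bsub>B\<^esub> = sec (\<lambda>z. mat 1)"
  by (auto simp: section_algebra_def sec_def fun_eq_iff)
lemma sec_zero: "\<zero>\<^bsub>B\<^esub> = sec (\<lambda>z. 0)"
  by (auto simp: section_algebra_def sec_def fun_eq_iff)
lemma sec_smult: "c \<odot>\<^bsub>B\<^esub> sec F = sec (\<lambda>z. cscale c (F z))"
  by (auto simp: section_algebra_def sec_def fun_eq_iff)
lemma sec_star: "star B (sec F) = sec (\<lambda>z. adj (F z))"
  by (auto simp: section_algebra_def sec_def fun_eq_iff)

lemmas sec_ops = sec_mult sec_add sec_one sec_zero sec_smult sec_star

lemma EF_cont: "F \<in> EF \<Longrightarrow> continuous_on PY F" by (simp add: EF_def)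
lemma IF_cont: "h \<in> IF \<Longrightarrow> continuous_on PY h" by (simp add: IF_def)
lemma EF_conj: "F \<in> EF \<Longrightarrow> z \<in> PY \<Longrightarrow> k \<in> unitary_group \<Longrightarrow> F (conj_tuple k z) = conj_mat k (F z)"
  by (simp add: EF_def)
lemma IF_conj: "h \<in> IF \<Longrightarrow> z \<in> PY \<Longrightarrow> k \<in> unitary_group \<Longrightarrow> h (conj_tuple k z) = h z"
  by (simp add: IF_def)

lemma conj_diff: "k \<in> unitary_group \<Longrightarrow> conj_mat k (A - C) = conj_mat k A - conj_mat k C"
  by (simp add: conj_unitary matrix_mult_diff)

lemma EF_intros:
  "F \<in> EF \<Longrightarrow> G \<in> EF \<Longrightarrow> (\<lambda>z. F z + G z) \<in> EF"
  "F \<in> EF \<Longrightarrow> G \<in> EF \<Longrightarrow> (\<lambda>z. F z - G z) \<in> EF"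
  "F \<in> EF \<Longrightarrow> G \<in> EF \<Longrightarrow> (\<lambda>z. F z ** G z) \<in> EF"
  "h \<in> IF \<Longrightarrow> F \<in> EF \<Longrightarrow> (\<lambda>z. cscale (h z) (F z)) \<in> EF"
  "F \<in> EF \<Longrightarrow> (\<lambda>z. adj (F z)) \<in> EF"
  "h \<in> IF \<Longrightarrow> (\<lambda>z. mat (h z)) \<in> EF"
  "(\<lambda>z. 0) \<in> EF"
  "F \<in> EF \<Longrightarrow> (\<lambda>z. cscale c (F z)) \<in> EF"
  by (auto simp: EF_def IF_def conj_mat_invertible[OF unitary_invertible] conj_diff conj_adj
      conj_unitary[of _ 0] intro!: continuous_intros)

lemma IF_const: "(\<lambda>z. c) \<in> IF" by (simp add: IF_def)

lemma EF_const: "(\<lambda>z. mat c) \<in> EF" by (rule EF_intros(6)[OF IF_const])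

lemma invariants_IF: "p \<in> invariants \<Longrightarrow> p \<in> IF"
  by (simp add: IF_def invariants_conj invariants_continuous)

lemma trace_algebra_EF: "f \<in> trace_algebra \<Longrightarrow> f \<in> EF"
  by (simp add: EF_def trace_algebra_continuous trace_algebra_equivariant)

lemma sec_eq_bundle_point:
  assumes F: "F \<in> EF" and z: "z \<in> PY"
  shows "sec F (pi0 z) = bundle_point z (F z)"
proof -
  have "\<exists>k\<in>unitary_group. w = conj_tuple k z" if "w \<in> P" "pi0 w = pi0 z" for w
    using P_orbit[of z w] z that by (auto simp: PY_def)
  then show ?thesis
    using z EF_conj[OF F z] by (auto simp: sec_def bundle_point_def PY_def P_conj pi0_conj)
qed

lemma bundle_quotient:
  "quotient_map (top_of_set (P \<times> UNIV)) (bundle_space P) (\<lambda>(z, A). bundle_point z A)"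
  unfolding bundle_space_def by (rule quotient_map_quotient_topology)

lemma bundle_proj_point: "bundle_proj (bundle_point z A) = pi0 z" for z :: "complex^'n^'n^'d"
proof -
  have "(pi0 \<circ> fst) ` bundle_point z A = (\<lambda>k. pi0 z) ` (unitary_group :: (complex^'n^'n) set)"
    by (simp add: bundle_point_def image_image pi0_conj)
  also have "\<dots> = {pi0 z}" using unitary_one by blast
  finally show ?thesis by (simp add: bundle_proj_def)
qed

lemma sec_carrier: assumes F: "F \<in> EF" shows "sec F \<in> carrier B"
proof -
  have "continuous_map (top_of_set PY) (bundle_space P) ((\<lambda>(z, A). bundle_point z A) \<circ> (\<lambda>z. (z, F z)))"
  proof (rule continuous_map_compose[OF _ quotient_imp_continuous_map[OF bundle_quotient]])
    show "continuous_map (top_of_set PY) (top_of_set (P \<times> UNIV)) (\<lambda>z. (z, F z))"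
      unfolding continuous_map_in_subtopology using EF_cont[OF F]
      by (auto simp: PY_def image_subset_iff intro: continuous_on_Pair continuous_on_id)
  qed
  then have "continuous_map (top_of_set PY) (bundle_space P) (sec F \<circ> pi0)"
    by (rule continuous_map_eq) (simp add: sec_eq_bundle_point[OF F])
  then have "continuous_map (subtopology Q_space Y) (bundle_space P) (sec F)"
    by (rule continuous_compose_quotient_map[OF PY_quotient])
  moreover have "bundle_proj (sec F u) = u" if "u \<in> Y" for u
  proof -
    obtain z where z: "z \<in> PY" "u = pi0 z" using \<open>u \<in> Y\<close> by (rule in_Y_E)
    then show ?thesis by (simp add: sec_eq_bundle_point[OF F] bundle_proj_point)
  qed
  ultimately show ?thesis by (auto simp: section_algebra_def sec_def)
qed

text \<open>Continuous invariant functions on \<open>P \<times> M\<^sub>n\<close> descend to the bundle, so their composition with a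
  continuous section is continuous.\<close>

lemma invariant_descends:
  fixes N :: "complex^'n^'n^'d \<Rightarrow> complex^'n^'n \<Rightarrow> complex"
  assumes cont: "continuous_on (P \<times> UNIV) (\<lambda>(z, A). N z A)"
    and inv: "\<And>k z A. k \<in> unitary_group \<Longrightarrow> N (conj_tuple k z) (conj_mat k A) = N z A"
    and s: "continuous_map (subtopology Q_space Y) (bundle_space P) s"
    and F: "\<And>z. z \<in> PY \<Longrightarrow> s (pi0 z) = bundle_point z (F z)"
  shows "continuous_on PY (\<lambda>z. N z (F z))"
proof -
  define N' where "N' e = the_elem ((\<lambda>(z, A). N z A) ` e)" for e
  have N': "N' (bundle_point z A) = N z A" for z A
  proof -
    have "(\<lambda>(z, A). N z A) ` bundle_point z A = (\<lambda>k. N z A) ` (unitary_group :: (complex^'n^'n) set)"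
      by (simp add: bundle_point_def image_image inv)
    also have "\<dots> = {N z A}" using unitary_one by blast
    finally show ?thesis by (simp add: N'_def)
  qed
  have "continuous_map (top_of_set (P \<times> UNIV)) euclidean (N' \<circ> (\<lambda>(z, A). bundle_point z A))"
  proof -
    have eq: "N' \<circ> (\<lambda>(z, A). bundle_point z A) = (\<lambda>(z, A). N z A)" by (auto simp: fun_eq_iff N')
    show ?thesis unfolding eq using cont by simp
  qed
  then have "continuous_map (bundle_space P) euclidean N'"
    by (rule continuous_compose_quotient_map[OF bundle_quotient])
  then have "continuous_map (top_of_set PY) euclidean (N' \<circ> (s \<circ> pi0))"
    by (intro continuous_map_compose[OF continuous_map_compose[OF quotient_imp_continuous_map[OF PY_quotient] s]])
  then have "continuous_on PY (N' \<circ> (s \<circ> pi0))" by simp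
  then show ?thesis by (rule continuous_on_eq) (simp add: F N')
qed

text \<open>The matrix function \<open>F\<close> behind a continuous section is continuous. The traces \<open>tr (F \<phi>)\<close> are
  continuous for each \<open>\<phi>\<close> in the trace algebra, and near a given point \<open>\<phi>\<close> may be taken close to any
  matrix unit, so that the traces come close to the entries of \<open>F\<close>. The norm of \<open>F\<close>, also an
  invariant, is bounded and controls the error.\<close>

lemma section_function_continuous:
  assumes s: "continuous_map (subtopology Q_space Y) (bundle_space P) s"
    and F: "\<And>z. z \<in> PY \<Longrightarrow> s (pi0 z) = bundle_point z (F z)"
  shows "continuous_on PY F"
proof -
  have "continuous_on PY (\<lambda>z. complex_of_real (opn (F z)))"
    by (rule invariant_descends[OF _ _ s F])
      (auto simp: opn_conj split_beta intro!: continuous_intros)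
  then have "compact ((\<lambda>z. complex_of_real (opn (F z))) ` PY)"
    by (rule compact_continuous_image[OF _ compact_PY])
  then obtain M where M: "\<And>z. z \<in> PY \<Longrightarrow> opn (F z) \<le> M"
    using compact_imp_bounded[of "(\<lambda>z. complex_of_real (opn (F z))) ` PY"] unfolding bounded_iff by fastforce
  have tr: "continuous_on PY (\<lambda>z. trace (F z ** f z))" if f: "f \<in> trace_algebra" for f
  proof (rule invariant_descends[OF _ _ s F])
    show "continuous_on (P \<times> UNIV) (\<lambda>(z, A). trace (A ** f z))"
      unfolding split_beta trace_def
      by (intro continuous_intros continuous_on_compose2[OF trace_algebra_continuous[OF f, of UNIV]]) auto
    show "trace (conj_mat k A ** f (conj_tuple k z)) = trace (A ** f z)" if "k \<in> unitary_group" for k z A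
      using that trace_algebra_equivariant[OF f that, of z]
      by (metis conj_mat_invertible(2) trace_conj unitary_invertible)
  qed
  have "continuous_on PY (\<lambda>z. F z $ b $ a)" for a b
    unfolding continuous_on_def
  proof
    fix z0 assume z0: "z0 \<in> PY"
    define E :: "complex^'n^'n" where "E = (\<chi> i j. if i = a \<and> j = b then 1 else 0)"
    obtain f where f': "f \<in> generic_matrix_algebra" and f0: "f z0 = E"
      using generic_matrix_surj[OF PY_gen[OF z0]] .
    then have f: "f \<in> trace_algebra" using generic_subset_trace by auto
    have entry: "F z $ b $ a = trace (F z ** f z0)" for z
      by (simp add: f0 E_def trace_matrix_unit)
    have lim: "((\<lambda>z. trace (F z ** f z)) \<longlongrightarrow> trace (F z0 ** f z0)) (at z0 within PY)"
      using tr[OF f] z0 by (simp add: continuous_on_def)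
    have "((\<lambda>z. F z $ b $ a - trace (F z ** f z)) \<longlongrightarrow> 0) (at z0 within PY)"
    proof (rule Lim_null_comparison)
      have "cmod (F z $ b $ a - trace (F z ** f z)) \<le> real CARD('n) * (M * opn (f z0 - f z))" if "z \<in> PY" for z
      proof -
        have "F z $ b $ a - trace (F z ** f z) = trace (F z ** (f z0 - f z))"
          by (simp add: entry trace_sub matrix_mult_diff)
        also have "cmod \<dots> \<le> real CARD('n) * opn (F z ** (f z0 - f z))" by (rule cmod_trace_le)
        also have "\<dots> \<le> real CARD('n) * (M * opn (f z0 - f z))"
          by (intro mult_left_mono order_trans[OF opn_mult] mult_right_mono M that) auto
        finally show ?thesis .
      qed
      then show "\<forall>\<^sub>F z in at z0 within PY. cmod (F z $ b $ a - trace (F z ** f z)) \<le> real CARD('n) * (M * opn (f z0 - f z))"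
        by (simp add: eventually_at_filter)
      have "continuous_on PY (\<lambda>z. real CARD('n) * (M * opn (f z0 - f z)))"
        by (intro continuous_intros trace_algebra_continuous f)
      then show "((\<lambda>z. real CARD('n) * (M * opn (f z0 - f z))) \<longlongrightarrow> 0) (at z0 within PY)"
        using z0 unfolding continuous_on_def by (metis (no_types, lifting) cancel_comm_monoid_add_class.diff_cancel mult_zero_right opn_zero)
    qed
    from tendsto_add[OF this lim] show "((\<lambda>z. F z $ b $ a) \<longlongrightarrow> F z0 $ b $ a) (at z0 within PY)"
      by (simp add: entry)
  qed
  then have "continuous_on PY (\<lambda>z. \<chi> i j. F z $ i $ j)" by (intro continuous_on_vec_lambda)
  then show ?thesis by simp
qed

lemma carrier_sec: "carrier B = sec ` EF"
proof
  show "sec ` EF \<subseteq> carrier B" using sec_carrier by blast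
  show "carrier B \<subseteq> sec ` EF"
  proof
    fix s assume "s \<in> carrier B"
    then have ext: "s \<in> extensional Y"
      and cont: "continuous_map (subtopology Q_space Y) (bundle_space P) s"
      and proj: "\<And>u. u \<in> Y \<Longrightarrow> bundle_proj (s u) = u"
      by (auto simp: section_algebra_def)
    have topY: "topspace (subtopology Q_space Y) = Y"
      using quotient_imp_surjective_map[OF PY_quotient] pi0_PY by simp
    have "\<exists>A. s (pi0 z) = bundle_point z A" if z: "z \<in> PY" for z
    proof -
      have u: "pi0 z \<in> Y" using z by (simp add: PY_def)
      then have "s (pi0 z) \<in> topspace (bundle_space P)"
        using continuous_map_image_subset_topspace[OF cont] topY by blast
      then obtain w A where w: "w \<in> P" "s (pi0 z) = bundle_point w A"
        unfolding quotient_imp_surjective_map[OF bundle_quotient, symmetric] by auto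
      then have "pi0 w = pi0 z" using proj[OF u] bundle_proj_point by metis
      then obtain k where "k \<in> unitary_group" "z = conj_tuple k w"
        using P_orbit[of w z] w(1) z by (auto simp: PY_def)
      then show ?thesis using w(2) bundle_point_conj[of k w A] by auto
    qed
    then obtain F where F: "\<And>z. z \<in> PY \<Longrightarrow> s (pi0 z) = bundle_point z (F z)" by metis
    have "F (conj_tuple k z) = conj_mat k (F z)" if z: "z \<in> PY" and k: "k \<in> unitary_group" for z k
    proof -
      have "bundle_point (conj_tuple k z) (F (conj_tuple k z)) = bundle_point z (F z)"
        using F[OF PY_conj[OF k z]] F[OF z] by (simp add: pi0_conj[OF k])
      then have "(conj_tuple k z, F (conj_tuple k z)) \<in> bundle_point z (F z)"
        using bundle_point_self by metis
      then show ?thesis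
        using bundle_point_graph[OF PY_gen[OF z]] bundle_point_conj_mem[OF bundle_point_self k] by blast
    qed
    then have FE: "F \<in> EF" using section_function_continuous[OF cont F] by (simp add: EF_def)
    have "s u = sec F u" for u
    proof (cases "u \<in> Y")
      case True
      then obtain z where "z \<in> PY" "u = pi0 z" by (rule in_Y_E)
      then show ?thesis using F sec_eq_bundle_point[OF FE] by simp
    next
      case False
      then show ?thesis using ext by (simp add: sec_def extensional_def)
    qed
    then show "s \<in> sec ` EF" using FE by blast
  qed
qed

lemma carrierE: assumes "s \<in> carrier B" obtains F where "F \<in> EF" "s = sec F"
  using assms by (auto simp: carrier_sec)

lemma Psi_sec: assumes f: "f \<in> trace_algebra" shows "Psi Y P f = sec f"
proof
  fix u show "Psi Y P f u = sec f u"
  proof (cases "u \<in> Y")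
    case True
    then obtain z where z: "z \<in> PY" "u = pi0 z" by (rule in_Y_E)
    have *: "bundle_point w (f w) = sec f u" if "w \<in> P" "pi0 w = u" for w
      using sec_eq_bundle_point[OF trace_algebra_EF[OF f], of w] that True by (auto simp: PY_def)
    have "(\<lambda>z. bundle_point z (f z)) ` {z \<in> P. pi0 z = u} = {sec f u}"
      using * z by (auto simp: PY_def image_iff)
    then show ?thesis using True by (simp add: Psi_def)
  qed (simp add: Psi_def sec_def)
qed

lemma EF_bounded: assumes "F \<in> EF" shows "bdd_above ((\<lambda>z. opn (F z)) ` PY)"
  using compact_continuous_image[OF continuous_on_opn[OF EF_cont[OF assms]] compact_PY]
  by (simp add: compact_imp_bounded bounded_imp_bdd_above)

lemma cnorm_sec: assumes F: "F \<in> EF" shows "cnorm B (sec F) = (SUP z\<in>PY. opn (F z))"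
proof -
  have *: "the_elem ((opn \<circ> snd) ` sec F (pi0 z)) = opn (F z)" if z: "z \<in> PY" for z
  proof -
    have "(opn \<circ> snd) ` sec F (pi0 z) = (\<lambda>k. opn (F z)) ` (unitary_group :: (complex^'n^'n) set)"
      by (simp add: sec_eq_bundle_point[OF F z] bundle_point_def image_image opn_conj)
    also have "\<dots> = {opn (F z)}" using unitary_one by blast
    finally show ?thesis by simp
  qed
  have "cnorm B (sec F) = (SUP u\<in>pi0 ` PY. the_elem ((opn \<circ> snd) ` sec F u))"
    by (simp add: section_algebra_def pi0_PY)
  also have "\<dots> = (SUP z\<in>PY. the_elem ((opn \<circ> snd) ` sec F (pi0 z)))" by (simp add: image_image)
  also have "\<dots> = (SUP z\<in>PY. opn (F z))" using * by (intro SUP_cong) auto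
  finally show ?thesis .
qed

lemma opn_le_cnorm: "F \<in> EF \<Longrightarrow> z \<in> PY \<Longrightarrow> opn (F z) \<le> cnorm B (sec F)"
  using cSUP_upper[OF _ EF_bounded, of z F] by (simp add: cnorm_sec)

lemma cnorm_le: "F \<in> EF \<Longrightarrow> (\<And>z. z \<in> PY \<Longrightarrow> opn (F z) \<le> b) \<Longrightarrow> cnorm B (sec F) \<le> b"
  by (simp add: cnorm_sec cSUP_least PY_nonempty)

lemma cnorm_attained: assumes F: "F \<in> EF" obtains z where "z \<in> PY" "cnorm B (sec F) = opn (F z)"
proof -
  obtain z where "z \<in> PY" "\<forall>w\<in>PY. opn (F w) \<le> opn (F z)"
    using continuous_attains_sup[OF compact_PY PY_nonempty continuous_on_opn[OF EF_cont[OF F]]] by blast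
  then show ?thesis using that[of z] opn_le_cnorm[OF F] cnorm_le[OF F] by (meson order_antisym)
qed

end

section \<open>The C*-algebra of sections\<close>

lemma opn_sum: "opn (\<Sum>i\<in>I. A i) \<le> (\<Sum>i\<in>I. opn (A i))"
  by (induction I rule: infinite_finite_induct) (auto intro: order_trans[OF opn_triangle])

lemma cscale_sum_left: "cscale (\<Sum>i\<in>I. c i) A = (\<Sum>i\<in>I. cscale (c i) A)"
  by (induction I rule: infinite_finite_induct) (auto simp: cscale_add_left)

context reduced_bundle begin

declare sec_carrier [simp]

lemma EF_minus: "F \<in> EF \<Longrightarrow> (\<lambda>z. - F z) \<in> EF"
  using EF_intros(2)[OF EF_intros(7)] by simp

lemma B_abelian_group: "abelian_group B"
proof (rule abelian_groupI)
  fix x assume "x \<in> carrier B"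
  then obtain F where F: "F \<in> EF" "x = sec F" by (rule carrierE)
  show "\<exists>y\<in>carrier B. y \<oplus>\<^bsub>B\<^esub> x = \<zero>\<^bsub>B\<^esub>"
    by (rule bexI[of _ "sec (\<lambda>z. - F z)"]) (auto simp: F sec_ops EF_minus)
qed (auto elim!: carrierE simp: sec_ops sec_eq_iff algebra_simps intro!: sec_carrier EF_intros)

lemma B_ring: "Ring.ring B"
proof (rule ringI[OF B_abelian_group])
  show "Group.monoid B"
    by (rule monoidI) (auto elim!: carrierE simp: sec_ops sec_eq_iff matrix_mul_assoc intro!: sec_carrier EF_intros EF_const)
qed (auto elim!: carrierE simp: sec_ops sec_eq_iff matrix_mult_add_left matrix_add_ldistrib)

lemma B_module: "Module.module complex_alg B"
  by (rule Module.module.intro[OF cring_complex_alg B_abelian_group], unfold_locales)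
    (auto elim!: carrierE simp: sec_ops sec_eq_iff cscale_add cscale_add_left intro!: sec_carrier EF_intros)

lemma sec_minus: assumes "F \<in> EF" "G \<in> EF" shows "sec F \<ominus>\<^bsub>B\<^esub> sec G = sec (\<lambda>z. F z - G z)"
proof -
  have "\<ominus>\<^bsub>B\<^esub> sec G = sec (\<lambda>z. - G z)"
    by (rule abelian_group.minus_equality[OF B_abelian_group]) (auto simp: assms EF_minus sec_ops)
  then show ?thesis by (simp add: a_minus_def sec_ops)
qed

lemma cdist_sec: "F \<in> EF \<Longrightarrow> G \<in> EF \<Longrightarrow> cdist B (sec F) (sec G) = cnorm B (sec (\<lambda>z. F z - G z))"
  by (simp add: cdist_def sec_minus)

lemma cnorm_nonneg: "F \<in> EF \<Longrightarrow> 0 \<le> cnorm B (sec F)"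
  by (metis cnorm_attained opn_nonneg)

lemma cnorm_eq_0: assumes "F \<in> EF" shows "cnorm B (sec F) = 0 \<longleftrightarrow> sec F = \<zero>\<^bsub>B\<^esub>"
proof
  assume "cnorm B (sec F) = 0"
  then have "opn (F z) = 0" if "z \<in> PY" for z
    using opn_le_cnorm[OF assms that] opn_nonneg[of "F z"] by linarith
  then show "sec F = \<zero>\<^bsub>B\<^esub>" by (simp add: sec_zero sec_eq_iff)
next
  assume "sec F = \<zero>\<^bsub>B\<^esub>"
  then show "cnorm B (sec F) = 0"
    using cnorm_attained[OF EF_intros(7)] by (metis opn_zero sec_zero)
qed

lemma cnorm_zero_iff: "x \<in> carrier B \<Longrightarrow> cnorm B x = 0 \<longleftrightarrow> x = \<zero>\<^bsub>B\<^esub>"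
  by (elim carrierE) (simp add: cnorm_eq_0)

lemma cnorm_triangle:
  assumes "F \<in> EF" "G \<in> EF"
  shows "cnorm B (sec (\<lambda>z. F z + G z)) \<le> cnorm B (sec F) + cnorm B (sec G)"
  by (intro cnorm_le EF_intros assms order_trans[OF opn_triangle] add_mono opn_le_cnorm)

lemma Metric_B: "Metric_space (carrier B) (cdist B)"
proof
  show "0 \<le> cdist B x y" for x y
  proof (cases "x \<in> carrier B \<and> y \<in> carrier B")
    case True
    then show ?thesis by (auto elim!: carrierE simp: cdist_sec cnorm_nonneg EF_intros)
  qed (auto simp: cdist_def)
  show "cdist B x y = cdist B y x" for x y
  proof (cases "x \<in> carrier B \<and> y \<in> carrier B")
    case True
    obtain F where F: "F \<in> EF" "x = sec F" using True[THEN conjunct1] by (rule carrierE)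
    obtain G where G: "G \<in> EF" "y = sec G" using True[THEN conjunct2] by (rule carrierE)
    show ?thesis
      unfolding F G by (simp add: cdist_sec F G cnorm_sec EF_intros opn_minus[of "F _"])
  qed (auto simp: cdist_def)
  show "cdist B x y = 0 \<longleftrightarrow> x = y" if c: "x \<in> carrier B" "y \<in> carrier B" for x y
  proof -
    obtain F where F: "F \<in> EF" "x = sec F" using c(1) by (rule carrierE)
    obtain G where G: "G \<in> EF" "y = sec G" using c(2) by (rule carrierE)
    show ?thesis
      by (simp add: F G cdist_sec cnorm_eq_0 EF_intros) (simp add: sec_zero sec_eq_iff)
  qed
  show "cdist B x z \<le> cdist B x y + cdist B y z"
    if c: "x \<in> carrier B" "y \<in> carrier B" "z \<in> carrier B" for x y z
  proof -
    obtain F where F: "F \<in> EF" "x = sec F" using c(1) by (rule carrierE)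
    obtain G where G: "G \<in> EF" "y = sec G" using c(2) by (rule carrierE)
    obtain H where H: "H \<in> EF" "z = sec H" using c(3) by (rule carrierE)
    show ?thesis
      using cnorm_triangle[OF EF_intros(2)[OF F(1) G(1)] EF_intros(2)[OF G(1) H(1)]]
      by (simp add: F G H cdist_sec)
  qed
qed

lemma mcomplete_B: "Metric_space.mcomplete (carrier B) (cdist B)"
proof -
  interpret M: Metric_space "carrier B" "cdist B" by (rule Metric_B)
  show ?thesis unfolding M.mcomplete_def
  proof (intro allI impI)
    fix s assume s: "M.MCauchy s"
    then have "s i \<in> carrier B" for i by (auto simp: M.MCauchy_def)
    then have "\<exists>F. F \<in> EF \<and> s i = sec F" for i by (metis carrierE)
    then obtain F where F: "\<And>i. F i \<in> EF" "\<And>i. s i = sec (F i)" by metis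
    have dist: "opn (F i z - F j z) \<le> cdist B (s i) (s j)" if "z \<in> PY" for i j z
      using opn_le_cnorm[OF EF_intros(2)[OF F(1) F(1)] that] by (simp add: F cdist_sec)
    define c where "c = real (CARD('n))^2"
    have c: "c > 0" by (simp add: c_def)
    have "uniformly_Cauchy_on PY F"
      unfolding uniformly_Cauchy_on_def
    proof (intro allI impI)
      fix e :: real assume e: "e > 0"
      then obtain N where N: "\<And>i j. N \<le> i \<Longrightarrow> N \<le> j \<Longrightarrow> cdist B (s i) (s j) < e / c"
        using s c unfolding M.MCauchy_def by (meson divide_pos_pos)
      have "dist (F i z) (F j z) < e" if "z \<in> PY" "N \<le> i" "N \<le> j" for i j z
      proof -
        have "dist (F i z) (F j z) \<le> c * opn (F i z - F j z)"
          unfolding dist_norm c_def by (rule norm_le_opn)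
        also have "\<dots> \<le> c * cdist B (s i) (s j)" using c dist[OF that(1)] by simp
        also have "\<dots> < c * (e / c)" using c N that by (intro mult_strict_left_mono) auto
        finally show ?thesis using c by simp
      qed
      then show "\<exists>M. \<forall>x\<in>PY. \<forall>m\<ge>M. \<forall>n\<ge>M. dist (F m x) (F n x) < e" by blast
    qed
    then obtain G where G: "uniform_limit PY F G sequentially"
      using Cauchy_uniformly_convergent unfolding uniformly_convergent_on_def by blast
    have Gpt: "(\<lambda>i. F i z) \<longlonglongrightarrow> G z" if "z \<in> PY" for z
      using tendsto_uniform_limitI[OF G that] .
    have "continuous_on PY G"
      by (rule uniform_limit_theorem[OF _ G]) (use EF_cont F in auto)
    moreover have "G (conj_tuple k z) = conj_mat k (G z)" if z: "z \<in> PY" and k: "k \<in> unitary_group" for z k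
    proof -
      have "(\<lambda>i. conj_mat k (F i z)) \<longlonglongrightarrow> conj_mat k (G z)"
      proof -
        have "continuous_on UNIV (\<lambda>A. conj_mat k A)"
          unfolding conj_unitary[OF k] by (intro continuous_intros)
        then show ?thesis using Gpt[OF z] by (auto simp: continuous_on_def intro: continuous_on_tendsto_compose[of UNIV])
      qed
      then have "(\<lambda>i. F i (conj_tuple k z)) \<longlonglongrightarrow> conj_mat k (G z)"
        by (simp add: EF_conj[OF F(1) z k])
      then show ?thesis using Gpt[OF PY_conj[OF k z]] LIMSEQ_unique by blast
    qed
    ultimately have GE: "G \<in> EF" by (simp add: EF_def)
    have "limitin M.mtopology s (sec G) sequentially"
      unfolding M.limit_metric_sequentially
    proof (intro conjI allI impI)
      show "sec G \<in> carrier B" using GE by simp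
      fix e :: real assume e: "e > 0"
      define e' where "e' = e / (2 * real CARD('n))"
      have "e' > 0" using e by (simp add: e'_def)
      then obtain N where N: "\<And>i z. N \<le> i \<Longrightarrow> z \<in> PY \<Longrightarrow> dist (F i z) (G z) < e'"
        using G unfolding uniform_limit_iff eventually_sequentially by blast
      have "cdist B (s i) (sec G) < e" if "N \<le> i" for i
      proof -
        have "cdist B (s i) (sec G) \<le> e / 2"
          unfolding F(2) cdist_sec[OF F(1) GE]
        proof (rule cnorm_le[OF EF_intros(2)[OF F(1) GE]])
          fix z assume z: "z \<in> PY"
          have "opn (F i z - G z) \<le> real CARD('n) * norm (F i z - G z)" by (rule opn_le_norm)
          also have "\<dots> \<le> real CARD('n) * e'"
            using N[OF that z] by (intro mult_left_mono) (auto simp: dist_norm)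
          finally show "opn (F i z - G z) \<le> e / 2" by (simp add: e'_def)
        qed
        then show ?thesis using e by simp
      qed
      then show "\<exists>N. \<forall>i\<ge>N. s i \<in> carrier B \<and> cdist B (s i) (sec G) < e" using F by auto
    qed
    then show "\<exists>x. limitin M.mtopology s x sequentially" by blast
  qed
qed

lemma cnorm_cstar: assumes F: "F \<in> EF"
  shows "cnorm B (sec (\<lambda>z. adj (F z) ** F z)) = (cnorm B (sec F))\<^sup>2"
proof (rule antisym)
  have G: "(\<lambda>z. adj (F z) ** F z) \<in> EF" by (intro EF_intros F)
  show "cnorm B (sec (\<lambda>z. adj (F z) ** F z)) \<le> (cnorm B (sec F))\<^sup>2"
    by (intro cnorm_le G) (simp add: opn_cstar power_mono opn_le_cnorm F)
  obtain z where "z \<in> PY" "cnorm B (sec F) = opn (F z)" using cnorm_attained[OF F] .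
  then show "(cnorm B (sec F))\<^sup>2 \<le> cnorm B (sec (\<lambda>z. adj (F z) ** F z))"
    using opn_le_cnorm[OF G] by (simp add: opn_cstar)
qed

lemma cnorm_cscale: assumes F: "F \<in> EF"
  shows "cnorm B (sec (\<lambda>z. cscale c (F z))) = cmod c * cnorm B (sec F)"
proof (rule antisym)
  have G: "(\<lambda>z. cscale c (F z)) \<in> EF" by (intro EF_intros F)
  show "cnorm B (sec (\<lambda>z. cscale c (F z))) \<le> cmod c * cnorm B (sec F)"
    by (intro cnorm_le G) (simp add: opn_cscale mult_left_mono opn_le_cnorm F)
  obtain z where "z \<in> PY" "cnorm B (sec F) = opn (F z)" using cnorm_attained[OF F] .
  then show "cmod c * cnorm B (sec F) \<le> cnorm B (sec (\<lambda>z. cscale c (F z)))"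
    using opn_le_cnorm[OF G] by (simp add: opn_cscale)
qed

lemma cnorm_mult: assumes "F \<in> EF" "G \<in> EF"
  shows "cnorm B (sec (\<lambda>z. F z ** G z)) \<le> cnorm B (sec F) * cnorm B (sec G)"
  by (intro cnorm_le EF_intros assms order_trans[OF opn_mult] mult_mono opn_le_cnorm cnorm_nonneg) auto

lemma B_cstar: "unital_cstar_algebra B"
  unfolding unital_cstar_algebra_def
  by (intro conjI B_ring B_module mcomplete_B cnorm_zero_iff ballI allI)
    (auto elim!: carrierE intro!: sec_carrier EF_intros
      simp: sec_mult sec_add sec_smult sec_star sec_eq_iff cscale_mult_left cscale_mult_right cnorm_nonneg
       cnorm_cscale cnorm_triangle cnorm_mult cnorm_cstar)

lemma norm_closure:
  "norm_topology B closure_of S = {x \<in> carrier B. \<forall>r>0. \<exists>y\<in>S. y \<in> carrier B \<and> cdist B x y < r}"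
proof -
  interpret M: Metric_space "carrier B" "cdist B" by (rule Metric_B)
  show ?thesis unfolding norm_topology_def M.metric_closure_of by auto
qed

text \<open>Norm closure in the section algebra is uniform approximation of matrix functions on \<open>PY\<close>.\<close>

lemma norm_closure_sec:
  assumes "S \<subseteq> EF"
  shows "norm_topology B closure_of (sec ` S) = sec ` {F \<in> EF. \<forall>e>0. \<exists>f\<in>S. \<forall>z\<in>PY. opn (F z - f z) \<le> e}"
proof -
  have 1: "(\<exists>f\<in>S. cdist B (sec F) (sec f) < r) \<longleftrightarrow> (\<exists>f\<in>S. cnorm B (sec (\<lambda>z. F z - f z)) < r)" if "F \<in> EF" for F r
    using assms that by (auto simp: cdist_sec subset_iff)
  have 2: "(\<forall>r>0. \<exists>f\<in>S. cnorm B (sec (\<lambda>z. F z - f z)) < r) \<longleftrightarrow> (\<forall>e>0. \<exists>f\<in>S. \<forall>z\<in>PY. opn (F z - f z) \<le> e)"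
    if "F \<in> EF" for F
  proof
    assume "\<forall>r>0. \<exists>f\<in>S. cnorm B (sec (\<lambda>z. F z - f z)) < r"
    then show "\<forall>e>0. \<exists>f\<in>S. \<forall>z\<in>PY. opn (F z - f z) \<le> e"
      using opn_le_cnorm[OF EF_intros(2)[OF that]] assms by (meson less_imp_le order_trans subsetD)
  next
    assume a: "\<forall>e>0. \<exists>f\<in>S. \<forall>z\<in>PY. opn (F z - f z) \<le> e"
    show "\<forall>r>0. \<exists>f\<in>S. cnorm B (sec (\<lambda>z. F z - f z)) < r"
    proof (intro allI impI)
      fix r :: real assume "r > 0"
      then obtain f where f: "f \<in> S" "\<forall>z\<in>PY. opn (F z - f z) \<le> r / 2" using a by (meson half_gt_zero)
      then have "cnorm B (sec (\<lambda>z. F z - f z)) \<le> r / 2"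
        using assms that by (intro cnorm_le EF_intros) auto
      then show "\<exists>f\<in>S. cnorm B (sec (\<lambda>z. F z - f z)) < r" using f \<open>r > 0\<close> by (intro bexI[of _ f]) auto
    qed
  qed
  have "norm_topology B closure_of (sec ` S) = {x \<in> carrier B. \<forall>r>0. \<exists>f\<in>S. cdist B x (sec f) < r}"
    unfolding norm_closure using assms by (auto simp: subset_iff)
  also have "\<dots> = sec ` {F \<in> EF. \<forall>r>0. \<exists>f\<in>S. cdist B (sec F) (sec f) < r}"
    by (auto simp: carrier_sec)
  also have "\<dots> = sec ` {F \<in> EF. \<forall>e>0. \<exists>f\<in>S. \<forall>z\<in>PY. opn (F z - f z) \<le> e}"
    by (intro arg_cong[of _ _ "image sec"] Collect_cong conj_cong refl) (simp only: 1 2)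
  finally show ?thesis .
qed

section \<open>The tracial function algebra\<close>

text \<open>\<open>TA\<close> is the tracial function algebra, \<open>TF\<close> the set of equivariant functions that define its
  elements: the uniform limits of the trace algebra on \<open>PY\<close>.\<close>

definition TA :: "('n, 'd) bundle_section set" where
  "TA = norm_topology B closure_of (Psi Y P ` trace_algebra)"

definition TF :: "(complex^'n^'n^'d \<Rightarrow> complex^'n^'n) set" where
  "TF = {F \<in> EF. \<forall>e>0. \<exists>f\<in>trace_algebra. \<forall>z\<in>PY. opn (F z - f z) \<le> e}"

lemma TA_TF: "TA = sec ` TF"
proof -
  have "Psi Y P ` trace_algebra = sec ` trace_algebra" by (simp add: Psi_sec)
  then show ?thesis
    unfolding TA_def TF_def using norm_closure_sec[of trace_algebra] trace_algebra_EF by auto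
qed

lemma TF_EF: "F \<in> TF \<Longrightarrow> F \<in> EF" by (simp add: TF_def)

lemma trace_algebra_TF: "f \<in> trace_algebra \<Longrightarrow> f \<in> TF"
  unfolding TF_def using trace_algebra_EF by (auto intro!: bexI[of _ f])

lemma TF_add: assumes F: "F \<in> TF" and G: "G \<in> TF" shows "(\<lambda>z. F z + G z) \<in> TF"
proof -
  have "\<exists>f\<in>trace_algebra. \<forall>z\<in>PY. opn (F z + G z - f z) \<le> e" if e: "e > 0" for e
  proof -
    obtain f g where f: "f \<in> trace_algebra" "\<forall>z\<in>PY. opn (F z - f z) \<le> e/2"
      and g: "g \<in> trace_algebra" "\<forall>z\<in>PY. opn (G z - g z) \<le> e/2"
      using F G half_gt_zero[OF e] unfolding TF_def by blast
    have "opn (F z + G z - (f z + g z)) \<le> e" if "z \<in> PY" for z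
    proof -
      have "opn (F z + G z - (f z + g z)) \<le> opn (F z - f z) + opn (G z - g z)"
        using opn_triangle[of "F z - f z" "G z - g z"] by (simp add: algebra_simps)
      then show ?thesis using f(2)[rule_format, OF that] g(2)[rule_format, OF that] by simp
    qed
    then show ?thesis by (intro bexI[OF _ trace_algebra_intros(3)[OF f(1) g(1)]]) auto
  qed
  then show ?thesis using F G by (auto simp: TF_def intro: EF_intros)
qed

lemma TF_cscale: assumes F: "F \<in> TF" shows "(\<lambda>z. cscale c (F z)) \<in> TF"
proof -
  have "\<exists>f\<in>trace_algebra. \<forall>z\<in>PY. opn (cscale c (F z) - f z) \<le> e" if e: "e > 0" for e
  proof -
    have "e / (cmod c + 1) > 0" using e by (simp add: add_nonneg_pos)
    then obtain f where f: "f \<in> trace_algebra" "\<forall>z\<in>PY. opn (F z - f z) \<le> e / (cmod c + 1)"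
      using F unfolding TF_def by blast
    have "opn (cscale c (F z) - cscale c (f z)) \<le> e" if "z \<in> PY" for z
    proof -
      have "opn (cscale c (F z) - cscale c (f z)) \<le> cmod c * (e / (cmod c + 1))"
        unfolding cscale_diff[symmetric] opn_cscale by (intro mult_left_mono f(2)[rule_format] that) simp
      also have "\<dots> \<le> (cmod c + 1) * (e / (cmod c + 1))"
        using e by (intro mult_right_mono) (auto simp: add_nonneg_pos)
      also have "\<dots> = e" using norm_ge_zero[of c] by (simp add: add_nonneg_eq_0_iff)
      finally show ?thesis .
    qed
    then show ?thesis by (intro bexI[OF _ trace_algebra_intros(5)[OF f(1)]]) auto
  qed
  then show ?thesis using F by (auto simp: TF_def intro: EF_intros)
qed

lemma TF_mult: assumes F: "F \<in> TF" and G: "G \<in> TF" shows "(\<lambda>z. F z ** G z) \<in> TF"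
proof -
  define M where "M = cnorm B (sec F) + 1 + cnorm B (sec G)"
  have M: "M \<ge> 1" using cnorm_nonneg F G TF_EF by (simp add: M_def)
  have "\<exists>f\<in>trace_algebra. \<forall>z\<in>PY. opn (F z ** G z - f z) \<le> e" if e: "e > 0" for e
  proof -
    define d where "d = min 1 (e / M)"
    have d: "d > 0" "d \<le> 1" "d * M \<le> e" using e M by (auto simp: d_def min_def field_simps)
    obtain f g where f: "f \<in> trace_algebra" "\<forall>z\<in>PY. opn (F z - f z) \<le> d"
      and g: "g \<in> trace_algebra" "\<forall>z\<in>PY. opn (G z - g z) \<le> d"
      using F G d(1) unfolding TF_def by blast
    have "opn (F z ** G z - f z ** g z) \<le> e" if z: "z \<in> PY" for z
    proof -
      have bF: "opn (F z) \<le> cnorm B (sec F)" and bG: "opn (G z) \<le> cnorm B (sec G)"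
        using opn_le_cnorm z F G TF_EF by auto
      have "opn (f z) \<le> opn (F z) + opn (f z - F z)"
        using opn_triangle[of "F z" "f z - F z"] by simp
      then have bf: "opn (f z) \<le> cnorm B (sec F) + 1"
        using bF f(2)[rule_format, OF z] d(2) opn_minus[of "f z" "F z"] by linarith
      have "F z ** G z - f z ** g z = (F z - f z) ** G z + f z ** (G z - g z)"
        by (simp add: matrix_mult_diff)
      then have "opn (F z ** G z - f z ** g z) \<le> opn ((F z - f z) ** G z) + opn (f z ** (G z - g z))"
        using opn_triangle by metis
      also have "\<dots> \<le> d * cnorm B (sec G) + (cnorm B (sec F) + 1) * d"
        using f(2) g(2) z bG bf d(1) order_trans[OF opn_nonneg bf]
        by (intro add_mono order_trans[OF opn_mult] mult_mono) auto
      also have "\<dots> = d * M" by (simp add: M_def algebra_simps)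
      finally show ?thesis using d(3) by simp
    qed
    then show ?thesis by (intro bexI[OF _ trace_algebra_intros(4)[OF f(1) g(1)]]) auto
  qed
  then show ?thesis using F G by (auto simp: TF_def intro: EF_intros)
qed

lemma TA_subalgebra: "generated_algebra B TA \<subseteq> TA"
proof
  fix x assume "x \<in> generated_algebra B TA"
  then show "x \<in> TA"
    by (induction rule: generated_algebra.induct)
      (auto simp: TA_TF sec_mult sec_add sec_smult sec_one
        intro!: imageI TF_add TF_mult TF_cscale trace_algebra_TF[OF trace_algebra_intros(2)])
qed

lemma TA_closed: "closedin (norm_topology B) TA"
  unfolding TA_def by (rule closedin_closure_of)

end

section \<open>Generation of the section algebra\<close>

context reduced_bundle begin

text \<open>The *-algebra generated by the tracial function algebra.\<close>

definition GA :: "('n, 'd) bundle_section set" where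
  "GA = generated_algebra B (TA \<union> star B ` TA)"

lemma GA_intros:
  "f \<in> trace_algebra \<Longrightarrow> sec f \<in> GA"
  "f \<in> trace_algebra \<Longrightarrow> sec (\<lambda>z. adj (f z)) \<in> GA"
  "sec F \<in> GA \<Longrightarrow> sec G \<in> GA \<Longrightarrow> sec (\<lambda>z. F z + G z) \<in> GA"
  "sec F \<in> GA \<Longrightarrow> sec G \<in> GA \<Longrightarrow> sec (\<lambda>z. F z ** G z) \<in> GA"
  "sec F \<in> GA \<Longrightarrow> sec (\<lambda>z. cscale c (F z)) \<in> GA"
proof -
  show "sec f \<in> GA" if "f \<in> trace_algebra" for f
    unfolding GA_def TA_TF using trace_algebra_TF[OF that] by (intro generated_algebra.gen_base) auto
  show "sec (\<lambda>z. adj (f z)) \<in> GA" if "f \<in> trace_algebra" for f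
    unfolding GA_def TA_TF using trace_algebra_TF[OF that]
    by (intro generated_algebra.gen_base) (auto simp flip: sec_star)
  show "sec (\<lambda>z. F z + G z) \<in> GA" if "sec F \<in> GA" "sec G \<in> GA" for F G
    using that generated_algebra.gen_add unfolding GA_def sec_add[symmetric] by fast
  show "sec (\<lambda>z. F z ** G z) \<in> GA" if "sec F \<in> GA" "sec G \<in> GA" for F G
    using that generated_algebra.gen_mult unfolding GA_def sec_mult[symmetric] by fast
  show "sec (\<lambda>z. cscale c (F z)) \<in> GA" if "sec F \<in> GA" for F c
    using that generated_algebra.gen_smult unfolding GA_def sec_smult[symmetric] by fast
qed

lemma GA_const: "sec (\<lambda>z. mat c) \<in> GA"
  using GA_intros(5)[OF GA_intros(1)[OF trace_algebra_intros(2)], of c] by simp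

lemma GA_sum: "finite I \<Longrightarrow> (\<And>i. i \<in> I \<Longrightarrow> sec (F i) \<in> GA) \<Longrightarrow> sec (\<lambda>z. \<Sum>i\<in>I. F i z) \<in> GA"
proof (induction I rule: finite_induct)
  case empty
  then show ?case using GA_const[of 0] by (simp add: mat_0)
next
  case (insert i I)
  then show ?case using GA_intros(3)[of "F i" "\<lambda>z. \<Sum>i\<in>I. F i z"] by simp
qed

text \<open>Stone--Weierstrass on \<open>Y\<close>. A separating sequence of invariants identifies \<open>Y\<close> with a compact
  set of complex sequences; real and imaginary parts of the coordinates come from invariants and
  their conjugates.\<close>

lemma scalar_approximation:
  fixes h :: "complex^'n^'n^'d \<Rightarrow> real"
  assumes h: "(\<lambda>z. complex_of_real (h z)) \<in> IF" and e: "e > 0"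
  obtains r :: "complex^'n^'n^'d \<Rightarrow> real"
  where "sec (\<lambda>z. mat (complex_of_real (r z))) \<in> GA" "(\<lambda>z. complex_of_real (r z)) \<in> IF"
    "\<And>z. z \<in> PY \<Longrightarrow> \<bar>h z - r z\<bar> < e"
proof -
  obtain g :: "nat \<Rightarrow> complex^'n^'n^'d \<Rightarrow> complex"
    where g: "\<And>i. g i \<in> invariants" and sep: "\<And>z w. pi0 z \<noteq> pi0 w \<Longrightarrow> \<exists>i. g i z \<noteq> g i w"
    using countable_separating_invariants by blast
  define \<gamma> where "\<gamma> z = (\<lambda>i. g i z)" for z
  have \<gamma>_cont: "continuous_on PY \<gamma>"
    unfolding \<gamma>_def by (intro continuous_on_coordinatewise_then_product invariants_continuous g)
  have hc: "continuous_on PY h"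
    using continuous_on_Re[OF IF_cont[OF h]] by simp
  have h\<gamma>: "h z = h w" if "z \<in> PY" "w \<in> PY" "\<gamma> z = \<gamma> w" for z w
  proof -
    have "pi0 z = pi0 w" using sep[of z w] that(3) unfolding \<gamma>_def by metis
    then obtain k where "k \<in> unitary_group" "w = conj_tuple k z"
      using P_orbit[of z w] \<open>z \<in> PY\<close> \<open>w \<in> PY\<close> by (auto simp: PY_def)
    then show ?thesis using IF_conj[OF h \<open>z \<in> PY\<close>] by (simp add: of_real_eq_iff)
  qed
  define S where "S = \<gamma> ` PY"
  define h' where "h' s = h (SOME z. z \<in> PY \<and> \<gamma> z = s)" for s
  have h': "h' (\<gamma> z) = h z" if "z \<in> PY" for z
  proof -
    have "(SOME w. w \<in> PY \<and> \<gamma> w = \<gamma> z) \<in> PY \<and> \<gamma> (SOME w. w \<in> PY \<and> \<gamma> w = \<gamma> z) = \<gamma> z"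
      by (rule someI[of _ z]) (simp add: that)
    then show ?thesis unfolding h'_def by (intro h\<gamma> that) blast+
  qed
  have S: "compact S" unfolding S_def by (rule compact_continuous_image[OF \<gamma>_cont compact_PY])
  have "continuous_on S h'"
    unfolding continuous_on_closed_vimage[OF compact_imp_closed[OF S]]
  proof (intro allI impI)
    fix T :: "real set" assume "closed T"
    then have "compact (PY \<inter> (PY \<inter> h -` T))"
      using compact_Int_closed[OF compact_PY continuous_closed_preimage[OF hc compact_imp_closed[OF compact_PY]]] by simp
    then have "compact (PY \<inter> h -` T)" by (simp add: Int_left_absorb)
    moreover have "h' -` T \<inter> S = \<gamma> ` (PY \<inter> h -` T)"
      unfolding S_def using h' by force
    ultimately show "closed (h' -` T \<inter> S)"
      by (simp only:) (intro compact_imp_closed compact_continuous_image continuous_on_subset[OF \<gamma>_cont] inf_le1)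
  qed
  define R where "R = {r :: (nat \<Rightarrow> complex) \<Rightarrow> real. continuous_on S r \<and>
     sec (\<lambda>z. mat (complex_of_real (r (\<gamma> z)))) \<in> GA}"
  interpret function_ring_on R S
  proof
    show "compact S" by (rule S)
    show "continuous_on S f" if "f \<in> R" for f using that by (simp add: R_def)
    show "(\<lambda>x. f x + g x) \<in> R" if "f \<in> R" "g \<in> R" for f g
    proof -
      have "sec (\<lambda>z. mat (complex_of_real (f (\<gamma> z))) + mat (complex_of_real (g (\<gamma> z)))) \<in> GA"
        using that unfolding R_def by (intro GA_intros(3)) auto
      moreover have "mat (complex_of_real (f x)) + mat (complex_of_real (g x)) = (mat (complex_of_real (f x + g x)) :: complex^'n^'n)" for x
        by (simp add: mat_def vec_eq_iff)
      ultimately show ?thesis using that by (auto simp: R_def intro!: continuous_intros)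
    qed
    show "(\<lambda>x. f x * g x) \<in> R" if "f \<in> R" "g \<in> R" for f g
    proof -
      have "sec (\<lambda>z. mat (complex_of_real (f (\<gamma> z))) ** mat (complex_of_real (g (\<gamma> z)))) \<in> GA"
        using that unfolding R_def by (intro GA_intros(4)) auto
      moreover have "mat (complex_of_real (f x)) ** mat (complex_of_real (g x)) = (mat (complex_of_real (f x * g x)) :: complex^'n^'n)" for x
        by (simp add: cscale_eq_mult(1)[symmetric])
      ultimately show ?thesis using that by (auto simp: R_def intro!: continuous_intros)
    qed
    show "(\<lambda>_. c) \<in> R" for c by (simp add: R_def GA_const)
    show "\<exists>f\<in>R. f x \<noteq> f y" if "x \<in> S" "y \<in> S" and ne: "x \<noteq> y" for x y
    proof -
      obtain i where i: "x i \<noteq> y i" using ne by (auto simp: fun_eq_iff)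
      have t: "(\<lambda>z. mat (g i z)) \<in> trace_algebra" by (rule trace_algebra_intros(1)[OF g])
      have c: "continuous_on S (\<lambda>x. x i)"
        by (rule continuous_on_product_then_coordinatewise) (rule continuous_on_id)
      have re: "cscale (1/2) (mat w + adj (mat w)) = (mat (complex_of_real (Re w)) :: complex^'n^'n)" for w
        by (simp add: cscale_def mat_def adj_def vec_eq_iff complex_eq_iff)
      have im: "cscale (1/(2*\<i>)) (mat w + cscale (-1) (adj (mat w))) = (mat (complex_of_real (Im w)) :: complex^'n^'n)" for w
        by (simp add: cscale_def mat_def adj_def vec_eq_iff complex_eq_iff)
      have "(\<lambda>x. Re (x i)) \<in> R"
        using GA_intros(5)[OF GA_intros(3)[OF GA_intros(1,2)[OF t]], of "1/2"] c
        unfolding R_def re by (auto simp: \<gamma>_def intro!: continuous_intros)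
      moreover have "(\<lambda>x. Im (x i)) \<in> R"
        using GA_intros(5)[OF GA_intros(3)[OF GA_intros(1)[OF t] GA_intros(5)[OF GA_intros(2)[OF t], of "-1"]], of "1/(2*\<i>)"] c
        unfolding R_def im by (auto simp: \<gamma>_def intro!: continuous_intros)
      ultimately show ?thesis using i by (metis complex_eq_iff)
    qed
  qed
  obtain r where r: "r \<in> R" "\<And>x. x \<in> S \<Longrightarrow> \<bar>h' x - r x\<bar> < e"
    using Stone_Weierstrass_basic[OF \<open>continuous_on S h'\<close> e] by blast
  show ?thesis
  proof (rule that[of "\<lambda>z. r (\<gamma> z)"])
    show "sec (\<lambda>z. mat (complex_of_real (r (\<gamma> z)))) \<in> GA" using r(1) by (simp add: R_def)
    have "continuous_on PY (\<lambda>z. r (\<gamma> z))"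
      using continuous_on_compose2[OF _ \<gamma>_cont, of S r] r(1) by (auto simp: R_def S_def)
    then show "(\<lambda>z. complex_of_real (r (\<gamma> z))) \<in> IF"
      by (auto simp: IF_def \<gamma>_def invariants_conj[OF g] intro!: continuous_intros)
    show "\<bar>h z - r (\<gamma> z)\<bar> < e" if "z \<in> PY" for z
      using r(2)[of "\<gamma> z"] h'[OF that] that by (simp add: S_def)
  qed
qed

lemma EF_sum: "(\<And>i. i \<in> I \<Longrightarrow> F i \<in> EF) \<Longrightarrow> (\<lambda>z. \<Sum>i\<in>I. F i z) \<in> EF"
  by (induction I rule: infinite_finite_induct) (auto intro: EF_intros)

text \<open>A continuous section is approximated by a convex combination, with continuous
  coefficients, of generic matrix functions matching it near the points of a finite set.\<close>

lemma GA_dense: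
  assumes F: "F \<in> EF" and e: "e > 0"
  obtains G where "G \<in> EF" "sec G \<in> GA" "\<And>z. z \<in> PY \<Longrightarrow> opn (F z - G z) \<le> e"
proof -
  define e2 where "e2 = e / 2"
  have e2: "e2 > 0" using e by (simp add: e2_def)
  define U where "U f = {z \<in> PY. opn (F z - f z) < e2}" for f
  have "\<exists>D\<subseteq>U ` trace_algebra. finite D \<and> PY \<subseteq> \<Union>D"
  proof (rule compact_eq_openin_cover[THEN iffD1, OF compact_PY, rule_format], intro conjI ballI)
    fix V assume "V \<in> U ` trace_algebra"
    then obtain f where f: "f \<in> trace_algebra" "V = U f" by auto
    have "continuous_on PY (\<lambda>z. opn (F z - f z))"
      by (intro continuous_intros EF_cont F trace_algebra_continuous f)
    then have "openin (top_of_set PY) (PY \<inter> (\<lambda>z. opn (F z - f z)) -` {..<e2})"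
      by (rule continuous_openin_preimage_gen) simp
    then show "openin (top_of_set PY) V" by (simp add: f U_def vimage_def Int_def)
  next
    show "PY \<subseteq> \<Union>(U ` trace_algebra)"
    proof
      fix z assume z: "z \<in> PY"
      obtain f where "f \<in> generic_matrix_algebra" "f z = F z" using generic_matrix_surj[OF PY_gen[OF z]] .
      then show "z \<in> \<Union>(U ` trace_algebra)" using z e2 generic_subset_trace by (auto simp: U_def intro!: bexI[of _ f])
    qed
  qed
  then obtain D where "D \<subseteq> U ` trace_algebra" "finite D" "PY \<subseteq> \<Union>D" by blast
  moreover obtain T where "T \<subseteq> trace_algebra" "finite T" "D = U ` T"
    using finite_subset_image[OF calculation(2,1)] by blast
  ultimately have T: "finite T" "T \<subseteq> trace_algebra" "PY \<subseteq> \<Union>(U ` T)" by auto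
  \<comment> \<open>The coefficient of \<open>f\<close> vanishes wherever \<open>f\<close> is not close to \<open>F\<close>.\<close>
  define h where "h f z = max 0 (e2 - opn (F z - f z))" for f z
  define H where "H z = (\<Sum>f\<in>T. h f z)" for z
  have h0: "h f z \<ge> 0" for f z by (simp add: h_def)
  have H: "H z > 0" if z: "z \<in> PY" for z
  proof -
    obtain f where "f \<in> T" "opn (F z - f z) < e2" using T(3) z by (auto simp: U_def)
    then show ?thesis unfolding H_def using T(1) h0
      by (intro sum_pos2[of T f]) (auto simp: h_def)
  qed
  define p where "p f z = h f z / H z" for f z
  have p0: "p f z \<ge> 0" if "z \<in> PY" for f z using h0 H[OF that] by (simp add: p_def)
  have psum: "(\<Sum>f\<in>T. p f z) = 1" if "z \<in> PY" for z
    using H[OF that] unfolding p_def sum_divide_distrib[symmetric] by (simp add: H_def)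
  have hc: "continuous_on PY (h f)" if "f \<in> T" for f
    unfolding h_def using T(2) that by (intro continuous_intros EF_cont F trace_algebra_continuous) auto
  have pIF: "(\<lambda>z. complex_of_real (p f z)) \<in> IF" if f: "f \<in> T" for f
  proof -
    have "h f' (conj_tuple k z) = h f' z" if "f' \<in> T" "z \<in> PY" "k \<in> unitary_group" for f' z k
      using that EF_conj[OF F] trace_algebra_equivariant[of f' k z] T(2)
      by (simp add: h_def subset_iff opn_conj flip: conj_diff)
    moreover have "H (conj_tuple k z) = H z" if "z \<in> PY" "k \<in> unitary_group" for z k
      unfolding H_def using calculation that by simp
    moreover have "continuous_on PY (p f)"
      unfolding p_def using H by (intro continuous_intros hc f) (auto simp: H_def[abs_def] intro!: continuous_intros hc, fastforce)
    ultimately show ?thesis using f by (auto simp: IF_def p_def[symmetric] intro!: continuous_intros) (simp add: p_def)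
  qed
  \<comment> \<open>The coefficients are approximated so well that the error this causes stays below \<open>e2\<close>.\<close>
  define M where "M = 1 + (\<Sum>f\<in>T. cnorm B (sec f))"
  have fE: "f \<in> EF" if "f \<in> T" for f using that T(2) trace_algebra_EF by auto
  have M: "M > 0" unfolding M_def using sum_nonneg[of T "\<lambda>f. cnorm B (sec f)"] cnorm_nonneg fE
    by (simp add: add_pos_nonneg)
  have "\<exists>r :: complex^'n^'n^'d \<Rightarrow> real. sec (\<lambda>z. mat (complex_of_real (r z))) \<in> GA \<and> (\<lambda>z. complex_of_real (r z)) \<in> IF \<and>
    (\<forall>z\<in>PY. \<bar>p f z - r z\<bar> < e2 / M)" if "f \<in> T" for f
    using scalar_approximation[OF pIF[OF that] divide_pos_pos[OF e2 M]] by metis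
  then obtain r :: "_ \<Rightarrow> complex^'n^'n^'d \<Rightarrow> real" where
    r: "\<And>f. f \<in> T \<Longrightarrow> sec (\<lambda>z. mat (complex_of_real (r f z))) \<in> GA"
      "\<And>f. f \<in> T \<Longrightarrow> (\<lambda>z. complex_of_real (r f z)) \<in> IF"
      "\<And>f z. f \<in> T \<Longrightarrow> z \<in> PY \<Longrightarrow> \<bar>p f z - r f z\<bar> < e2 / M"
    by metis
  define G where "G z = (\<Sum>f\<in>T. cscale (complex_of_real (r f z)) (f z))" for z
  show ?thesis
  proof (rule that[of G])
    show "G \<in> EF" unfolding G_def by (intro EF_sum EF_intros r fE)
    show "sec G \<in> GA" unfolding G_def cscale_eq_mult(1)
      using T(2) by (intro GA_sum T(1) GA_intros(4) r GA_intros(1)) auto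
    fix z assume z: "z \<in> PY"
    have "F z - G z = (\<Sum>f\<in>T. cscale (of_real (p f z)) (F z - f z)) + (\<Sum>f\<in>T. cscale (of_real (p f z - r f z)) (f z))"
    proof -
      have "F z = (\<Sum>f\<in>T. cscale (of_real (p f z)) (F z))"
        unfolding cscale_sum_left[symmetric] of_real_sum[symmetric] psum[OF z] by simp
      then have "F z - G z = (\<Sum>f\<in>T. cscale (of_real (p f z)) (F z)) - (\<Sum>f\<in>T. cscale (of_real (r f z)) (f z))"
        by (simp add: G_def)
      also have "\<dots> = (\<Sum>f\<in>T. cscale (of_real (p f z)) (F z - f z) + cscale (of_real (p f z - r f z)) (f z))"
        unfolding sum_subtractf[symmetric] by (intro sum.cong refl) (simp add: cscale_diff cscale_diff_left)
      finally show ?thesis by (simp add: sum.distrib)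
    qed
    then have "opn (F z - G z) \<le> opn (\<Sum>f\<in>T. cscale (of_real (p f z)) (F z - f z)) + opn (\<Sum>f\<in>T. cscale (of_real (p f z - r f z)) (f z))"
      by (simp only: opn_triangle)
    also have "\<dots> \<le> (\<Sum>f\<in>T. p f z * e2) + (\<Sum>f\<in>T. e2 / M * cnorm B (sec f))"
    proof (intro add_mono order_trans[OF opn_sum] sum_mono)
      fix f assume f: "f \<in> T"
      show "opn (cscale (of_real (p f z)) (F z - f z)) \<le> p f z * e2"
      proof (cases "opn (F z - f z) < e2")
        case True
        then show ?thesis using p0[OF z, of f] by (simp add: opn_cscale mult_left_mono)
      next
        case False
        then have "p f z = 0" by (simp add: p_def h_def)
        then show ?thesis by simp
      qed
      show "opn (cscale (of_real (p f z - r f z)) (f z)) \<le> e2 / M * cnorm B (sec f)"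
        unfolding opn_cscale norm_of_real using r(3)[OF f z] opn_le_cnorm[OF fE[OF f] z]
        by (intro mult_mono) auto
    qed
    also have "\<dots> = e2 + e2 / M * (M - 1)"
      unfolding sum_distrib_right[symmetric] sum_distrib_left[symmetric] psum[OF z] by (simp add: M_def)
    also have "\<dots> \<le> e2 + e2 / M * M"
      using e2 M by (intro add_left_mono mult_left_mono) auto
    also have "\<dots> = e" using M by (simp add: e2_def)
    finally show "opn (F z - G z) \<le> e" .
  qed
qed

lemma generating: "generating_subalgebra B TA"
  unfolding generating_subalgebra_def
proof (intro conjI B_cstar TA_subalgebra TA_closed)
  show "TA \<subseteq> carrier B" unfolding TA_TF using TF_EF by (auto intro: sec_carrier)
  show "norm_topology B closure_of generated_algebra B (TA \<union> star B ` TA) = carrier B"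
    unfolding GA_def[symmetric] norm_closure
  proof (intro equalityI subsetI CollectI conjI allI impI)
    fix x and e :: real assume x: "x \<in> carrier B" and e: "0 < e"
    obtain F where F: "F \<in> EF" "x = sec F" using x by (rule carrierE)
    obtain G where G: "G \<in> EF" "sec G \<in> GA" "\<And>z. z \<in> PY \<Longrightarrow> opn (F z - G z) \<le> e/2"
      using GA_dense[OF F(1), of "e/2"] e by auto
    have "cdist B x (sec G) \<le> e/2"
      unfolding F(2) cdist_sec[OF F(1) G(1)] by (intro cnorm_le EF_intros F G)
    then show "\<exists>y\<in>GA. y \<in> carrier B \<and> cdist B x y < e" using e G by (intro bexI[of _ "sec G"]) auto
  qed auto
qed

end

section \<open>Peak points and the Shilov boundary\<close>

text \<open>A point of \<open>P\<close> is a peak point if, for every closed part \<open>C\<close> of \<open>P\<close> on which \<open>pi0\<close> does not take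
  the value at the point, there are invariants with nonnegative real part on \<open>P\<close> and real part at
  least 1 on \<open>C\<close>, but arbitrarily small real part at the point.\<close>

definition peak_point :: "(complex^'n^'n^'d) set \<Rightarrow> complex^'n::finite^'n^'d::finite \<Rightarrow> bool" where
  "peak_point P z \<longleftrightarrow> z \<in> P \<and>
     (\<forall>C e. closed C \<longrightarrow> C \<subseteq> P \<longrightarrow> pi0 z \<notin> pi0 ` C \<longrightarrow> e > 0 \<longrightarrow>
       (\<exists>p\<in>invariants. (\<forall>w\<in>P. 0 \<le> Re (p w)) \<and> (\<forall>w\<in>C. 1 \<le> Re (p w)) \<and> Re (p z) \<le> e))"

lemma compact_bound:
  fixes f :: "'a::topological_space \<Rightarrow> 'b::real_normed_vector"
  assumes "compact S" "continuous_on S f" obtains M where "M \<ge> 1" "\<And>x. x \<in> S \<Longrightarrow> norm (f x) \<le> M"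
proof -
  obtain M where "\<And>x. x \<in> S \<Longrightarrow> norm (f x) \<le> M"
    using compact_imp_bounded[OF compact_continuous_image[OF assms(2,1)]] unfolding bounded_iff by auto
  then show ?thesis using that[of "max 1 M"] by fastforce
qed

text \<open>Peak points exist near the maximum of the real part of each invariant \<open>g\<close>. Let \<open>f\<^sub>i\<close> be a
  separating sequence of invariants and \<open>q = \<Sum>\<^sub>i c\<^sub>i \<bar>f\<^sub>i\<bar>\<^sup>2\<close>, and let \<open>z\<close> maximise \<open>q + t Re g\<close> with
  maximum \<open>m\<close>. For \<open>h = \<Sum>\<^sub>i c\<^sub>i cnj(f\<^sub>i(z)) f\<^sub>i\<close>, a uniform limit of invariants, strict convexity gives
  \<open>Re (m + q(z) - t g - 2 h) \<ge> q + q(z) - 2 Re h = \<Sum>\<^sub>i c\<^sub>i \<bar>f\<^sub>i - f\<^sub>i(z)\<bar>\<^sup>2\<close>,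
  with equality at \<open>z\<close>. The right-hand side is 0 at \<open>z\<close>
  and positive wherever \<open>pi0\<close> differs from \<open>pi0 z\<close>.\<close>

lemma peak_point_near_maximum:
  fixes P :: "(complex^'n::finite^'n^'d::finite) set"
  assumes P: "compact P" "P \<noteq> {}" and g: "g \<in> invariants" and e: "e > 0"
  obtains z where "peak_point P z" "\<And>w. w \<in> P \<Longrightarrow> Re (g w) \<le> Re (g z) + e"
proof -
  obtain f :: "nat \<Rightarrow> complex^'n^'n^'d \<Rightarrow> complex"
    where f: "\<And>i. f i \<in> invariants" and sep: "\<And>z w. pi0 z \<noteq> pi0 w \<Longrightarrow> \<exists>i. f i z \<noteq> f i w"
    using countable_separating_invariants by blast
  have "\<exists>M\<ge>1. \<forall>z\<in>P. cmod (f i z) \<le> M" for i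
    using compact_bound[OF P(1) invariants_continuous[OF f]] by metis
  then obtain M where M: "\<And>i. M i \<ge> 1" "\<And>i z. z \<in> P \<Longrightarrow> cmod (f i z) \<le> M i" by metis
  \<comment> \<open>These weights make both series converge geometrically, uniformly on \<open>P\<close>.\<close>
  define c where "c i = (1/2)^i / (M i)\<^sup>2" for i
  have c: "c i > 0" for i using M(1)[of i] by (simp add: c_def)
  have cM: "c i * (M i * M i) = (1/2)^i" for i using M(1)[of i] by (simp add: c_def power2_eq_square)
  have sm: "summable (\<lambda>i. (1/2::real)^i)" by (simp add: summable_geometric)
  define q where "q z = (\<Sum>i. c i * (cmod (f i z))\<^sup>2)" for z
  have bq: "norm (c i * (cmod (f i z))\<^sup>2) \<le> (1/2)^i" if "z \<in> P" for i z
  proof -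
    have "c i * (cmod (f i z) * cmod (f i z)) \<le> c i * (M i * M i)"
      using c[of i] M(2)[OF that] order_trans[OF zero_le_one M(1)[of i]]
      by (intro mult_left_mono mult_mono) auto
    then show ?thesis using c[of i] by (simp add: cM power2_eq_square abs_mult)
  qed
  have sq: "summable (\<lambda>i. c i * (cmod (f i z))\<^sup>2)" if "z \<in> P" for z
    using bq[OF that] by (intro summable_comparison_test'[OF sm]) auto
  have "uniform_limit P (\<lambda>n z. \<Sum>i<n. c i * (cmod (f i z))\<^sup>2) q sequentially"
    unfolding q_def using bq sm by (rule Weierstrass_m_test)
  then have qc: "continuous_on P q"
    by (rule uniform_limit_theorem[rotated]) (auto intro!: continuous_intros invariants_continuous f always_eventually)
  have q0: "0 \<le> q z" if "z \<in> P" for z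
    unfolding q_def using c by (intro suminf_nonneg sq that) (simp add: less_imp_le)
  have q2: "q z \<le> 2" if "z \<in> P" for z
  proof -
    have "q z \<le> (\<Sum>i. (1/2::real)^i)"
      unfolding q_def using bq[OF that] by (intro suminf_le sq that sm) (simp add: abs_le_iff)
    then show ?thesis by (simp add: suminf_geometric)
  qed
  \<comment> \<open>Since \<open>q\<close> varies by at most 2, the maximum moves away from that of \<open>Re g\<close> by at most \<open>e\<close>.\<close>
  define t where "t = 2 / e"
  have t: "t > 0" using e by (simp add: t_def)
  have "continuous_on P (\<lambda>z. q z + t * Re (g z))"
    by (intro continuous_intros qc invariants_continuous g)
  then obtain z where z: "z \<in> P" and max: "\<And>w. w \<in> P \<Longrightarrow> q w + t * Re (g w) \<le> q z + t * Re (g z)"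
    using continuous_attains_sup[OF P] by blast
  have gmax: "Re (g w) \<le> Re (g z) + e" if w: "w \<in> P" for w
  proof -
    have "t * Re (g w) \<le> t * Re (g z) + 2" using max[OF w] q0[OF w] q2[OF z] by linarith
    also have "\<dots> = t * (Re (g z) + e)" using e by (simp add: t_def field_simps)
    finally show ?thesis using t by simp
  qed
  define H where "H n w = (\<Sum>i<n. of_real (c i) * cnj (f i z) * f i w)" for n w
  define h where "h w = (\<Sum>i. of_real (c i) * cnj (f i z) * f i w)" for w
  have bh: "norm (of_real (c i) * cnj (f i z) * f i w) \<le> (1/2)^i" if "w \<in> P" for i w
  proof -
    have "c i * (cmod (f i z) * cmod (f i w)) \<le> c i * (M i * M i)"
      using c[of i] M(2)[OF that] M(2)[OF z] order_trans[OF zero_le_one M(1)[of i]]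
      by (intro mult_left_mono mult_mono) auto
    then show ?thesis using c[of i] by (simp add: cM norm_mult mult.assoc)
  qed
  have uh: "uniform_limit P H h sequentially"
    unfolding H_def h_def using bh sm by (rule Weierstrass_m_test)
  have Hinv: "H n \<in> invariants" for n
    unfolding H_def by (intro invariants_sum) (use invariants_intros(3)[OF f] in auto)
  have hc: "continuous_on P h"
    by (rule uniform_limit_theorem[OF _ uh]) (auto intro: invariants_continuous Hinv always_eventually)
  define Q where "Q w = (\<Sum>i. c i * (cmod (f i w - f i z))\<^sup>2)" for w
  have sh: "summable (\<lambda>i. of_real (c i) * cnj (f i z) * f i w)" if "w \<in> P" for w
    using bh[OF that] by (intro summable_comparison_test'[OF sm]) auto
  have Qterm: "c i * (cmod (f i w - f i z))\<^sup>2 =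
    c i * (cmod (f i w))\<^sup>2 + c i * (cmod (f i z))\<^sup>2 - 2 * Re (of_real (c i) * cnj (f i z) * f i w)" for i w
    by (simp only: cmod_power2) (simp add: algebra_simps power2_eq_square)
  have Qsums: "(\<lambda>i. c i * (cmod (f i w - f i z))\<^sup>2) sums (q w + q z - 2 * Re (h w))" if w: "w \<in> P" for w
    unfolding Qterm q_def h_def
    by (intro sums_diff sums_add sums_mult sums_Re summable_sums sq sh w z)
  have Q: "Q w = q w + q z - 2 * Re (h w)" if "w \<in> P" for w
    using sums_unique[OF Qsums[OF that]] by (simp add: Q_def)
  have Qpos: "Q w > 0" if w: "w \<in> P" and ne: "pi0 w \<noteq> pi0 z" for w
  proof -
    obtain i where "f i w \<noteq> f i z" using sep[OF ne] by blast
    then show ?thesis unfolding Q_def using c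
      by (intro suminf_pos2[of _ i] sums_summable[OF Qsums[OF w]]) (auto simp: less_imp_le)
  qed
  have Qnn: "Q w \<ge> 0" if w: "w \<in> P" for w
    unfolding Q_def using c by (intro suminf_nonneg sums_summable[OF Qsums[OF w]]) (auto simp: less_imp_le)
  have Qz: "Q z = 0" by (simp add: Q_def)
  have Qc: "continuous_on P Q"
    by (rule continuous_on_eq[of _ "\<lambda>w. q w + q z - 2 * Re (h w)"])
      (use Q in \<open>auto intro!: continuous_intros qc hc\<close>)
  define m where "m = q z + t * Re (g z)"
  have "peak_point P z"
    unfolding peak_point_def
  proof (intro conjI allI impI z)
    fix C and e' :: real assume C: "closed C" "C \<subseteq> P" "pi0 z \<notin> pi0 ` C" and e': "e' > 0"
    have "compact C" using C P(1) by (metis compact_Int_closed inf.absorb_iff2)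
    obtain \<delta> where \<delta>: "\<delta> > 0" "\<And>w. w \<in> C \<Longrightarrow> \<delta> \<le> Q w"
    proof (cases "C = {}")
      case False
      obtain w where "w \<in> C" "\<And>v. v \<in> C \<Longrightarrow> Q w \<le> Q v"
        using continuous_attains_inf[OF \<open>compact C\<close> False continuous_on_subset[OF Qc C(2)]] by blast
      moreover have "Q w > 0"
      proof (rule Qpos)
        show "w \<in> P" "pi0 w \<noteq> pi0 z"
          using C(2,3) \<open>w \<in> C\<close> by (auto simp: image_iff intro: sym)
      qed
      ultimately show ?thesis using that[of "Q w"] by blast
    qed (use that[of 1] in auto)
    define \<eta> where "\<eta> = e' * \<delta> / 4"
    have \<eta>: "\<eta> > 0" using e' \<delta> by (simp add: \<eta>_def)
    obtain N where N: "\<And>w. w \<in> P \<Longrightarrow> dist (H N w) (h w) < \<eta>"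
      using uh[unfolded uniform_limit_iff, rule_format, OF \<eta>] unfolding eventually_sequentially by blast
    have N': "\<bar>Re (H N w) - Re (h w)\<bar> < \<eta>" if "w \<in> P" for w
      using N[OF that] abs_Re_le_cmod[of "H N w - h w"] by (simp add: dist_norm)
    define p where "p w = of_real (1/\<delta>) * (of_real (m + q z + 2 * \<eta>) + (of_real (-t) * g w + (-2) * H N w))" for w
    have p: "p \<in> invariants"
      unfolding p_def by (intro invariants_intros g Hinv)
    have Rep: "Re (p w) = (m - (q w + t * Re (g w)) + Q w + 2 * \<eta> - 2 * (Re (H N w) - Re (h w))) / \<delta>" if "w \<in> P" for w
      unfolding p_def Q[OF that] by (simp add: field_simps)
    have le: "Q w / \<delta> \<le> Re (p w)" if "w \<in> P" for w
    proof -
      have "Q w \<le> m - (q w + t * Re (g w)) + Q w + 2 * \<eta> - 2 * (Re (H N w) - Re (h w))"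
        using max[OF that] N'[OF that] unfolding m_def abs_less_iff by argo
      then show ?thesis unfolding Rep[OF that] using \<delta>(1) by (intro divide_right_mono) auto
    qed
    show "\<exists>p\<in>invariants. (\<forall>w\<in>P. 0 \<le> Re (p w)) \<and> (\<forall>w\<in>C. 1 \<le> Re (p w)) \<and> Re (p z) \<le> e'"
    proof (intro bexI[OF _ p] conjI ballI)
      show "0 \<le> Re (p w)" if "w \<in> P" for w
        using order_trans[OF divide_nonneg_pos[OF Qnn[OF that] \<delta>(1)] le[OF that]] .
      show "1 \<le> Re (p w)" if "w \<in> C" for w
      proof -
        have "1 \<le> Q w / \<delta>" using \<delta> that by simp
        then show ?thesis using le[of w] C(2) that by (meson order_trans subsetD)
      qed
      have "Re (p z) \<le> (4 * \<eta>) / \<delta>"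
      proof -
        have "m - (q z + t * Re (g z)) + Q z + 2 * \<eta> - 2 * (Re (H N z) - Re (h z)) \<le> 4 * \<eta>"
          using N'[OF z] unfolding m_def Qz abs_less_iff by argo
        then show ?thesis unfolding Rep[OF z] using \<delta>(1) by (intro divide_right_mono) auto
      qed
      then show "Re (p z) \<le> e'" using \<delta>(1) by (simp add: \<eta>_def)
    qed
  qed
  then show ?thesis using gmax that by blast
qed

text \<open>Passing from real part to modulus: for a large constant \<open>c\<close>, the modulus of \<open>c - p\<close> is close to
  \<open>c - Re p\<close>.\<close>

lemma peak_point_modulus:
  assumes P: "compact P" and z: "peak_point P z"
    and C: "closed C" "C \<subseteq> P" "pi0 z \<notin> pi0 ` C"
  obtains g r where "g \<in> invariants" "r \<ge> 0" "\<And>w. w \<in> C \<Longrightarrow> cmod (g w) \<le> r" "r < cmod (g z)"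
proof -
  have "\<exists>p\<in>invariants. (\<forall>w\<in>P. 0 \<le> Re (p w)) \<and> (\<forall>w\<in>C. 1 \<le> Re (p w)) \<and> Re (p z) \<le> 1/4"
    using z[unfolded peak_point_def, THEN conjunct2, rule_format, of C "1/4"] C by simp
  then obtain p where p: "p \<in> invariants" "\<And>w. w \<in> C \<Longrightarrow> 1 \<le> Re (p w)" "Re (p z) \<le> 1/4"
    by blast
  obtain M where M: "M \<ge> 1" "\<And>w. w \<in> P \<Longrightarrow> cmod (p w) \<le> M"
    using compact_bound[OF P invariants_continuous[OF p(1)]] by blast
  \<comment> \<open>With \<open>c \<ge> \<bar>p\<bar>\<^sup>2\<close> one has \<open>\<bar>c - p\<bar> \<le> c - 1/2\<close> on \<open>C\<close>, against \<open>c - 1/4\<close> as a lower bound at \<open>z\<close>.\<close>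
  define c where "c = M * M"
  have c: "c \<ge> 1" using mult_mono[OF M(1) M(1)] M(1) by (simp add: c_def)
  define g where "g w = of_real c + (-1) * p w" for w
  show ?thesis
  proof (rule that[of g "c - 1/2"])
    show "g \<in> invariants" unfolding g_def by (intro invariants_intros p)
    show "0 \<le> c - 1/2" using c by simp
    have "c - 1/4 \<le> Re (g z)" using p(3) by (simp add: g_def)
    then have "c - 1/4 \<le> cmod (g z)" using complex_Re_le_cmod order_trans by blast
    then show "c - 1/2 < cmod (g z)" by simp
    fix w assume w: "w \<in> C"
    have "(cmod (g w))\<^sup>2 = c\<^sup>2 - 2 * c * Re (p w) + (cmod (p w))\<^sup>2"
      unfolding g_def cmod_power2 by (simp add: power2_eq_square algebra_simps)
    also have "\<dots> \<le> c\<^sup>2 - 2 * c * 1 + c"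
    proof (intro add_mono diff_mono mult_left_mono)
      have "cmod (p w) \<le> M" using M(2) C(2) w by blast
      then show "(cmod (p w))\<^sup>2 \<le> c" by (simp add: c_def power2_eq_square mult_mono')
    qed (use p(2)[OF w] c in auto)
    also have "\<dots> \<le> (c - 1/2)\<^sup>2" by (simp add: power2_eq_square algebra_simps)
    finally show "cmod (g w) \<le> c - 1/2" using c by (auto intro: power2_le_imp_le[of _ "c - 1/2"])
  qed
qed

lemma invariant_in_function_algebra:
  assumes p: "p \<in> invariants"
  shows "(\<lambda>u\<in>Q_space closure_of D. u p) \<in> function_algebra D"
proof -
  have "continuous_map Q_space euclidean (\<lambda>u. u p)"
    unfolding Q_space_def
    by (intro continuous_map_from_subtopology continuous_map_product_projection p)
  then have "continuous_map (subtopology Q_space (Q_space closure_of D)) euclidean (\<lambda>u. u p)"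
    by (rule continuous_map_from_subtopology)
  then have "continuous_map (subtopology Q_space (Q_space closure_of D)) euclidean (\<lambda>u\<in>Q_space closure_of D. u p)"
    by (rule continuous_map_eq) simp
  then show ?thesis using p unfolding function_algebra_def Let_def by (auto intro!: bexI[of _ p])
qed

lemma boundary_closedin:
  "closedin (subtopology Q_space (Q_space closure_of D)) (boundary D)"
proof -
  let ?X = "subtopology Q_space (Q_space closure_of D)"
  have "topspace ?X \<in> {F. closedin ?X F \<and> (\<forall>f\<in>function_algebra D. \<forall>x\<in>topspace ?X. \<exists>y\<in>F. cmod (f x) \<le> cmod (f y))}"
    using closedin_topspace[of ?X] by blast
  then show ?thesis unfolding boundary_def shilov_boundary_def
    by (intro closedin_Inter) auto
qed

context
  fixes P :: "(complex^'n::finite^'n^'d::finite) set" and D :: "('n, 'd) mpoint set"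
  assumes red: "is_reduction P (Q_space closure_of D)"
begin

lemma quot: "quotient_map (top_of_set P) (subtopology Q_space (Q_space closure_of D)) pi0"
  and compP: "compact P"
  using red by (auto simp: is_reduction_def)

lemma pi0_image: "pi0 ` P = Q_space closure_of D"
  using quotient_imp_surjective_map[OF quot] by (simp add: closure_of_subset_topspace inf.absorb2)

lemma preimage_closed:
  assumes "closedin (subtopology Q_space (Q_space closure_of D)) F"
  shows "compact {z \<in> P. pi0 z \<in> F}"
proof -
  have "closedin (top_of_set P) {z \<in> P. pi0 z \<in> F}"
    using closedin_continuous_map_preimage[OF quotient_imp_continuous_map[OF quot] assms] by simp
  then show ?thesis using compP closedin_compact by blast
qed

text \<open>The image of the peak points is dense in the Shilov boundary: every closed boundary contains
  all peak points, and a closed set containing them is a boundary.\<close>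

lemma peak_point_in_boundary:
  assumes z: "peak_point P z" shows "pi0 z \<in> boundary D"
  unfolding boundary_def shilov_boundary_def
proof (intro InterI, clarify)
  fix F assume F: "closedin (subtopology Q_space (Q_space closure_of D)) F"
    and max: "\<forall>f\<in>function_algebra D. \<forall>x\<in>topspace (subtopology Q_space (Q_space closure_of D)). \<exists>y\<in>F. cmod (f x) \<le> cmod (f y)"
  show "pi0 z \<in> F"
  proof (rule ccontr)
    assume nF: "pi0 z \<notin> F"
    have zP: "z \<in> P" using z by (simp add: peak_point_def)
    define C where "C = {z \<in> P. pi0 z \<in> F}"
    have "closed C" unfolding C_def by (intro compact_imp_closed preimage_closed F)
    moreover have "C \<subseteq> P" "pi0 z \<notin> pi0 ` C" using nF by (auto simp: C_def)
    ultimately obtain g r where g: "g \<in> invariants" and r: "\<And>w. w \<in> C \<Longrightarrow> cmod (g w) \<le> r" "r < cmod (g z)"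
      using peak_point_modulus[OF compP z] by metis
    let ?f = "\<lambda>u\<in>Q_space closure_of D. u g"
    have "pi0 z \<in> Q_space closure_of D" using pi0_image zP by blast
    then have "pi0 z \<in> topspace (subtopology Q_space (Q_space closure_of D))"
      using closure_of_subset_topspace[of Q_space D] by auto
    then have "\<exists>y\<in>F. cmod (?f (pi0 z)) \<le> cmod (?f y)"
      using max invariant_in_function_algebra[OF g, of D] by blast
    moreover have FX: "F \<subseteq> Q_space closure_of D" using closedin_subset[OF F] by auto
    ultimately obtain y where y: "y \<in> F" "cmod (pi0 z g) \<le> cmod (y g)"
      using \<open>pi0 z \<in> Q_space closure_of D\<close> by (auto simp: subset_iff)
    then obtain w where w: "w \<in> P" "y = pi0 w" using FX pi0_image by blast
    then have "w \<in> C" using y by (simp add: C_def)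
    moreover have "cmod (g z) \<le> cmod (g w)" using y(2) w(2) by (simp add: pi0_apply g)
    ultimately show False using r(1)[of w] r(2) by simp
  qed
qed

lemma boundary_subset_closure:
  assumes F: "closedin (subtopology Q_space (Q_space closure_of D)) F"
    and peaks: "\<And>z. peak_point P z \<Longrightarrow> pi0 z \<in> F"
  shows "boundary D \<subseteq> F"
proof -
  have "\<exists>y\<in>F. cmod (f x) \<le> cmod (f y)" if f: "f \<in> function_algebra D" and x: "x \<in> Q_space closure_of D" for f x
  proof (rule ccontr)
    assume n: "\<not> (\<exists>y\<in>F. cmod (f x) \<le> cmod (f y))"
    obtain w where w: "w \<in> P" "x = pi0 w" using x pi0_image by blast
    then have Pne: "P \<noteq> {}" by blast
    define C where "C = {z \<in> P. pi0 z \<in> F}"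
    have C: "compact C" unfolding C_def by (rule preimage_closed[OF F])
    have "peak_point P z \<Longrightarrow> z \<in> C" for z using peaks by (auto simp: C_def peak_point_def)
    moreover obtain z0 where "peak_point P z0"
      using peak_point_near_maximum[OF compP Pne invariants_intros(4)[of 0], of 1] by auto
    ultimately have Cne: "C \<noteq> {}" by blast
    have "continuous_map (top_of_set P) euclidean (f \<circ> pi0)"
      using f by (intro continuous_map_compose[OF quotient_imp_continuous_map[OF quot]])
        (simp add: function_algebra_def Let_def)
    then have "continuous_on P (f \<circ> pi0)" by (simp only: continuous_map_iff_continuous)
    then have "continuous_on C (\<lambda>z. cmod ((f \<circ> pi0) z))"
      by (intro continuous_on_norm continuous_on_subset[of P "f \<circ> pi0" C]) (auto simp: C_def)
    then obtain y where y: "y \<in> C" "\<And>v. v \<in> C \<Longrightarrow> cmod (f (pi0 v)) \<le> cmod (f (pi0 y))"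
      using continuous_attains_sup[OF C Cne, of "\<lambda>z. cmod ((f \<circ> pi0) z)"] unfolding comp_def by blast
    define \<eta> where "\<eta> = (cmod (f x) - cmod (f (pi0 y))) / 5"
    have \<eta>: "\<eta> > 0" using n y(1) by (auto simp: \<eta>_def C_def not_le)
    obtain p where p: "p \<in> invariants" "\<And>u. u \<in> Q_space closure_of D \<Longrightarrow> cmod (f u - u p) < \<eta>"
      using f \<eta> unfolding function_algebra_def Let_def by blast
    have near: "\<bar>cmod (f (pi0 v)) - cmod (p v)\<bar> < \<eta>" if "v \<in> P" for v
      using p(2)[of "pi0 v"] pi0_image that norm_triangle_ineq3[of "f (pi0 v)" "p v"]
      by (force simp: pi0_apply[OF p(1)])
    \<comment> \<open>A rotation turns the modulus at \<open>w\<close> into a real part.\<close>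
    obtain a where a: "cmod a = 1" "a * p w = of_real (cmod (p w))"
    proof (cases "p w = 0")
      case False
      have "cnj (p w) * p w = of_real (cmod (p w)) * of_real (cmod (p w))"
        using complex_norm_square[of "p w"] by (simp add: power2_eq_square mult.commute)
      then show ?thesis using that[of "cnj (p w) / of_real (cmod (p w))"] False
        by (simp add: norm_divide)
    qed (use that[of 1] in auto)
    obtain z where z: "peak_point P z" "\<And>v. v \<in> P \<Longrightarrow> Re (a * p v) \<le> Re (a * p z) + \<eta>"
      using peak_point_near_maximum[OF compP Pne invariants_intros(3)[OF p(1)] \<eta>] by blast
    have zC: "z \<in> C" "z \<in> P" using z(1) peaks by (auto simp: C_def peak_point_def)
    have "cmod (p w) \<le> Re (a * p z) + \<eta>" using z(2)[OF w(1)] by (simp add: a(2))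
    also have "Re (a * p z) \<le> cmod (p z)"
      using complex_Re_le_cmod[of "a * p z"] by (simp add: norm_mult a(1))
    finally have "cmod (p w) \<le> cmod (p z) + \<eta>" by simp
    then have "cmod (f x) \<le> cmod (f (pi0 y)) + 3 * \<eta>"
      using near[OF w(1)] near[OF zC(2)] y(2)[OF zC(1)] unfolding w(2) abs_less_iff by argo
    then show False using \<eta> unfolding \<eta>_def by (simp add: field_simps)
  qed
  then show ?thesis unfolding boundary_def shilov_boundary_def using F by auto
qed

lemma boundary_nonempty: assumes "D \<noteq> {}" "D \<subseteq> topspace Q_space" shows "boundary D \<noteq> {}"
proof -
  have "P \<noteq> {}" using pi0_image assms closure_of_subset[of D Q_space] by auto
  then obtain z where "peak_point P z"
    using peak_point_near_maximum[OF compP _ invariants_intros(4)[of 0], of 1] by auto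
  then show ?thesis using peak_point_in_boundary by blast
qed

end

section \<open>Unital positive maps agreeing with a point evaluation\<close>

lemma mat_add: "mat (a + b) = (mat a + mat b :: complex^'n^'n)"
  by (simp add: mat_def vec_eq_iff)
lemma mat_mult: "mat a ** mat b = (mat (a * b) :: complex^'n^'n)"
  by (simp add: cscale_eq_mult(1)[symmetric])

lemma inner_i: "(\<i> *s v) \<bullet> v = 0" for v :: "complex^'n"
  by (simp add: inner_vec_def inner_complex_def)

lemma inner_adj_self: "(adj Y ** Y *v v) \<bullet> v = (norm (Y *v v))\<^sup>2"
  by (simp add: norm_mv_sq inner_commute)

lemma inner_i_adj_self: "(\<i> *s (adj Y ** Y *v v)) \<bullet> v = 0"
proof -
  have "\<i> *s (adj Y ** Y *v v) = adj Y *v (\<i> *s (Y *v v))"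
    by (simp add: vector_scalar_commute flip: matrix_vector_mul_assoc)
  then have "(\<i> *s (adj Y ** Y *v v)) \<bullet> v = (\<i> *s (Y *v v)) \<bullet> (Y *v v)"
    by (simp add: inner_adj)
  then show ?thesis by (simp add: inner_i)
qed

context reduced_bundle begin

text \<open>Evaluation at a peak point is the only completely positive map that extends its restriction to
  the trace algebra. The map is given here by the matrices \<open>w F\<close> that it assigns to equivariant
  functions. A function \<open>c\<close> vanishing at the point factors as \<open>c = h c'\<close> with the scalar factor
  \<open>h = sqrt \<parallel>c\<parallel>\<close>; the peak invariants bound \<open>h\<^sup>2\<close>, so \<open>w\<close> kills \<open>h\<^sup>2\<close>, and positivity of 2 by 2
  matrices then makes it kill \<open>h c'\<close>. Only scalar functions ever need a square root.\<close>

lemma peak_evaluation_unique: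
  fixes w :: "(complex^'n^'n^'d \<Rightarrow> complex^'n^'n) \<Rightarrow> complex^'n^'n"
  assumes peak: "peak_point P z0" and z0: "z0 \<in> PY"
    and cong: "\<And>F G. F \<in> EF \<Longrightarrow> G \<in> EF \<Longrightarrow> (\<And>z. z \<in> PY \<Longrightarrow> F z = G z) \<Longrightarrow> w F = w G"
    and add: "\<And>F G. F \<in> EF \<Longrightarrow> G \<in> EF \<Longrightarrow> w (\<lambda>z. F z + G z) = w F + w G"
    and scale: "\<And>F c. F \<in> EF \<Longrightarrow> w (\<lambda>z. cscale c (F z)) = cscale c (w F)"
    and pos: "\<And>F G. F \<in> EF \<Longrightarrow> G \<in> EF \<Longrightarrow>
       \<exists>Y Z Y' Z'. w (\<lambda>z. adj (F z) ** F z) = adj Y ** Y + adj Z ** Z \<and>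
         w (\<lambda>z. adj (F z) ** G z) = adj Y ** Y' + adj Z ** Z'"
    and agree: "\<And>f. f \<in> trace_algebra \<Longrightarrow> w f = f z0"
    and F: "F \<in> EF"
  shows "w F = F z0"
proof -
  define m where "m h = w (\<lambda>z. mat (h z))" for h
  have nonneg: "\<exists>Y Z. m (\<lambda>z. of_real (h z)) = adj Y ** Y + adj Z ** Z"
    if h: "(\<lambda>z. complex_of_real (h z)) \<in> IF" and h0: "\<And>z. z \<in> PY \<Longrightarrow> h z \<ge> 0" for h
  proof -
    have "continuous_on PY h" using continuous_on_Re[OF IF_cont[OF h]] by simp
    moreover have "h (conj_tuple k z) = h z" if "z \<in> PY" "k \<in> unitary_group" for z k
      using IF_conj[OF h that] by simp
    ultimately have s: "(\<lambda>z. complex_of_real (sqrt (h z))) \<in> IF"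
      by (auto simp: IF_def intro!: continuous_intros)
    define S where "S z = (mat (complex_of_real (sqrt (h z))) :: complex^'n^'n)" for z
    have S: "S \<in> EF" unfolding S_def by (rule EF_intros(6)[OF s])
    obtain Y Z where YZ: "w (\<lambda>z. adj (S z) ** S z) = adj Y ** Y + adj Z ** Z"
      using pos[OF S S] by blast
    have "m (\<lambda>z. of_real (h z)) = w (\<lambda>z. adj (S z) ** S z)"
      unfolding m_def
    proof (rule cong)
      show "(\<lambda>z. mat (complex_of_real (h z))) \<in> EF" by (rule EF_intros(6)[OF h])
      show "(\<lambda>z. adj (S z) ** S z) \<in> EF" by (intro EF_intros S)
      show "mat (complex_of_real (h z)) = adj (S z) ** S z" if "z \<in> PY" for z
        using h0[OF that] by (simp add: S_def mat_mult flip: of_real_mult)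
    qed
    then show ?thesis using YZ by metis
  qed
  have m_add: "m (\<lambda>z. f z + g z) = m f + m g" if "f \<in> IF" "g \<in> IF" for f g
    unfolding m_def mat_add by (intro add EF_intros that)
  have m_scale: "m (\<lambda>z. c * f z) = cscale c (m f)" if "f \<in> IF" for f c
    using scale[OF EF_intros(6)[OF that], of c] by (simp add: m_def)
  have m_inv: "m p = mat (p z0)" if "p \<in> invariants" for p
    unfolding m_def by (rule agree) (rule trace_algebra_intros(1)[OF that])
  have IF_add: "(\<lambda>z. f z + g z) \<in> IF" if "f \<in> IF" "g \<in> IF" for f g
    using that by (auto simp: IF_def intro!: continuous_intros)
  have IF_scale: "(\<lambda>z. c * f z) \<in> IF" if "f \<in> IF" for f c
    using that by (auto simp: IF_def intro!: continuous_intros)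
  have IF_Re: "(\<lambda>z. complex_of_real (Re (f z))) \<in> IF" "(\<lambda>z. complex_of_real (Im (f z))) \<in> IF" if "f \<in> IF" for f
    using that by (auto simp: IF_def intro!: continuous_intros)
  \<comment> \<open>A real function becomes nonnegative when a constant is added, so \<open>w\<close> maps it to a Hermitian matrix.\<close>
  have real: "(\<i> *s (m (\<lambda>z. of_real (h z)) *v v)) \<bullet> v = 0" if h: "(\<lambda>z. complex_of_real (h z)) \<in> IF" for h v
  proof -
    obtain M where M: "M \<ge> 1" "\<And>z. z \<in> PY \<Longrightarrow> norm (complex_of_real (h z)) \<le> M"
      using compact_bound[OF compact_PY IF_cont[OF h]] by blast
    have hM: "(\<lambda>z. complex_of_real (h z + M)) \<in> IF" using IF_add[OF h IF_const[of "of_real M"]] by simp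
    have "h z + M \<ge> 0" if "z \<in> PY" for z using M(2)[OF that] by (simp add: abs_le_iff)
    then obtain Y Z where YZ: "m (\<lambda>z. of_real (h z + M)) = adj Y ** Y + adj Z ** Z"
      using nonneg[OF hM] by blast
    have "m (\<lambda>z. of_real (h z + M)) = m (\<lambda>z. of_real (h z)) + mat (of_real M)"
      using m_add[OF h IF_const[of "of_real M"]] m_inv[OF invariants_intros(4), of "of_real M"] by simp
    then have mh: "m (\<lambda>z. of_real (h z)) = adj Y ** Y + adj Z ** Z - mat (of_real M)"
      using YZ by (simp add: algebra_simps)
    have "\<i> *s (m (\<lambda>z. of_real (h z)) *v v) =
       \<i> *s (adj Y ** Y *v v) + \<i> *s (adj Z ** Z *v v) - M *\<^sub>R (\<i> *s v)"
      unfolding mh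
      by (simp add: matrix_vector_mult_add_rdistrib matrix_vector_mult_diff_rdistrib mat_vec
          vec_eq_iff algebra_simps scaleR_conv_of_real[where 'a=complex])
    then show ?thesis by (simp add: inner_diff_left inner_add_left inner_i_adj_self inner_i)
  qed
  have Rep: "(m (\<lambda>z. of_real (Re (p z))) *v v) \<bullet> v = Re (p z0) * (norm v)\<^sup>2" if p: "p \<in> invariants" for p v
  proof -
    have "mat (p z0) = m (\<lambda>z. of_real (Re (p z)) + \<i> * of_real (Im (p z)))"
      using m_inv[OF p] by (simp flip: complex_eq)
    also have "\<dots> = m (\<lambda>z. of_real (Re (p z))) + cscale \<i> (m (\<lambda>z. of_real (Im (p z))))"
      using IF_Re[OF invariants_IF[OF p]] by (simp add: m_add m_scale IF_scale)
    finally have "(mat (p z0) *v v) \<bullet> v = (m (\<lambda>z. of_real (Re (p z))) *v v) \<bullet> v"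
      using real[OF IF_Re(2)[OF invariants_IF[OF p]], of v]
      by (simp add: matrix_vector_mult_add_rdistrib inner_add_left cscale_vec)
    moreover have "(mat (p z0) *v v) \<bullet> v = Re (p z0) * (norm v)\<^sup>2"
      unfolding mat_vec power2_norm_eq_inner
      by (simp add: inner_vec_def inner_complex_def sum_distrib_left algebra_simps)
    ultimately show ?thesis by simp
  qed
  have vanish: "w c = 0" if c: "c \<in> EF" and c0: "c z0 = 0" for c
  proof -
    define h where "h z = sqrt (opn (c z))" for z
    \<comment> \<open>At zeros of \<open>c\<close> the scalar \<open>inverse (h z)\<close> is \<open>inverse 0 = 0\<close>, and \<open>c'\<close> is continuous there because
      its norm is \<open>h\<close>.\<close>
    define c' where "c' z = inverse (h z) *\<^sub>R c z" for z
    have hc: "continuous_on PY h" unfolding h_def by (intro continuous_intros EF_cont c)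
    have hIF: "(\<lambda>z. complex_of_real (h z)) \<in> IF"
      using hc EF_conj[OF c] by (auto simp: IF_def h_def opn_conj intro!: continuous_intros)
    have oIF: "(\<lambda>z. complex_of_real (opn (c z))) \<in> IF"
      using EF_conj[OF c] by (auto simp: IF_def opn_conj intro!: continuous_intros EF_cont c)
    have opn': "opn (c' z) = h z" for z
    proof -
      have "opn (c' z) = \<bar>inverse (h z)\<bar> * (h z * h z)"
        using opn_cscale[of "of_real (inverse (h z))" "c z"] unfolding cscale_of_real
        by (simp add: c'_def h_def norm_inverse)
      moreover have "h z \<ge> 0" by (simp add: h_def)
      ultimately show ?thesis by (cases "h z = 0") simp_all
    qed
    have "continuous_on PY c'"
      unfolding continuous_on_def
    proof
      fix z assume z: "z \<in> PY"
      have hz: "(h \<longlongrightarrow> h z) (at z within PY)" and cz: "(c \<longlongrightarrow> c z) (at z within PY)"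
        using hc EF_cont[OF c] z by (simp_all add: continuous_on_def)
      show "(c' \<longlongrightarrow> c' z) (at z within PY)"
      proof (cases "h z = 0")
        case True
        have "(c' \<longlongrightarrow> 0) (at z within PY)"
        proof (rule Lim_null_comparison)
          show "\<forall>\<^sub>F x in at z within PY. norm (c' x) \<le> (real CARD('n))^2 * h x"
            using norm_le_opn[of "c' _"] by (simp add: opn')
          show "((\<lambda>x. (real CARD('n))^2 * h x) \<longlongrightarrow> 0) (at z within PY)"
            using tendsto_mult_left[OF hz, of "(real CARD('n))^2"] True by simp
        qed
        moreover have "c' z = 0" using True by (simp add: c'_def)
        ultimately show ?thesis by simp
      next
        case False
        then show ?thesis unfolding c'_def[abs_def] by (intro tendsto_scaleR tendsto_inverse hz cz)
      qed
    qed
    moreover have "c' (conj_tuple k z) = conj_mat k (c' z)" if "z \<in> PY" "k \<in> unitary_group" for z k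
    proof -
      have "conj_mat k (inverse (h z) *\<^sub>R c z) = inverse (h z) *\<^sub>R conj_mat k (c z)"
        using conj_mat_invertible(3)[OF unitary_invertible[OF that(2)], of "of_real (inverse (h z))"]
        unfolding cscale_of_real .
      then show ?thesis using EF_conj[OF c that] that(2) by (simp add: c'_def h_def opn_conj)
    qed
    ultimately have c'E: "c' \<in> EF" by (simp add: EF_def)
    define S where "S z = (mat (complex_of_real (h z)) :: complex^'n^'n)" for z
    have S: "S \<in> EF" unfolding S_def by (rule EF_intros(6)[OF hIF])
    obtain Y Z Y' Z' where YZ: "w (\<lambda>z. adj (S z) ** S z) = adj Y ** Y + adj Z ** Z"
      "w (\<lambda>z. adj (S z) ** c' z) = adj Y ** Y' + adj Z ** Z'"
      using pos[OF S c'E] by blast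
    have "(\<lambda>z. adj (S z) ** S z) = (\<lambda>z. mat (of_real (opn (c z))))"
      by (simp add: S_def mat_mult h_def flip: of_real_mult)
    then have mo: "m (\<lambda>z. of_real (opn (c z))) = adj Y ** Y + adj Z ** Z"
      using YZ(1) by (simp add: m_def)
    obtain M where M: "M \<ge> 1" "\<And>z. z \<in> PY \<Longrightarrow> opn (c z) \<le> M"
      using compact_bound[OF compact_PY IF_cont[OF oIF]] by auto
    have "Y *v v = 0 \<and> Z *v v = 0" for v
    proof -
      have eq: "(m (\<lambda>z. of_real (opn (c z))) *v v) \<bullet> v = (norm (Y *v v))\<^sup>2 + (norm (Z *v v))\<^sup>2"
        by (simp add: mo matrix_vector_mult_add_rdistrib inner_add_left inner_adj_self)
      have "(norm (Y *v v))\<^sup>2 + (norm (Z *v v))\<^sup>2 \<le> 0"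
      proof (rule field_le_epsilon)
        fix e :: real assume e: "e > 0"
        define d where "d = e / (2 * ((norm v)\<^sup>2 + 1))"
        have pv: "(norm v)\<^sup>2 + 1 > 0" by (simp add: add_nonneg_pos)
        have d: "d > 0" using e pv by (simp add: d_def)
        define C where "C = {z \<in> PY. d \<le> opn (c z)}"
        have "closed (PY \<inter> (\<lambda>z. opn (c z)) -` {d..})"
          by (rule continuous_closed_preimage[OF continuous_on_opn[OF EF_cont[OF c]]
                compact_imp_closed[OF compact_PY] closed_atLeast])
        then have "closed C" by (simp add: C_def vimage_def Int_def)
        moreover have "C \<subseteq> P" by (auto simp: C_def PY_def)
        moreover have "pi0 z0 \<notin> pi0 ` C"
        proof
          assume "pi0 z0 \<in> pi0 ` C"
          then obtain z where z: "z \<in> PY" "pi0 z0 = pi0 z" "d \<le> opn (c z)" by (auto simp: C_def)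
          then obtain k where "k \<in> unitary_group" "z = conj_tuple k z0"
            using P_orbit[of z0 z] z0 by (auto simp: PY_def)
          then have "opn (c z) = 0" using EF_conj[OF c z0] c0 by (simp add: conj_unitary)
          then show False using z(3) d by simp
        qed
        moreover have "d / M > 0" using d M(1) by simp
        ultimately obtain p where p: "p \<in> invariants" "\<And>z. z \<in> P \<Longrightarrow> 0 \<le> Re (p z)"
            "\<And>z. z \<in> C \<Longrightarrow> 1 \<le> Re (p z)" "Re (p z0) \<le> d / M"
          using peak[unfolded peak_point_def, THEN conjunct2, rule_format, of C "d / M"] by blast
        define q where "q z = of_real d + of_real M * p z" for z
        have q: "q \<in> invariants" unfolding q_def by (intro invariants_intros p)
        define k where "k z = Re (q z) - opn (c z)" for z
        have kk: "(\<lambda>z. complex_of_real (k z)) = (\<lambda>z. of_real (Re (q z)) + (-1) * of_real (opn (c z)))"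
          by (simp add: k_def)
        have kIF: "(\<lambda>z. complex_of_real (k z)) \<in> IF"
          unfolding kk by (intro IF_add IF_scale IF_Re oIF invariants_IF q)
        have "k z \<ge> 0" if z: "z \<in> PY" for z
        proof (cases "z \<in> C")
          case True
          have "M * 1 \<le> M * Re (p z)" using M(1) p(3)[OF True] by (intro mult_left_mono) auto
          then show ?thesis using M(2)[OF z] d by (simp add: k_def q_def)
        next
          case False
          then have "opn (c z) \<le> d" using z by (simp add: C_def)
          moreover have "0 \<le> M * Re (p z)" using M(1) p(2) z by (simp add: PY_def)
          ultimately show ?thesis by (simp add: k_def q_def)
        qed
        then obtain Y1 Z1 where "m (\<lambda>z. of_real (k z)) = adj Y1 ** Y1 + adj Z1 ** Z1"
          using nonneg[OF kIF] by blast
        then have "0 \<le> (m (\<lambda>z. of_real (k z)) *v v) \<bullet> v"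
          by (simp add: matrix_vector_mult_add_rdistrib inner_add_left inner_adj_self)
        also have "m (\<lambda>z. of_real (k z)) = m (\<lambda>z. of_real (Re (q z))) + cscale (-1) (m (\<lambda>z. of_real (opn (c z))))"
          unfolding kk by (simp only: m_add m_scale IF_scale IF_Re oIF invariants_IF q)
        also have "(\<dots> *v v) \<bullet> v = Re (q z0) * (norm v)\<^sup>2 - ((norm (Y *v v))\<^sup>2 + (norm (Z *v v))\<^sup>2)"
          unfolding matrix_vector_mult_add_rdistrib inner_add_left Rep[OF q] eq[symmetric] cscale_vec
          by (simp add: inner_vec_def sum_negf)
        finally have "(norm (Y *v v))\<^sup>2 + (norm (Z *v v))\<^sup>2 \<le> Re (q z0) * (norm v)\<^sup>2" by simp
        also have "\<dots> \<le> (2 * d) * ((norm v)\<^sup>2 + 1)"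
        proof (intro mult_mono)
          have "M * Re (p z0) \<le> M * (d / M)" using M(1) p(4) by (intro mult_left_mono) auto
          then show "Re (q z0) \<le> 2 * d" using M(1) by (simp add: q_def)
        qed (use d in auto)
        also have "\<dots> = e" using pv unfolding d_def by (simp only: times_divide_eq_right times_divide_eq_left nonzero_mult_divide_mult_cancel_left) (auto simp: field_simps)
        finally show "(norm (Y *v v))\<^sup>2 + (norm (Z *v v))\<^sup>2 \<le> 0 + e" by simp
      qed
      then show ?thesis by (simp add: sum_power2_le_zero_iff)
    qed
    then have "Y = 0" "Z = 0" by (simp_all add: matrix_eq)
    then have "w (\<lambda>z. adj (S z) ** c' z) = 0" using YZ(2) by simp
    moreover have "w (\<lambda>z. adj (S z) ** c' z) = w c"
    proof (rule cong)
      show "(\<lambda>z. adj (S z) ** c' z) \<in> EF" by (intro EF_intros S c'E)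
      show "adj (S z) ** c' z = c z" if "z \<in> PY" for z
        by (cases "c z = 0") (simp_all add: S_def c'_def h_def cscale_of_real flip: cscale_eq_mult(1))
    qed (rule c)
    ultimately show ?thesis by simp
  qed
  obtain f where f: "f \<in> generic_matrix_algebra" "f z0 = F z0" using generic_matrix_surj[OF PY_gen[OF z0]] .
  then have ft: "f \<in> trace_algebra" using generic_subset_trace by auto
  have fE: "f \<in> EF" by (rule trace_algebra_EF[OF ft])
  have "w F = w (\<lambda>z. (F z - f z) + f z)" by simp
  also have "\<dots> = w (\<lambda>z. F z - f z) + w f" by (intro add EF_intros F fE)
  also have "w (\<lambda>z. F z - f z) = 0" by (intro vanish EF_intros F fE) (simp add: f)
  finally show ?thesis using agree[OF ft] f by simp
qed

end

section \<open>Operators on a copy of complex n-space\<close>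

text \<open>The Hermitian inner product, linear in the first argument.\<close>

definition herm :: "complex^'n \<Rightarrow> complex^'n \<Rightarrow> complex"
  where "herm v w = (\<Sum>i\<in>UNIV. v $ i * cnj (w $ i))"

lemma herm_complex: "herm v w = Complex (v \<bullet> w) (v \<bullet> (\<i> *s w))"
  by (simp add: herm_def complex_eq_iff inner_vec_def inner_complex_def)

lemma herm_adj: "herm (A *v v) w = herm v (adj A *v w)"
  by (simp add: herm_complex inner_adj vector_scalar_commute)

lemma herm_self: "Re (herm v v) = (norm v)\<^sup>2"
  by (simp add: herm_complex power2_norm_eq_inner)

lemma matrix_of_linear:
  fixes f :: "complex^'n \<Rightarrow> complex^'n"
  assumes "\<And>x y. f (x + y) = f x + f y" "\<And>c x. f (c *s x) = c *s f x"
  obtains A where "\<And>x. f x = A *v x"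
proof -
  have "Vector_Spaces.linear (*s) (*s) f"
    unfolding Vector_Spaces.linear_iff using assms vec.vector_space_axioms by auto
  then show ?thesis using that matrix_works by metis
qed

lemma (in abelian_monoid) finsum_two:
  "f 0 \<in> carrier G \<Longrightarrow> f 1 \<in> carrier G \<Longrightarrow> finsum G f {..<2::nat} = f 0 \<oplus> f 1"
  "f 0 \<in> carrier G \<Longrightarrow> finsum G f {..<1::nat} = f 0"
proof -
  have "{..<2::nat} = {0, 1}" "{..<1::nat} = {0}" by auto
  then show "f 0 \<in> carrier G \<Longrightarrow> f 1 \<in> carrier G \<Longrightarrow> finsum G f {..<2::nat} = f 0 \<oplus> f 1"
    "f 0 \<in> carrier G \<Longrightarrow> finsum G f {..<1::nat} = f 0"
    by (simp_all add: Pi_def)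
qed

text \<open>Boundary representations have to live on a Hilbert space whose elements are sections; any
  injection of \<open>\<complex>\<^sup>n\<close> into the type of sections provides one.\<close>

locale hilbert_copy =
  fixes e :: "complex^'n::finite \<Rightarrow> 'h"
  assumes inj_e: "inj e"
begin

abbreviation ei where "ei \<equiv> inv_into UNIV e"

lemma inv_e [simp]: "ei (e v) = v" by (rule inv_f_f[OF inj_e])
lemma e_eq [simp]: "e v = e w \<longleftrightarrow> v = w" using inj_e by (simp add: inj_eq)

text \<open>The Hilbert space \<open>\<complex>\<^sup>n\<close>, carried over to the range of the injection. The fields \<open>mult\<close> and \<open>one\<close>
  are dummies.\<close>

definition HS :: "'h hilbert_struct" where
  "HS = \<lparr>carrier = range e, mult = (\<lambda>x y. e 0), one = e 0, zero = e 0,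
     add = (\<lambda>x y. e (ei x + ei y)), smult = (\<lambda>c x. e (c *s ei x)),
     hinner = (\<lambda>x y. herm (ei x) (ei y))\<rparr>"

lemma HS_simps [simp]:
  "carrier HS = range e" "\<zero>\<^bsub>HS\<^esub> = e 0" "e v \<oplus>\<^bsub>HS\<^esub> e w = e (v + w)" "c \<odot>\<^bsub>HS\<^esub> e v = e (c *s v)"
  "hinner HS (e v) (e w) = herm v w" "hnorm HS (e v) = norm v"
  by (simp_all add: HS_def hnorm_def herm_self)

lemma HS_module: "Module.module complex_alg HS"
proof (rule Module.module.intro)
  show "cring complex_alg" by (rule cring_complex_alg)
  show "abelian_group HS"
  proof (rule abelian_groupI)
    show "\<exists>y\<in>carrier HS. y \<oplus>\<^bsub>HS\<^esub> x = \<zero>\<^bsub>HS\<^esub>" if "x \<in> carrier HS" for x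
    proof -
      obtain v where "x = e v" using \<open>x \<in> carrier HS\<close> by auto
      then show ?thesis by (intro bexI[of _ "e (- v)"]) auto
    qed
  qed (auto simp: algebra_simps)
  show "module_axioms complex_alg HS"
    by unfold_locales (auto simp: vector_add_ldistrib vector_sadd_rdistrib)
qed

lemma HS_minus: "e v \<ominus>\<^bsub>HS\<^esub> e w = e (v - w)"
proof -
  interpret abelian_group HS using HS_module by (rule Module.module.axioms(2))
  have "\<ominus>\<^bsub>HS\<^esub> e w = e (- w)" by (rule minus_equality) auto
  then show ?thesis by (simp add: a_minus_def)
qed

lemma hdist_HS: "hdist HS (e v) (e w) = dist v w"
  by (simp add: hdist_def HS_minus dist_norm)

lemma HS_hilbert: "hilbert_space HS"
proof -
  have "Metric_space (range e) (hdist HS)"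
  proof
    show "0 \<le> hdist HS x y" "hdist HS x y = hdist HS y x" for x y
      by (cases "x \<in> range e \<and> y \<in> range e"; auto simp: hdist_HS dist_commute; auto simp: hdist_def)+
  qed (auto simp: hdist_HS dist_triangle)
  then interpret M: Metric_space "range e" "hdist HS" .
  have "M.mcomplete" unfolding M.mcomplete_def
  proof (intro allI impI)
    fix s assume s: "M.MCauchy s"
    then have sr: "s i \<in> range e" for i by (auto simp: M.MCauchy_def)
    define v where "v i = ei (s i)" for i
    have v: "s i = e (v i)" for i using f_inv_into_f[OF sr] by (simp add: v_def)
    have "Cauchy v" using s by (simp add: M.MCauchy_def v hdist_HS Cauchy_def)
    then obtain l where l: "v \<longlonglongrightarrow> l" using Cauchy_convergent_iff convergentD by blast
    then have "limitin M.mtopology s (e l) sequentially"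
      unfolding M.limit_metric_sequentially by (simp add: v hdist_HS lim_sequentially)
    then show "\<exists>x. limitin M.mtopology s x sequentially" by blast
  qed
  moreover have "herm w v = cnj (herm v w)" for v w :: "complex^'n"
    by (simp add: herm_def mult.commute)
  moreover have "0 < Re (herm v v)" if "v \<noteq> 0" for v :: "complex^'n"
    using that by (simp add: herm_self)
  ultimately show ?thesis
    unfolding hilbert_space_def using HS_module
    by (auto simp: herm_def sum.distrib sum_distrib_left algebra_simps)
qed

text \<open>The operator with matrix \<open>A\<close>, as an element of \<open>B(H)\<close>.\<close>

definition op :: "complex^'n^'n \<Rightarrow> 'h \<Rightarrow> 'h" where
  "op A = (\<lambda>x\<in>range e. e (A *v ei x))"

lemma op_apply [simp]: "op A (e v) = e (A *v v)" by (simp add: op_def)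

lemma op_ext: "(\<And>v. T (e v) = e (A *v v)) \<Longrightarrow> T \<in> extensional (range e) \<Longrightarrow> T = op A"
  by (rule extensionalityI[of _ "range e"]) (auto simp: op_def)

lemma op_eq [simp]: "op A = op C \<longleftrightarrow> A = C"
proof
  assume "op A = op C"
  then have "A *v v = C *v v" for v by (metis op_apply e_eq)
  then show "A = C" by (simp add: matrix_eq)
qed simp

lemma bounded_ops_HS: "bounded_ops HS = range op"
proof
  show "range op \<subseteq> bounded_ops HS"
  proof
    fix T assume "T \<in> range op"
    then obtain A where T: "T = op A" by auto
    have "\<exists>b. \<forall>x\<in>carrier HS. hnorm HS (T x) \<le> b * hnorm HS x"
      using opn_bound[of A] by (intro exI[of _ "opn A"]) (auto simp: T)
    then show "T \<in> bounded_ops HS"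
      by (auto simp: bounded_ops_def T matrix_vector_right_distrib vector_scalar_commute) (auto simp: op_def)
  qed
  show "bounded_ops HS \<subseteq> range op"
  proof
    fix T assume T: "T \<in> bounded_ops HS"
    then have TE: "T \<in> range e \<rightarrow>\<^sub>E range e"
      and add: "\<And>v w. T (e (v + w)) = T (e v) \<oplus>\<^bsub>HS\<^esub> T (e w)"
      and sc: "\<And>c v. T (e (c *s v)) = c \<odot>\<^bsub>HS\<^esub> T (e v)"
      by (auto simp: bounded_ops_def)
    define f where "f v = ei (T (e v))" for v
    have Tf: "T (e v) = e (f v)" for v
      using PiE_mem[OF TE, of "e v"] by (auto simp: f_def)
    have "f (v + w) = f v + f w" "f (c *s v) = c *s f v" for v w c
      using add[of v w] sc[of c v] by (simp_all add: Tf)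
    then obtain A where "\<And>x. f x = A *v x" using matrix_of_linear by blast
    then have "T = op A" using Tf TE by (intro op_ext) (auto simp: PiE_def)
    then show "T \<in> range op" by simp
  qed
qed

text \<open>The algebra of bounded operators, which are exactly the operators given by matrices.\<close>

abbreviation OA where "OA \<equiv> op_alg HS"

lemma OA_carrier: "carrier OA = range op"
  by (simp add: op_alg_def bounded_ops_HS)

lemma OA_simps [simp]:
  "op A \<otimes>\<^bsub>OA\<^esub> op C = op (A ** C)" "op A \<oplus>\<^bsub>OA\<^esub> op C = op (A + C)"
  "\<one>\<^bsub>OA\<^esub> = op (mat 1)" "\<zero>\<^bsub>OA\<^esub> = op 0" "c \<odot>\<^bsub>OA\<^esub> op A = op (cscale c A)"
  by (rule op_ext; auto simp: op_alg_def matrix_vector_mul_assoc matrix_vector_mult_add_rdistrib cscale_vec)+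

lemma OA_star [simp]: "star OA (op A) = op (adj A)"
proof -
  have "star OA (op A) = (THE S. S \<in> bounded_ops HS \<and>
       (\<forall>x\<in>carrier HS. \<forall>y\<in>carrier HS. hinner HS (op A x) y = hinner HS x (S y)))"
    by (simp add: op_alg_def)
  also have "\<dots> = op (adj A)"
  proof (rule the_equality)
    show "op (adj A) \<in> bounded_ops HS \<and>
       (\<forall>x\<in>carrier HS. \<forall>y\<in>carrier HS. hinner HS (op A x) y = hinner HS x (op (adj A) y))"
      by (auto simp: bounded_ops_HS herm_adj)
    fix S assume S: "S \<in> bounded_ops HS \<and>
       (\<forall>x\<in>carrier HS. \<forall>y\<in>carrier HS. hinner HS (op A x) y = hinner HS x (S y))"
    then obtain C where C: "S = op C" by (auto simp: bounded_ops_HS)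
    have "herm v (adj A *v w) = herm v (C *v w)" for v w
      using S by (simp add: C herm_adj)
    then have "v \<bullet> (adj A *v w) = v \<bullet> (C *v w)" for v w
      unfolding herm_complex by (metis complex.inject)
    then have "adj A *v w = C *v w" for w using vector_eq_ldot by blast
    then show "S = op (adj A)" unfolding C by (simp add: matrix_eq)
  qed
  finally show ?thesis .
qed

lemma OA_abelian_monoid: "abelian_monoid OA"
  by (rule abelian_monoidI) (auto simp: OA_carrier add.assoc add.commute)

end

section \<open>Boundary representations\<close>

context reduced_bundle begin

lemma B_abelian_monoid: "abelian_monoid B"
  using B_abelian_group by (rule abelian_group.axioms)

text \<open>Complete positivity is used only for the 2 by 2 matrix \<open>x\<^sup>*x\<close>, where \<open>x\<close> has first row \<open>F, G\<close>
  and second row 0.\<close>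

lemma ucp_two_positive:
  fixes e :: "complex^'n \<Rightarrow> 'h"
  assumes e: "hilbert_copy e"
    and ucp: "unital_completely_positive B (op_alg (hilbert_copy.HS e)) \<omega>"
    and F: "F \<in> EF" and G: "G \<in> EF"
  obtains R S R' S' where
    "\<omega> (sec (\<lambda>z. adj (F z) ** F z)) = hilbert_copy.op e (adj R ** R + adj S ** S)"
    "\<omega> (sec (\<lambda>z. adj (F z) ** G z)) = hilbert_copy.op e (adj R ** R' + adj S ** S')"
proof -
  interpret hilbert_copy e by (rule e)
  interpret OA: abelian_monoid OA by (rule OA_abelian_monoid)
  interpret B: abelian_monoid B by (rule B_abelian_monoid)
  let ?I = "{..<2::nat} \<times> {..<2::nat}"
  define X where "X i j = (if i = 0 then if j = 0 then F else G else (\<lambda>z. 0))" for i j :: nat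
  have X: "X i j \<in> EF" for i j using F G EF_intros(7) by (simp add: X_def)
  define x where "x = (\<lambda>(i,j)\<in>?I. sec (X i j))"
  have xc: "x \<in> carrier (mat_over 2 B)"
    by (auto simp: x_def mat_over_def intro!: sec_carrier X)
  have x: "x (i, j) = sec (X i j)" if "i < 2" "j < 2" for i j
    using that by (simp add: x_def)
  define a where "a = star (mat_over 2 B) x \<otimes>\<^bsub>mat_over 2 B\<^esub> x"
  have star: "star (mat_over 2 B) x (i, j) = sec (\<lambda>z. adj (X j i z))" if "i < 2" "j < 2" for i j
    using that by (simp add: mat_over_def x sec_star)
  have 2: "(0::nat) < 2" "(1::nat) < 2" by auto
  have a_eq: "a (i, j) = sec (\<lambda>z. adj (X 0 i z) ** X 0 j z + adj (X 1 i z) ** X 1 j z)"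
    if "i < 2" "j < 2" for i j
  proof -
    have "a (i, j) = (\<Oplus>\<^bsub>B\<^esub>k\<in>{..<2}. star (mat_over 2 B) x (i, k) \<otimes>\<^bsub>B\<^esub> x (k, j))"
      using that by (simp add: a_def mat_over_def)
    also have "\<dots> = (star (mat_over 2 B) x (i, 0) \<otimes>\<^bsub>B\<^esub> x (0, j)) \<oplus>\<^bsub>B\<^esub> (star (mat_over 2 B) x (i, 1) \<otimes>\<^bsub>B\<^esub> x (1, j))"
      using that 2 by (intro B.finsum_two) (auto simp: star x sec_mult intro!: sec_carrier EF_intros X)
    finally show ?thesis using that by (simp add: star x sec_mult sec_add)
  qed
  have a00: "a (0, 0) = sec (\<lambda>z. adj (F z) ** F z)"
    using a_eq[of 0 0] by (simp add: X_def)
  have a01: "a (0, 1) = sec (\<lambda>z. adj (F z) ** G z)"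
    using a_eq[of 0 1] by (simp add: X_def)
  have "cstar_positive (mat_over 2 B) a"
    unfolding cstar_positive_def a_def using xc by blast
  then have "cstar_positive (mat_over 2 OA) (entrywise 2 \<omega> a)"
    using ucp by (auto simp: unital_completely_positive_def)
  then obtain y where y: "y \<in> carrier (mat_over 2 OA)"
    and wa: "entrywise 2 \<omega> a = star (mat_over 2 OA) y \<otimes>\<^bsub>mat_over 2 OA\<^esub> y"
    by (auto simp: cstar_positive_def)
  have "y (i, j) \<in> range op" if "i < 2" "j < 2" for i j
    using y that by (auto simp: mat_over_def OA_carrier PiE_def Pi_def)
  then have "\<exists>C. y (i, j) = op C" if "i < 2" "j < 2" for i j using that by blast
  then obtain C where C: "\<And>i j. i < 2 \<Longrightarrow> j < 2 \<Longrightarrow> y (i, j) = op (C i j)" by metis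
  have starO: "star (mat_over 2 OA) y (i, j) = op (adj (C j i))" if "i < 2" "j < 2" for i j
    using that by (simp add: mat_over_def C)
  have w_eq: "\<omega> (a (i, j)) = op (adj (C 0 i) ** C 0 j + adj (C 1 i) ** C 1 j)" if "i < 2" "j < 2" for i j
  proof -
    have "\<omega> (a (i, j)) = entrywise 2 \<omega> a (i, j)" using that by (simp add: entrywise_def)
    also have "\<dots> = (\<Oplus>\<^bsub>OA\<^esub>k\<in>{..<2}. star (mat_over 2 OA) y (i, k) \<otimes>\<^bsub>OA\<^esub> y (k, j))"
      unfolding wa using that by (simp add: mat_over_def)
    also have "\<dots> = (star (mat_over 2 OA) y (i, 0) \<otimes>\<^bsub>OA\<^esub> y (0, j)) \<oplus>\<^bsub>OA\<^esub> (star (mat_over 2 OA) y (i, 1) \<otimes>\<^bsub>OA\<^esub> y (1, j))"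
      using that 2 by (intro OA.finsum_two) (auto simp: starO C OA_carrier)
    finally show ?thesis using that by (simp add: starO C)
  qed
  show ?thesis
    using that[of "C 0 0" "C 1 0" "C 0 1" "C 1 1"] w_eq[of 0 0] w_eq[of 0 1] a00 a01 by simp
qed

text \<open>The representation by evaluation at \<open>z\<close>, on a copy of \<open>\<complex>\<^sup>n\<close>: the value of a section over \<open>pi0 z\<close>
  is the graph of a function, which is evaluated at \<open>z\<close>.\<close>

definition eval_rep :: "(complex^'n \<Rightarrow> 'h) \<Rightarrow> complex^'n^'n^'d \<Rightarrow> ('n, 'd) bundle_section \<Rightarrow> 'h \<Rightarrow> 'h" where
  "eval_rep e z s = hilbert_copy.op e (THE A. (z, A) \<in> s (pi0 z))"

lemma eval_rep_sec:
  assumes "z \<in> PY" shows "eval_rep e z (sec F) = hilbert_copy.op e (F z)"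
proof -
  have "(THE A. (z, A) \<in> sec F (pi0 z)) = F z"
    by (rule the_equality) (use assms in \<open>auto simp: sec_def PY_def\<close>)
  then show ?thesis by (simp add: eval_rep_def)
qed

text \<open>Irreducibility holds because the values at \<open>z\<close> of the coordinates generate all matrices.\<close>

lemma eval_rep_irreducible:
  fixes e :: "complex^'n \<Rightarrow> 'h"
  assumes e: "hilbert_copy e" and z: "z \<in> PY"
  shows "irreducible_representation B (hilbert_copy.HS e) (eval_rep e z)"
proof -
  interpret hilbert_copy e by (rule e)
  have "star_hom B OA (eval_rep e z)"
    unfolding star_hom_def
  proof (intro conjI allI ballI)
    show "eval_rep e z \<in> ring_hom B OA"
      by (rule ring_hom_memI)
        (auto elim!: carrierE simp: sec_mult sec_add sec_one eval_rep_sec[OF z] OA_carrier)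
  qed (auto elim!: carrierE simp: sec_smult sec_star eval_rep_sec[OF z])
  moreover have "carrier HS \<noteq> {\<zero>\<^bsub>HS\<^esub>}"
  proof -
    have "vec 1 \<noteq> (0 :: complex^'n)" by (simp add: vec_eq_iff)
    then have "e (vec 1) \<in> carrier HS" "e (vec 1) \<noteq> \<zero>\<^bsub>HS\<^esub>" by (simp_all only: HS_simps rangeI e_eq simp_thms)
    then show ?thesis by blast
  qed
  moreover have "W = {\<zero>\<^bsub>HS\<^esub>} \<or> W = carrier HS"
    if W: "submodule W complex_alg HS" and inv: "\<forall>b\<in>carrier B. eval_rep e z b ` W \<subseteq> W" for W
  proof (cases "W \<subseteq> {\<zero>\<^bsub>HS\<^esub>}")
    case True
    moreover have "\<zero>\<^bsub>HS\<^esub> \<in> W"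
      using subgroup.one_closed[OF submodule.axioms(1)[OF W]] by simp
    ultimately show ?thesis by blast
  next
    case False
    have sub: "W \<subseteq> carrier HS" using subgroup.subset[OF submodule.axioms(1)[OF W]] by simp
    obtain x where x: "x \<in> W" "x \<noteq> e 0" using False by auto
    then obtain v where v: "x = e v" using sub by auto
    then have "v \<noteq> 0" using x by auto
    then obtain i where i: "v $ i \<noteq> 0" by (auto simp: vec_eq_iff)
    have "e u \<in> W" for u
    proof -
      define A :: "complex^'n^'n" where "A = (\<chi> k j. if j = i then u $ k / v $ i else 0)"
      have Av: "A *v v = u"
        using i by (simp add: A_def matrix_vector_mult_def vec_eq_iff if_distrib if_distribR cong: if_cong)
      obtain f where f: "f \<in> generic_matrix_algebra" "f z = A" using generic_matrix_surj[OF PY_gen[OF z]] .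
      then have "f \<in> EF" using generic_subset_trace trace_algebra_EF by auto
      then have "eval_rep e z (sec f) x \<in> W" using inv x sec_carrier by blast
      then show ?thesis by (simp add: eval_rep_sec[OF z] f v Av)
    qed
    then show ?thesis using sub by auto
  qed
  ultimately show ?thesis
    unfolding irreducible_representation_def using HS_hilbert by blast
qed

lemma eval_rep_boundary:
  fixes e :: "complex^'n \<Rightarrow> 'h"
  assumes e: "hilbert_copy e" and z: "z \<in> PY" and peak: "peak_point P z"
  shows "boundary_representation B TA (hilbert_copy.HS e) (eval_rep e z)"
  unfolding boundary_representation_def
proof (intro conjI allI impI ballI eval_rep_irreducible[OF e z])
  interpret hilbert_copy e by (rule e)
  fix \<omega> b
  assume "unital_completely_positive B OA \<omega> \<and> (\<forall>a\<in>TA. \<omega> a = eval_rep e z a)" and b: "b \<in> carrier B"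
  then have ucp: "unital_completely_positive B OA \<omega>" and agree: "\<And>a. a \<in> TA \<Longrightarrow> \<omega> a = eval_rep e z a"
    by auto
  obtain F where F: "F \<in> EF" "b = sec F" using b by (rule carrierE)
  define w where "w G = (SOME A. \<omega> (sec G) = op A)" for G
  have w: "\<omega> (sec G) = op (w G)" if "G \<in> EF" for G
  proof -
    have "\<omega> (sec G) \<in> range op"
      using ucp sec_carrier[OF that] by (auto simp: unital_completely_positive_def OA_carrier)
    then obtain A where "\<omega> (sec G) = op A" by auto
    then show ?thesis unfolding w_def by (rule someI)
  qed
  have "w F = F z"
  proof (rule peak_evaluation_unique[OF peak z _ _ _ _ _ F(1)])
    show "w F = w G" if "\<And>z. z \<in> PY \<Longrightarrow> F z = G z" for F G
      using that unfolding w_def by (metis sec_eq_iff)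
    show "w (\<lambda>z. F z + G z) = w F + w G" if "F \<in> EF" "G \<in> EF" for F G
    proof -
      have "\<omega> (sec F \<oplus>\<^bsub>B\<^esub> sec G) = \<omega> (sec F) \<oplus>\<^bsub>OA\<^esub> \<omega> (sec G)"
        using ucp that sec_carrier by (auto simp: unital_completely_positive_def)
      then show ?thesis by (simp add: sec_add w that EF_intros)
    qed
    show "w (\<lambda>z. cscale c (F z)) = cscale c (w F)" if "F \<in> EF" for F c
    proof -
      have "\<omega> (c \<odot>\<^bsub>B\<^esub> sec F) = c \<odot>\<^bsub>OA\<^esub> \<omega> (sec F)"
        using ucp that sec_carrier by (auto simp: unital_completely_positive_def)
      then show ?thesis by (simp add: sec_smult w that EF_intros)
    qed
    show "\<exists>Y Z Y' Z'. w (\<lambda>z. adj (F z) ** F z) = adj Y ** Y + adj Z ** Z \<and>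
         w (\<lambda>z. adj (F z) ** G z) = adj Y ** Y' + adj Z ** Z'" if "F \<in> EF" "G \<in> EF" for F G
    proof -
      have "(\<lambda>z. adj (F z) ** F z) \<in> EF" "(\<lambda>z. adj (F z) ** G z) \<in> EF" using \<open>F \<in> EF\<close> \<open>G \<in> EF\<close> by (auto intro!: EF_intros)
      moreover obtain Y Z Y' Z' where
        "\<omega> (sec (\<lambda>z. adj (F z) ** F z)) = op (adj Y ** Y + adj Z ** Z)"
        "\<omega> (sec (\<lambda>z. adj (F z) ** G z)) = op (adj Y ** Y' + adj Z ** Z')"
        by (rule ucp_two_positive[OF e ucp \<open>F \<in> EF\<close> \<open>G \<in> EF\<close>])
      ultimately have "w (\<lambda>z. adj (F z) ** F z) = adj Y ** Y + adj Z ** Z"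
         "w (\<lambda>z. adj (F z) ** G z) = adj Y ** Y' + adj Z ** Z'" by (simp_all add: w)
      then show ?thesis by blast
    qed
    show "w f = f z" if f: "f \<in> trace_algebra" for f
    proof -
      have "sec f \<in> TA" unfolding TA_TF using trace_algebra_TF[OF f] by simp
      then have "op (w f) = op (f z)"
        using agree w[OF trace_algebra_EF[OF f]] by (simp add: eval_rep_sec[OF z])
      then show ?thesis by simp
    qed
  qed
  then show "\<omega> b = eval_rep e z b" using w[OF F(1)] by (simp add: F eval_rep_sec[OF z])
qed

end

section \<open>Closed ideals\<close>

lemma scaleR_mv: "(r *\<^sub>R A) *v v = r *\<^sub>R (A *v v)" for A :: "complex^'n^'n"
  by (simp add: matrix_vector_mult_def vec_eq_iff scaleR_right.sum)

lemma mv_scaleR: "A *v (r *\<^sub>R v) = r *\<^sub>R (A *v v)" for A :: "complex^'n^'n"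
  by (simp add: matrix_vector_mult_def vec_eq_iff scaleR_right.sum)

lemma contraction_identity:
  assumes c: "c \<ge> 0" "c * (opn F)\<^sup>2 \<le> 1"
  shows "(norm (v - c *\<^sub>R (F ** adj F *v v)))\<^sup>2 \<le> (norm v)\<^sup>2 - c * (norm (adj F *v v))\<^sup>2"
proof -
  define u where "u = adj F *v v"
  have Fu: "F ** adj F *v v = F *v u" by (simp add: u_def matrix_vector_mul_assoc)
  have ip: "v \<bullet> (F *v u) = (norm u)\<^sup>2"
    using inner_adj[of "adj F" v u] by (simp add: u_def power2_norm_eq_inner)
  have "(norm (F *v u))\<^sup>2 \<le> (opn F * norm u)\<^sup>2" by (intro power_mono opn_bound) simp
  then have "c * (c * (norm (F *v u))\<^sup>2) \<le> c * ((c * (opn F)\<^sup>2) * (norm u)\<^sup>2)"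
    using c(1) by (intro mult_left_mono) (simp_all add: power_mult_distrib mult.assoc mult_left_mono)
  also have "\<dots> \<le> c * (1 * (norm u)\<^sup>2)"
    using c by (intro mult_left_mono mult_right_mono) auto
  finally have le: "c * (c * (norm (F *v u))\<^sup>2) \<le> c * (norm u)\<^sup>2" by simp
  have "(norm (v - c *\<^sub>R (F *v u)))\<^sup>2 = (norm v)\<^sup>2 - 2 * c * (v \<bullet> (F *v u)) + c * (c * (norm (F *v u))\<^sup>2)"
    by (simp add: power2_norm_eq_inner inner_diff_left inner_diff_right inner_commute algebra_simps)
  then show ?thesis using le unfolding Fu ip u_def[symmetric] by simp
qed

text \<open>The power \<open>S\<^sup>m\<close> of \<open>S = 1 - c F F\<^sup>*\<close>.\<close>

definition spow :: "real \<Rightarrow> complex^'n^'n \<Rightarrow> nat \<Rightarrow> complex^'n^'n" where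
  "spow c F m = (((**) (mat 1 - c *\<^sub>R (F ** adj F))) ^^ m) (mat 1)"

lemma spow_simps: "spow c F 0 = mat 1" "spow c F (Suc m) = (mat 1 - c *\<^sub>R (F ** adj F)) ** spow c F m"
  by (simp_all add: spow_def)

text \<open>If \<open>c > 0\<close> and \<open>c \<parallel>F\<parallel>\<^sup>2 \<le> 1\<close>, then \<open>\<parallel>F\<^sup>* S\<^sup>m\<parallel> \<le> 1 / sqrt (m c)\<close> for \<open>m > 0\<close>: the norms \<open>\<parallel>F\<^sup>* S\<^sup>i v\<parallel>\<close> decrease
  in \<open>i\<close>, and the sum of their squares is bounded by telescoping.\<close>

lemma spow_bound:
  assumes c: "c > 0" "c * (opn F)\<^sup>2 \<le> 1"
  shows "real m * c * (opn (adj F ** spow c F m))\<^sup>2 \<le> 1"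
proof -
  define N where "N v i = (norm (adj F ** spow c F i *v v))\<^sup>2" for v i
  have step: "spow c F (Suc i) *v v = spow c F i *v v - c *\<^sub>R (F ** adj F *v (spow c F i *v v))" for v i
    by (simp add: spow_simps matrix_vector_mult_diff_rdistrib scaleR_mv flip: matrix_vector_mul_assoc)
  have decr: "N v (Suc i) \<le> N v i" for v i
  proof -
    define u where "u = adj F *v (spow c F i *v v)"
    have "adj F ** spow c F (Suc i) *v v = adj F *v (spow c F (Suc i) *v v)"
      by (simp add: matrix_vector_mul_assoc)
    also have "\<dots> = u - c *\<^sub>R (adj F ** adj (adj F) *v u)"
      unfolding step u_def by (simp add: matrix_vector_mult_diff_distrib mv_scaleR matrix_vector_mul_assoc matrix_mul_assoc)
    finally have "N v (Suc i) \<le> (norm u)\<^sup>2 - c * (norm (adj (adj F) *v u))\<^sup>2"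
      using contraction_identity[of c "adj F" u] c by (simp add: N_def)
    also have "\<dots> \<le> (norm u)\<^sup>2" using c by simp
    finally show ?thesis by (simp add: N_def u_def matrix_vector_mul_assoc)
  qed
  have tele: "c * (\<Sum>i<m. N v i) \<le> (norm v)\<^sup>2 - (norm (spow c F m *v v))\<^sup>2" for v m
  proof (induction m)
    case (Suc m)
    have "(norm (spow c F (Suc m) *v v))\<^sup>2 \<le> (norm (spow c F m *v v))\<^sup>2 - c * N v m"
      unfolding step N_def using contraction_identity[of c F "spow c F m *v v"] c
      by (simp add: matrix_vector_mul_assoc)
    then show ?case using Suc by (simp add: algebra_simps)
  qed (simp add: spow_simps)
  have "norm (adj F ** spow c F m *v v) \<le> sqrt (1 / (real m * c)) * norm v" if m: "m > 0" for v
  proof -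
    have anti: "N v m \<le> N v i" if "i \<le> m" for i
      using that by (induction rule: inc_induct) (auto intro: order_trans[OF _ decr])
    have "real m * N v m = (\<Sum>i<m. N v m)" by simp
    also have "\<dots> \<le> (\<Sum>i<m. N v i)" by (intro sum_mono anti) auto
    finally have "c * (real m * N v m) \<le> c * (\<Sum>i<m. N v i)" using c by simp
    also have "\<dots> \<le> (norm v)\<^sup>2" using tele[of v m] by (smt (verit) zero_le_power2)
    finally have "N v m \<le> 1 / (real m * c) * (norm v)\<^sup>2" using c m by (simp add: field_simps)
    then have "(norm (adj F ** spow c F m *v v))\<^sup>2 \<le> (sqrt (1 / (real m * c)) * norm v)\<^sup>2"
      using c m by (simp add: N_def power_mult_distrib)
    then show ?thesis by (rule power2_le_imp_le) (use c in auto)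
  qed
  then have "opn (adj F ** spow c F m) \<le> sqrt (1 / (real m * c))" if "m > 0"
    using that by (intro opn_le) auto
  then have "(opn (adj F ** spow c F m))\<^sup>2 \<le> 1 / (real m * c)" if "m > 0"
    using that c power_mono[of "opn (adj F ** spow c F m)" "sqrt (1 / (real m * c))" 2] by simp
  then show ?thesis using c by (cases "m = 0") (auto simp: field_simps)
qed

lemma finsum_transport:
  assumes G: "abelian_monoid G" and H: "abelian_monoid H"
    and add: "\<And>x y. x \<in> carrier G \<Longrightarrow> y \<in> carrier G \<Longrightarrow> q (x \<oplus>\<^bsub>G\<^esub> y) = q x \<oplus>\<^bsub>H\<^esub> q y"
    and zero: "q \<zero>\<^bsub>G\<^esub> = \<zero>\<^bsub>H\<^esub>" and q: "q ` carrier G \<subseteq> carrier H"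
    and f: "f ` I \<subseteq> carrier G" and I: "finite I"
  shows "q (finsum G f I) = finsum H (\<lambda>i. q (f i)) I"
  using I f
proof (induction I rule: finite_induct)
  case empty
  then show ?case by (simp add: zero abelian_monoid.finsum_empty G H)
next
  case (insert i I)
  have "finsum G f I \<in> carrier G"
    using insert by (intro abelian_monoid.finsum_closed[OF G]) auto
  then show ?case using insert q
    by (subst abelian_monoid.finsum_insert[OF G], simp, simp, blast, blast)
      (subst abelian_monoid.finsum_insert[OF H], auto simp: add)
qed

lemma isometric_isomorphism_completely_isometric:
  assumes B: "abelian_monoid B" and C: "abelian_monoid C"
    and bij: "bij_betw q (carrier B) (carrier C)"
    and add: "\<And>x y. x \<in> carrier B \<Longrightarrow> y \<in> carrier B \<Longrightarrow> q (x \<oplus>\<^bsub>B\<^esub> y) = q x \<oplus>\<^bsub>C\<^esub> q y"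
    and mult: "\<And>x y. x \<in> carrier B \<Longrightarrow> y \<in> carrier B \<Longrightarrow> q (x \<otimes>\<^bsub>B\<^esub> y) = q x \<otimes>\<^bsub>C\<^esub> q y"
    and star: "\<And>x. x \<in> carrier B \<Longrightarrow> q (star B x) = star C (q x)"
    and zero: "q \<zero>\<^bsub>B\<^esub> = \<zero>\<^bsub>C\<^esub>"
    and norm: "\<And>x. x \<in> carrier B \<Longrightarrow> cnorm C (q x) = cnorm B x"
    and mult_closed: "\<And>x y. x \<in> carrier B \<Longrightarrow> y \<in> carrier B \<Longrightarrow> x \<otimes>\<^bsub>B\<^esub> y \<in> carrier B"
    and star_closed: "\<And>x. x \<in> carrier B \<Longrightarrow> star B x \<in> carrier B"
    and A: "A \<subseteq> carrier B"
  shows "completely_isometric_on B C A q"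
  unfolding completely_isometric_on_def
proof (intro allI ballI)
  fix m :: nat and a assume a: "a \<in> {..<m} \<times> {..<m} \<rightarrow>\<^sub>E A"
  have qC: "q ` carrier B \<subseteq> carrier C" using bij by (simp add: bij_betw_def)
  note fs = finsum_transport[OF B C add zero qC]
  have col: "column_norm m C y = column_norm m B x"
    if x: "\<And>i. i < m \<Longrightarrow> x i \<in> carrier B" and y: "\<And>i. i < m \<Longrightarrow> y i = q (x i)"
    for x y and m :: nat
  proof -
    have "(\<Oplus>\<^bsub>C\<^esub>i\<in>{..<m}. star C (y i) \<otimes>\<^bsub>C\<^esub> y i) = (\<Oplus>\<^bsub>C\<^esub>i\<in>{..<m}. q (star B (x i) \<otimes>\<^bsub>B\<^esub> x i))"
      by (rule abelian_monoid.finsum_cong'[OF C]) (use x y qC in \<open>auto simp: mult_closed star_closed image_subset_iff simp flip: star mult\<close>)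
    also have "\<dots> = q (\<Oplus>\<^bsub>B\<^esub>i\<in>{..<m}. star B (x i) \<otimes>\<^bsub>B\<^esub> x i)"
      by (rule fs[symmetric]) (use x in \<open>auto simp: mult_closed star_closed\<close>)
    finally have "(\<Oplus>\<^bsub>C\<^esub>i\<in>{..<m}. star C (y i) \<otimes>\<^bsub>C\<^esub> y i) = q (\<Oplus>\<^bsub>B\<^esub>i\<in>{..<m}. star B (x i) \<otimes>\<^bsub>B\<^esub> x i)" .
    moreover have "(\<Oplus>\<^bsub>B\<^esub>i\<in>{..<m}. star B (x i) \<otimes>\<^bsub>B\<^esub> x i) \<in> carrier B"
      using x by (intro abelian_monoid.finsum_closed[OF B]) (auto simp: mult_closed star_closed)
    ultimately show ?thesis by (simp add: column_norm_def norm)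
  qed
  have aB: "a (i, j) \<in> carrier B" if "i < m" "j < m" for i j using a A that by (auto simp: PiE_def Pi_def)
  have row: "(\<Oplus>\<^bsub>C\<^esub>j\<in>{..<m}. entrywise m q a (i, j) \<otimes>\<^bsub>C\<^esub> q (x j)) = q (\<Oplus>\<^bsub>B\<^esub>j\<in>{..<m}. a (i, j) \<otimes>\<^bsub>B\<^esub> x j)"
    if "i < m" "\<And>j. j < m \<Longrightarrow> x j \<in> carrier B" for i x
  proof -
    have "(\<Oplus>\<^bsub>C\<^esub>j\<in>{..<m}. entrywise m q a (i, j) \<otimes>\<^bsub>C\<^esub> q (x j)) = (\<Oplus>\<^bsub>C\<^esub>j\<in>{..<m}. q (a (i, j) \<otimes>\<^bsub>B\<^esub> x j))"
      by (rule abelian_monoid.finsum_cong'[OF C]) (use that aB qC in \<open>auto simp: mult_closed entrywise_def image_subset_iff simp flip: mult\<close>)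
    also have "\<dots> = q (\<Oplus>\<^bsub>B\<^esub>j\<in>{..<m}. a (i, j) \<otimes>\<^bsub>B\<^esub> x j)"
      by (rule fs[symmetric]) (use that aB in \<open>auto simp: mult_closed\<close>)
    finally show ?thesis .
  qed
  define D where "D = {x \<in> {..<m} \<rightarrow>\<^sub>E carrier B. column_norm m B x \<le> 1}"
  define Q where "Q x = (\<lambda>i\<in>{..<m}. q (x i))" for x
  have D: "x \<in> D \<Longrightarrow> i < m \<Longrightarrow> x i \<in> carrier B" for x i by (auto simp: D_def PiE_def Pi_def)
  have "{y \<in> {..<m} \<rightarrow>\<^sub>E carrier C. column_norm m C y \<le> 1} = Q ` D"
  proof (intro equalityI subsetI)
    fix y assume y: "y \<in> {y \<in> {..<m} \<rightarrow>\<^sub>E carrier C. column_norm m C y \<le> 1}"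
    define x where "x = (\<lambda>i\<in>{..<m}. inv_into (carrier B) q (y i))"
    have yi: "y i \<in> q ` carrier B" if "i < m" for i using y that bij by (auto simp: bij_betw_def PiE_def Pi_def)
    have xi: "x i \<in> carrier B" "q (x i) = y i" if "i < m" for i
      using inv_into_into[OF yi[OF that]] f_inv_into_f[OF yi[OF that]] that by (simp_all add: x_def)
    have "column_norm m C y = column_norm m B x" by (rule col) (simp_all add: xi)
    then have "x \<in> D" using y xi by (auto simp: D_def x_def)
    moreover have "y = Q x"
      by (rule extensionalityI[of _ "{..<m}"]) (use y xi in \<open>auto simp: Q_def PiE_def\<close>)
    ultimately show "y \<in> Q ` D" by blast
  next
    fix y assume "y \<in> Q ` D"
    then obtain x where x: "x \<in> D" "y = Q x" by blast
    have "column_norm m C y = column_norm m B x" by (rule col) (simp_all add: x Q_def D[OF x(1)])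
    then show "y \<in> {y \<in> {..<m} \<rightarrow>\<^sub>E carrier C. column_norm m C y \<le> 1}"
      using x D[OF x(1)] qC by (auto simp: Q_def D_def)
  qed
  then have "cnorm (mat_over m C) (entrywise m q a) =
      (SUP x\<in>D. column_norm m C (\<lambda>i. \<Oplus>\<^bsub>C\<^esub>j\<in>{..<m}. entrywise m q a (i, j) \<otimes>\<^bsub>C\<^esub> Q x j))"
    by (simp add: mat_over_def image_image)
  also have "\<dots> = (SUP x\<in>D. column_norm m B (\<lambda>i. \<Oplus>\<^bsub>B\<^esub>j\<in>{..<m}. a (i, j) \<otimes>\<^bsub>B\<^esub> x j))"
  proof (intro SUP_cong refl col)
    fix x i assume x: "x \<in> D" and i: "i < m"
    show "(\<Oplus>\<^bsub>B\<^esub>j\<in>{..<m}. a (i, j) \<otimes>\<^bsub>B\<^esub> x j) \<in> carrier B"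
      using aB[OF i] D[OF x] by (intro abelian_monoid.finsum_closed[OF B]) (auto simp: mult_closed)
    have "(\<Oplus>\<^bsub>C\<^esub>j\<in>{..<m}. entrywise m q a (i, j) \<otimes>\<^bsub>C\<^esub> Q x j) = (\<Oplus>\<^bsub>C\<^esub>j\<in>{..<m}. entrywise m q a (i, j) \<otimes>\<^bsub>C\<^esub> q (x j))"
      by (rule abelian_monoid.finsum_cong'[OF C])
        (use aB[OF i] D[OF x] qC i in \<open>auto simp: Q_def entrywise_def image_subset_iff mult_closed simp flip: mult\<close>)
    then show "(\<Oplus>\<^bsub>C\<^esub>j\<in>{..<m}. entrywise m q a (i, j) \<otimes>\<^bsub>C\<^esub> Q x j) = q (\<Oplus>\<^bsub>B\<^esub>j\<in>{..<m}. a (i, j) \<otimes>\<^bsub>B\<^esub> x j)"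
      using row[OF i D[OF x]] by simp
  qed
  also have "\<dots> = cnorm (mat_over m B) a" by (simp add: mat_over_def D_def)
  finally show "cnorm (mat_over m C) (entrywise m q a) = cnorm (mat_over m B) a" .
qed

lemma cstar_quot_simps:
  "carrier (cstar_quot B J) = carrier (B Quot J)" "mult (cstar_quot B J) = mult (B Quot J)"
  "one (cstar_quot B J) = one (B Quot J)" "zero (cstar_quot B J) = zero (B Quot J)"
  "add (cstar_quot B J) = add (B Quot J)"
  by (simp_all add: cstar_quot_def)

lemma cstar_quot_abelian_monoid:
  assumes "ideal J B" shows "abelian_monoid (cstar_quot B J)"
proof -
  interpret Q: Ring.ring "B Quot J" by (rule ideal.quotient_is_ring[OF assms])
  show ?thesis
    by (rule abelian_monoidI; unfold cstar_quot_simps)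
      (rule Q.a_closed Q.zero_closed Q.a_assoc Q.l_zero Q.a_comm; assumption?)+
qed

context reduced_bundle begin

lemma zero_ideal: "ideal {\<zero>\<^bsub>B\<^esub>} B"
proof -
  interpret Ring.ring B by (rule B_ring)
  show ?thesis by (rule zeroideal)
qed

text \<open>The quotient by the zero ideal consists of the singletons.\<close>

lemma zero_coset: "b \<in> carrier B \<Longrightarrow> {\<zero>\<^bsub>B\<^esub>} +>\<^bsub>B\<^esub> b = {b}"
proof -
  interpret Ring.ring B by (rule B_ring)
  show "b \<in> carrier B \<Longrightarrow> {\<zero>\<^bsub>B\<^esub>} +>\<^bsub>B\<^esub> b = {b}" by (simp add: a_r_coset_def')
qed

text \<open>The quotient of the section algebra by the zero ideal.\<close>

abbreviation B0 where "B0 \<equiv> cstar_quot B {\<zero>\<^bsub>B\<^esub>}"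

lemma star_closed: "b \<in> carrier B \<Longrightarrow> star B b \<in> carrier B"
  by (elim carrierE) (auto simp: sec_star intro!: sec_carrier EF_intros)

lemma B0_simps:
  "carrier B0 = (\<lambda>b. {b}) ` carrier B"
  "x \<in> carrier B \<Longrightarrow> y \<in> carrier B \<Longrightarrow> {x} \<oplus>\<^bsub>B0\<^esub> {y} = {x \<oplus>\<^bsub>B\<^esub> y}"
  "x \<in> carrier B \<Longrightarrow> y \<in> carrier B \<Longrightarrow> {x} \<otimes>\<^bsub>B0\<^esub> {y} = {x \<otimes>\<^bsub>B\<^esub> y}"
  "x \<in> carrier B \<Longrightarrow> star B0 {x} = {star B x}" "x \<in> carrier B \<Longrightarrow> c \<odot>\<^bsub>B0\<^esub> {x} = {c \<odot>\<^bsub>B\<^esub> x}"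
  "\<zero>\<^bsub>B0\<^esub> = {\<zero>\<^bsub>B\<^esub>}" "\<one>\<^bsub>B0\<^esub> = {\<one>\<^bsub>B\<^esub>}" "cnorm B0 {x} = cnorm B x"
proof -
  interpret Ring.ring B by (rule B_ring)
  have sc: "c \<odot>\<^bsub>B\<^esub> x \<in> carrier B" if "x \<in> carrier B" for c x
    using that by (elim carrierE) (auto simp: sec_smult intro!: sec_carrier EF_intros)
  show "carrier B0 = (\<lambda>b. {b}) ` carrier B"
    by (auto simp: cstar_quot_simps FactRing_def A_RCOSETS_def' zero_coset)
  show "x \<in> carrier B \<Longrightarrow> y \<in> carrier B \<Longrightarrow> {x} \<oplus>\<^bsub>B0\<^esub> {y} = {x \<oplus>\<^bsub>B\<^esub> y}"
    by (simp add: cstar_quot_simps FactRing_def set_add_def')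
  show "x \<in> carrier B \<Longrightarrow> y \<in> carrier B \<Longrightarrow> {x} \<otimes>\<^bsub>B0\<^esub> {y} = {x \<otimes>\<^bsub>B\<^esub> y}"
    by (simp add: cstar_quot_simps FactRing_def rcoset_mult_def zero_coset)
  show "x \<in> carrier B \<Longrightarrow> star B0 {x} = {star B x}"
    by (simp add: cstar_quot_def set_add_def' star_closed)
  show "x \<in> carrier B \<Longrightarrow> c \<odot>\<^bsub>B0\<^esub> {x} = {c \<odot>\<^bsub>B\<^esub> x}"
    by (simp add: cstar_quot_def set_add_def' sc)
  show "\<zero>\<^bsub>B0\<^esub> = {\<zero>\<^bsub>B\<^esub>}" "\<one>\<^bsub>B0\<^esub> = {\<one>\<^bsub>B\<^esub>}"
    by (simp_all add: cstar_quot_simps FactRing_def zero_coset)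
  show "cnorm B0 {x} = cnorm B x" by (simp add: cstar_quot_def)
qed

lemma zero_closed: "closedin (norm_topology B) {\<zero>\<^bsub>B\<^esub>}"
proof -
  interpret M: Metric_space "carrier B" "cdist B" by (rule Metric_B)
  have "\<zero>\<^bsub>B\<^esub> \<in> carrier B" by (simp add: sec_zero EF_intros)
  then show ?thesis unfolding norm_topology_def
    by (intro closedin_Hausdorff_singleton M.Hausdorff_space_mtopology) simp
qed

lemma zero_boundary_ideal: "boundary_ideal B TA {\<zero>\<^bsub>B\<^esub>}"
  unfolding boundary_ideal_def
proof (intro conjI zero_ideal zero_closed)
  interpret Ring.ring B by (rule B_ring)
  have TA: "TA \<subseteq> carrier B" using generating by (simp add: generating_subalgebra_def)
  have "completely_isometric_on B B0 TA (\<lambda>b. {b})"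
    by (rule isometric_isomorphism_completely_isometric[OF B_abelian_monoid cstar_quot_abelian_monoid[OF zero_ideal]])
      (use TA in \<open>auto simp: B0_simps bij_betw_def star_closed\<close>)
  moreover have "entrywise m (\<lambda>b. {\<zero>\<^bsub>B\<^esub>} +>\<^bsub>B\<^esub> b) a = entrywise m (\<lambda>b. {b}) a"
    if "a \<in> {..<m} \<times> {..<m} \<rightarrow>\<^sub>E TA" for m and a :: "nat \<times> nat \<Rightarrow> ('n, 'd) bundle_section"
    unfolding entrywise_def using that TA
    by (intro restrict_ext zero_coset) (auto simp: PiE_def Pi_def)
  ultimately show "completely_isometric_on B B0 TA (\<lambda>b. {\<zero>\<^bsub>B\<^esub>} +>\<^bsub>B\<^esub> b)"
    by (simp add: completely_isometric_on_def)
qed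

lemma quotient_by_zero_iso: "star_iso B0 B the_elem"
  unfolding star_iso_def star_hom_def
proof (intro conjI allI ballI)
  show "the_elem \<in> ring_hom B0 B"
    by (rule ring_hom_memI) (auto simp: B0_simps)
  show "bij_betw the_elem (carrier B0) (carrier B)"
    by (auto simp: bij_betw_def inj_on_def B0_simps image_image)
qed (auto simp: B0_simps)

text \<open>Closed ideals are self-adjoint: with \<open>S = 1 - c F F\<^sup>*\<close> the element \<open>F\<^sup>* (1 - S\<^sup>m)\<close> lies in the
  ideal, and it converges to \<open>F\<^sup>*\<close>. This makes the adjoint of a coset a coset.\<close>

lemma closed_ideal_star:
  assumes J: "ideal J B" "closedin (norm_topology B) J" and F: "F \<in> EF" "sec F \<in> J"
  shows "sec (\<lambda>z. adj (F z)) \<in> J"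
proof -
  interpret ideal J B by (rule J(1))
  \<comment> \<open>This choice ensures that \<open>c > 0\<close> and \<open>c \<parallel>F\<parallel>\<^sup>2 \<le> 1\<close>.\<close>
  define c where "c = 1 / ((cnorm B (sec F))\<^sup>2 + 1)"
  have pos: "(cnorm B (sec F))\<^sup>2 + 1 > 0" by (simp add: add_nonneg_pos)
  have c: "c > 0" using pos by (simp add: c_def)
  have cF: "c * (opn (F z))\<^sup>2 \<le> 1" if "z \<in> PY" for z
  proof -
    have "(opn (F z))\<^sup>2 \<le> (cnorm B (sec F))\<^sup>2" by (intro power_mono opn_le_cnorm F that) simp
    then show ?thesis using pos by (simp add: c_def)
  qed
  define S where "S m z = spow c (F z) m" for m z
  have cE: "(\<lambda>z. c *\<^sub>R G z) \<in> EF" if "G \<in> EF" for G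
    using EF_intros(8)[OF that, of "of_real c"] by (simp add: cscale_of_real)
  have SE: "S m \<in> EF" for m
  proof (induction m)
    case 0
    then show ?case using EF_const[of 1] by (simp add: S_def[abs_def] spow_simps)
  next
    case (Suc m)
    have "(\<lambda>z. (mat 1 - c *\<^sub>R (F z ** adj (F z))) ** S m z) \<in> EF"
      by (intro EF_intros cE F EF_const Suc)
    then show ?case by (simp add: S_def[abs_def] spow_simps)
  qed
  have SJ: "sec (\<lambda>z. mat 1 - S m z) \<in> J" for m
  proof (induction m)
    case 0
    have "sec (\<lambda>z. mat 1 - S 0 z) = \<zero>\<^bsub>B\<^esub>" by (simp add: S_def spow_simps sec_zero)
    then show ?case using additive_subgroup.zero_closed[OF ideal.axioms(1)[OF J(1)]] by simp
  next
    case (Suc m)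
    have 1: "sec F \<otimes>\<^bsub>B\<^esub> sec (\<lambda>z. c *\<^sub>R (adj (F z) ** S m z)) \<in> J"
      by (intro I_r_closed F sec_carrier cE EF_intros SE)
    have "sec (\<lambda>z. (mat 1 - S m z) + F z ** (c *\<^sub>R (adj (F z) ** S m z))) \<in> J"
      using additive_subgroup.a_closed[OF ideal.axioms(1)[OF J(1)] Suc 1] by (simp add: sec_add sec_mult)
    moreover have "(mat 1 - S m z) + F z ** (c *\<^sub>R (adj (F z) ** S m z)) = mat 1 - S (Suc m) z" for z
      using cscale_mult_right[of "F z" "of_real c"] cscale_mult_left[of "of_real c" "F z ** adj (F z)" "S m z"]
      unfolding cscale_of_real
      by (simp add: S_def spow_simps matrix_mult_diff matrix_mul_assoc)
    ultimately show ?case by simp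
  qed
  have "sec (\<lambda>z. adj (F z)) \<in> norm_topology B closure_of J"
    unfolding norm_closure
  proof (intro CollectI conjI allI impI sec_carrier EF_intros F)
    fix e :: real assume e: "e > 0"
    obtain m :: nat where m: "real m > 1 / (c * (e/2)\<^sup>2)" using reals_Archimedean2 by blast
    have e2: "c * (e/2)\<^sup>2 > 0" using c e by simp
    then have m0: "real m > 0" using m by (meson divide_pos_pos less_trans zero_less_one)
    define G where "G z = adj (F z) ** (mat 1 - S m z)" for z
    have GE: "G \<in> EF" unfolding G_def by (intro EF_intros EF_const F SE)
    have "sec G \<in> J"
      using I_l_closed[OF SJ[of m], of "sec (\<lambda>z. adj (F z))"]
      by (simp add: G_def[abs_def] sec_mult sec_carrier EF_intros F)
    moreover have "cdist B (sec (\<lambda>z. adj (F z))) (sec G) \<le> e / 2"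
      unfolding cdist_sec[OF EF_intros(5)[OF F(1)] GE]
    proof (intro cnorm_le EF_intros F GE)
      fix z assume z: "z \<in> PY"
      have "1 < real m * (c * (e/2)\<^sup>2)" using m e2 by (simp add: field_simps)
      then have "real m * c * (opn (adj (F z) ** S m z))\<^sup>2 \<le> real m * c * (e/2)\<^sup>2"
        using spow_bound[OF c cF[OF z], of m] by (simp add: S_def mult.assoc)
      then have "(opn (adj (F z) ** S m z))\<^sup>2 \<le> (e/2)\<^sup>2" using m0 c by simp
      then have "opn (adj (F z) ** S m z) \<le> e / 2" using e by (auto intro: power2_le_imp_le[of _ "e/2"])
      then show "opn (adj (F z) - G z) \<le> e / 2" by (simp add: G_def matrix_mult_diff)
    qed
    ultimately show "\<exists>y\<in>J. y \<in> carrier B \<and> cdist B (sec (\<lambda>z. adj (F z))) y < e"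
      using e sec_carrier[OF GE] by (intro bexI[of _ "sec G"]) auto
  qed
  then show ?thesis using J(2) by (simp add: closure_of_closedin)
qed

end

section \<open>The Shilov boundary ideal\<close>

lemma column_norm_one:
  assumes "abelian_monoid C" "star C (x 0) \<otimes>\<^bsub>C\<^esub> x 0 \<in> carrier C"
  shows "column_norm 1 C x = sqrt (cnorm C (star C (x 0) \<otimes>\<^bsub>C\<^esub> x 0))"
  unfolding column_norm_def using abelian_monoid.finsum_two(2)[OF assms(1), of "\<lambda>i. star C (x i) \<otimes>\<^bsub>C\<^esub> x i"] assms(2)
  by simp

text \<open>The situation of the theorem: the base is the closure of \<open>D\<close>, and sections are taken over the Shilov
  boundary.\<close>

locale shilov_bundle = reduced_bundle P "Q_space closure_of D" "boundary D"
  for P :: "(complex^'n::finite^'n^'d::finite) set" and D :: "('n, 'd) mpoint set"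
begin

lemma peak_point_PY: assumes "peak_point P z" shows "z \<in> PY"
  using peak_point_in_boundary[OF reduction assms] assms by (simp add: PY_def peak_point_def)

text \<open>Peak points are dense over the Shilov boundary.\<close>

lemma peak_point_avoiding:
  assumes S: "closed S" "S \<subseteq> PY" "\<And>k z. k \<in> unitary_group \<Longrightarrow> z \<in> S \<Longrightarrow> conj_tuple k z \<in> S"
    and z1: "z1 \<in> PY" "z1 \<notin> S"
  obtains z where "peak_point P z" "z \<notin> S" "pi0 z \<notin> pi0 ` S"
proof -
  have sat: "z \<in> S" if zP: "z \<in> P" and zS: "pi0 z \<in> pi0 ` S" for z
  proof -
    obtain s where s: "s \<in> S" "pi0 s = pi0 z" using zS by auto
    then obtain k where "k \<in> unitary_group" "z = conj_tuple k s"
      using P_orbit[of s z] S(2) zP by (auto simp: PY_def)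
    then show ?thesis using S(3) s(1) by simp
  qed
  have SP: "S \<subseteq> P" using S(2) by (auto simp: PY_def)
  have "{z \<in> P. pi0 z \<in> pi0 ` S} = S" using sat SP by auto
  then have "closedin (top_of_set P) {z \<in> topspace (top_of_set P). pi0 z \<in> pi0 ` S}"
    using closed_subset[OF SP S(1)] by simp
  moreover have "pi0 ` S \<subseteq> topspace (subtopology Q_space (Q_space closure_of D))"
    using SP pi0_P by blast
  ultimately have cl: "closedin (subtopology Q_space (Q_space closure_of D)) (pi0 ` S)"
    using P_quotient unfolding quotient_map_closedin by blast
  have "pi0 z1 \<in> boundary D" "pi0 z1 \<notin> pi0 ` S" using z1 sat by (auto simp: PY_def)
  then obtain z where z: "peak_point P z" "pi0 z \<notin> pi0 ` S"
    using boundary_subset_closure[OF reduction cl] by blast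
  then show ?thesis using that[of z] by blast
qed

lemma copy_exists: "\<exists>e :: complex^'n \<Rightarrow> ('n, 'd) bundle_section. hilbert_copy e"
proof -
  \<comment> \<open>Any injection serves; this one stores \<open>v\<close> in the columns of a matrix.\<close>
  define e :: "complex^'n \<Rightarrow> ('n, 'd) bundle_section" where "e v = (\<lambda>u. {(0, \<chi> i j. v $ i)})" for v
  have "inj e" by (rule injI) (auto simp: e_def fun_eq_iff vec_eq_iff)
  then show ?thesis using hilbert_copy.intro by blast
qed

text \<open>A nonzero section is nonzero at some peak point, and evaluation there is a
  boundary representation.\<close>

lemma kernel_intersection: "boundary_kernel_intersection B TA = {\<zero>\<^bsub>B\<^esub>}"
proof (intro equalityI subsetI)
  fix b assume "b \<in> boundary_kernel_intersection B TA"
  then have b: "b \<in> carrier B"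
    and ker: "\<And>(H :: ('n, 'd) bundle_section hilbert_struct) \<rho>. boundary_representation B TA H \<rho> \<Longrightarrow> \<rho> b = \<zero>\<^bsub>op_alg H\<^esub>"
    by (auto simp: boundary_kernel_intersection_def)
  obtain F where F: "F \<in> EF" "b = sec F" using b by (rule carrierE)
  obtain e :: "complex^'n \<Rightarrow> ('n, 'd) bundle_section" where e: "hilbert_copy e" using copy_exists by blast
  interpret hilbert_copy e by (rule e)
  have "F z1 = 0" if z1: "z1 \<in> PY" for z1
  proof (rule ccontr)
    assume ne: "F z1 \<noteq> 0"
    define S where "S = {z \<in> PY. F z = 0}"
    have "closed (PY \<inter> F -` {0})"
      by (rule continuous_closed_preimage[OF EF_cont[OF F(1)] compact_imp_closed[OF compact_PY] closed_singleton])
    then have "closed S" by (simp add: S_def vimage_def Int_def)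
    moreover have "conj_tuple k z \<in> S" if "k \<in> unitary_group" "z \<in> S" for k z
      using that PY_conj EF_conj[OF F(1)] by (auto simp: S_def conj_unitary)
    moreover have "S \<subseteq> PY" "z1 \<notin> S" using ne by (auto simp: S_def)
    ultimately obtain z where z: "peak_point P z" "z \<notin> S"
      using peak_point_avoiding[of S z1] z1 by blast
    have zPY: "z \<in> PY" by (rule peak_point_PY[OF z(1)])
    have "eval_rep e z b = \<zero>\<^bsub>OA\<^esub>" by (rule ker[OF eval_rep_boundary[OF e zPY z(1)]])
    then have "F z = 0" by (simp add: F eval_rep_sec[OF zPY])
    then show False using z(2) zPY by (simp add: S_def)
  qed
  then show "b \<in> {\<zero>\<^bsub>B\<^esub>}" by (simp add: F sec_zero sec_eq_iff)
next
  fix b assume b: "b \<in> {\<zero>\<^bsub>B\<^esub>}"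
  have zc: "\<zero>\<^bsub>B\<^esub> \<in> carrier B" by (simp add: sec_zero EF_intros)
  have "\<rho> \<zero>\<^bsub>B\<^esub> = \<zero>\<^bsub>op_alg H\<^esub>" if "boundary_representation B TA H \<rho>" for H :: "('n, 'd) bundle_section hilbert_struct" and \<rho>
  proof -
    have hom: "star_hom B (op_alg H) \<rho>" and H: "hilbert_space H"
      using that by (auto simp: boundary_representation_def irreducible_representation_def)
    interpret H: Module.module complex_alg H using H by (simp add: hilbert_space_def)
    have "\<rho> \<zero>\<^bsub>B\<^esub> \<in> carrier (op_alg H)" using hom zc by (auto simp: star_hom_def ring_hom_def)
    then have "\<rho> \<zero>\<^bsub>B\<^esub> \<in> carrier H \<rightarrow> carrier H" by (auto simp: op_alg_def bounded_ops_def)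
    then have z: "0 \<odot>\<^bsub>op_alg H\<^esub> \<rho> \<zero>\<^bsub>B\<^esub> = \<zero>\<^bsub>op_alg H\<^esub>"
      using H.smult_l_null by (auto simp: op_alg_def fun_eq_iff Pi_def)
    have "0 \<odot>\<^bsub>B\<^esub> \<zero>\<^bsub>B\<^esub> = \<zero>\<^bsub>B\<^esub>" by (simp add: sec_zero sec_smult)
    then have "\<rho> \<zero>\<^bsub>B\<^esub> = 0 \<odot>\<^bsub>op_alg H\<^esub> \<rho> \<zero>\<^bsub>B\<^esub>"
      using hom zc unfolding star_hom_def by metis
    then show ?thesis using z by simp
  qed
  then show "b \<in> boundary_kernel_intersection B TA"
    using b zc by (auto simp: boundary_kernel_intersection_def)
qed

text \<open>A nonzero closed ideal contains a section \<open>E\<close> that is close to the unit over some open set. A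
  peak invariant \<open>g\<close> concentrated there loses norm modulo the ideal, since \<open>\<bar>g\<bar>\<^sup>2 b\<close> may be replaced
  by \<open>\<bar>g\<bar>\<^sup>2 b (1 - \<theta> E)\<close> for a cutoff function \<open>\<theta>\<close>. Hence the quotient map is not even isometric on the
  invariants.\<close>

lemma boundary_ideal_trivial:
  assumes bi: "boundary_ideal B TA J" shows "J \<subseteq> {\<zero>\<^bsub>B\<^esub>}"
proof (rule ccontr)
  assume nt: "\<not> J \<subseteq> {\<zero>\<^bsub>B\<^esub>}"
  have J: "ideal J B" "closedin (norm_topology B) J" and ci: "completely_isometric_on B (cstar_quot B J) TA (\<lambda>b. J +>\<^bsub>B\<^esub> b)"
    using bi by (auto simp: boundary_ideal_def)
  interpret ideal J B by (rule J(1))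
  note J_add = additive_subgroup.a_closed[OF ideal.axioms(1)[OF J(1)]]
  note J_zero = additive_subgroup.zero_closed[OF ideal.axioms(1)[OF J(1)]]
  obtain s where s: "s \<in> J" "s \<noteq> \<zero>\<^bsub>B\<^esub>" using nt by blast
  then have "s \<in> carrier B" using a_subset by blast
  then obtain F where F: "F \<in> EF" "s = sec F" by (rule carrierE)
  then obtain z1 where z1: "z1 \<in> PY" "F z1 \<noteq> 0" using s(2) by (auto simp: sec_zero sec_eq_iff)
  then obtain a0 b0 where ab: "F z1 $ a0 $ b0 \<noteq> 0" by (auto simp: vec_eq_iff)
  \<comment> \<open>As \<open>M\<^sub>n\<close> is simple, the two-sided ideal generated by \<open>F(z1)\<close> contains the unit; the coefficients
    lift to the trace algebra.\<close>
  define t where "t = F z1 $ a0 $ b0"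
  have "\<exists>G\<in>trace_algebra. G z1 = M" for M :: "complex^'n^'n"
    using generic_matrix_surj[OF PY_gen[OF z1(1)]] generic_subset_trace by (metis subsetD)
  then have "\<exists>G\<in>trace_algebra. G z1 = (\<chi> k l. if k = i then if l = a0 then 1 / t else 0 else 0)"
    "\<exists>H\<in>trace_algebra. H z1 = (\<chi> k l. if k = b0 then if l = i then 1 else 0 else 0)" for i
    by blast+
  then obtain G H where
    G: "\<And>i. G i \<in> trace_algebra" "\<And>i. G i z1 = (\<chi> k l. if k = i then if l = a0 then 1 / t else 0 else 0)"
    and H: "\<And>i. H i \<in> trace_algebra" "\<And>i. H i z1 = (\<chi> k l. if k = b0 then if l = i then 1 else 0 else 0)"
    by metis
  define E where "E z = (\<Sum>i\<in>UNIV. G i z ** F z ** H i z)" for z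
  have EE: "E \<in> EF" unfolding E_def by (intro EF_sum EF_intros trace_algebra_EF G H F)
  have "E z1 = mat 1"
  proof -
    have "(G i z1 ** F z1 ** H i z1) $ k $ l = (if k = i then if l = i then 1 else 0 else 0)" for i k l
    proof -
      have GF: "(G i z1 ** F z1) $ k $ m = (if k = i then F z1 $ a0 $ m / t else 0)" for m
      proof -
        have "(G i z1 ** F z1) $ k $ m = (\<Sum>l\<in>UNIV. (if k = i then if l = a0 then 1 / t else 0 else 0) * F z1 $ l $ m)"
          by (simp add: matrix_matrix_mult_def G(2))
        also have "\<dots> = (\<Sum>l\<in>UNIV. if l = a0 then (if k = i then F z1 $ a0 $ m / t else 0) else 0)"
          by (rule sum.cong) auto
        finally show ?thesis by (simp only: sum.delta finite_class.finite_UNIV UNIV_I if_True)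
      qed
      have "(G i z1 ** F z1 ** H i z1) $ k $ l = (\<Sum>m\<in>UNIV. (G i z1 ** F z1) $ k $ m * (if m = b0 then if l = i then 1 else 0 else 0))"
        by (simp add: matrix_matrix_mult_def[of "G i z1 ** F z1"] H(2))
      also have "\<dots> = (\<Sum>m\<in>UNIV. if m = b0 then (G i z1 ** F z1) $ k $ b0 * (if l = i then 1 else 0) else 0)"
        by (rule sum.cong) auto
      also have "\<dots> = (G i z1 ** F z1) $ k $ b0 * (if l = i then 1 else 0)"
        by (simp only: sum.delta finite_class.finite_UNIV UNIV_I if_True)
      finally show ?thesis using ab by (simp add: GF t_def)
    qed
    then show ?thesis by (simp add: E_def vec_eq_iff mat_def)
  qed
  have EJ: "sec E \<in> J"
  proof -
    have "sec (\<lambda>z. \<Sum>i\<in>I. G i z ** F z ** H i z) \<in> J" if "finite I" for I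
      using that
    proof (induction I rule: finite_induct)
      case empty
      then show ?case using J_zero by (simp add: sec_zero)
    next
      case (insert i I)
      have "sec (G i) \<otimes>\<^bsub>B\<^esub> sec F \<otimes>\<^bsub>B\<^esub> sec (H i) \<in> J"
        using s(1) unfolding F(2) by (intro I_r_closed I_l_closed sec_carrier trace_algebra_EF G H)
      then have "sec (\<lambda>z. G i z ** F z ** H i z) \<oplus>\<^bsub>B\<^esub> sec (\<lambda>z. \<Sum>i\<in>I. G i z ** F z ** H i z) \<in> J"
        using insert by (intro J_add) (simp_all add: sec_mult)
      then show ?case using insert by (simp add: sec_add)
    qed
    then show ?thesis by (simp add: E_def[abs_def])
  qed
  define d where "d z = opn (mat 1 - E z)" for z
  have d_cont: "continuous_on PY d" unfolding d_def by (intro continuous_intros EF_cont EE)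
  have d_conj: "d (conj_tuple k z) = d z" if "z \<in> PY" "k \<in> unitary_group" for z k
    using EF_conj[OF EF_intros(2)[OF EF_const[of 1] EE] that] that by (simp add: d_def opn_conj)
  define S where "S = {z \<in> PY. 1/4 \<le> d z}"
  have "closed (PY \<inter> d -` {1/4..})"
    by (rule continuous_closed_preimage[OF d_cont compact_imp_closed[OF compact_PY] closed_atLeast])
  then have "closed S" by (simp add: S_def vimage_def Int_def)
  moreover have "conj_tuple k z \<in> S" if "k \<in> unitary_group" "z \<in> S" for k z
    using that PY_conj d_conj by (auto simp: S_def)
  moreover have "S \<subseteq> PY" by (auto simp: S_def)
  moreover have "z1 \<notin> S" using \<open>E z1 = mat 1\<close> by (simp add: S_def d_def)
  ultimately obtain z0 where z0: "peak_point P z0" "pi0 z0 \<notin> pi0 ` S"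
    using peak_point_avoiding[of S z1] z1(1) by blast
  have "S \<subseteq> P" by (auto simp: S_def PY_def)
  obtain g r where g: "g \<in> invariants" and r: "r \<ge> 0" "\<And>w. w \<in> S \<Longrightarrow> cmod (g w) \<le> r" "r < cmod (g z0)"
    using peak_point_modulus[OF compact_P z0(1) \<open>closed S\<close> \<open>S \<subseteq> P\<close> z0(2)] by metis
  define gm where "gm z = (mat (g z) :: complex^'n^'n)" for z
  have gmT: "gm \<in> trace_algebra" unfolding gm_def by (rule trace_algebra_intros(1)[OF g])
  have gmE: "gm \<in> EF" by (rule trace_algebra_EF[OF gmT])
  define N where "N = cnorm B (sec gm)"
  have gN: "cmod (g z) \<le> N" if "z \<in> PY" for z
    using opn_le_cnorm[OF gmE that] by (simp add: gm_def N_def)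
  have rN: "r < N" using gN[OF peak_point_PY[OF z0(1)]] r(3) by simp
  \<comment> \<open>This will bound the norm of \<open>g\<close> modulo the ideal.\<close>
  define \<kappa> where "\<kappa> = max (N/2) r"
  have \<kappa>: "\<kappa> > 0" "\<kappa> < N" using rN r(1) by (auto simp: \<kappa>_def)
  \<comment> \<open>The cutoff is 1 where \<open>d \<le> 1/4\<close>, that is off \<open>S\<close>, and 0 where \<open>d \<ge> 1/2\<close>.\<close>
  define \<theta> where "\<theta> z = max 0 (min 1 (2 - 4 * d z))" for z
  have \<theta>IF: "(\<lambda>z. complex_of_real (\<theta> z)) \<in> IF"
    using d_conj unfolding IF_def \<theta>_def by (auto intro!: continuous_intros d_cont)
  have gIF: "(\<lambda>z. complex_of_real ((cmod (g z))\<^sup>2)) \<in> IF"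
    using invariants_IF[OF g] unfolding IF_def by (auto intro!: continuous_intros)
  \<comment> \<open>Multiplication by \<open>\<bar>g\<bar>\<^sup>2\<close>.\<close>
  define sq where "sq b z = cscale (of_real ((cmod (g z))\<^sup>2)) (b z)"
    for b :: "complex^'n^'n^'d \<Rightarrow> complex^'n^'n" and z
  have sqE: "sq b \<in> EF" if "b \<in> EF" for b unfolding sq_def by (intro EF_intros gIF that)
  define cE where "cE z = cscale (of_real (\<theta> z)) (E z)" for z
  have cEE: "cE \<in> EF" unfolding cE_def by (intro EF_intros \<theta>IF EE)
  have cEJ: "sec cE \<in> J"
  proof -
    have "sec (\<lambda>z. mat (of_real (\<theta> z))) \<otimes>\<^bsub>B\<^esub> sec E \<in> J"
      by (intro I_l_closed EJ sec_carrier EF_intros \<theta>IF)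
    then show ?thesis by (simp add: sec_mult cE_def[abs_def] cscale_eq_mult(1))
  qed
  have factor: "(cmod (g z))\<^sup>2 * opn (mat 1 - cE z) \<le> \<kappa>\<^sup>2" if z: "z \<in> PY" for z
  proof (cases "z \<in> S")
    case True
    have \<theta>01: "0 \<le> \<theta> z" "\<theta> z \<le> 1" by (auto simp: \<theta>_def)
    have "\<theta> z * d z \<le> \<theta> z"
    proof (cases "d z \<le> 1")
      case True
      then show ?thesis using mult_left_le[of "d z" "\<theta> z"] \<theta>01 by simp
    next
      case False
      then show ?thesis by (simp add: \<theta>_def)
    qed
    moreover have "mat 1 - cE z = cscale (of_real (1 - \<theta> z)) (mat 1) + cscale (of_real (\<theta> z)) (mat 1 - E z)"
      by (simp add: cE_def cscale_diff flip: mat_add del: of_real_diff) (simp flip: of_real_add)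
    then have "opn (mat 1 - cE z) \<le> opn (cscale (of_real (1 - \<theta> z)) (mat 1 :: complex^'n^'n)) + opn (cscale (of_real (\<theta> z)) (mat 1 - E z))"
      by (simp only: opn_triangle)
    then have "opn (mat 1 - cE z) \<le> (1 - \<theta> z) + \<theta> z * d z"
      unfolding opn_cscale norm_of_real using \<theta>01 by (simp add: d_def)
    ultimately have "opn (mat 1 - cE z) \<le> 1" by simp
    then have "(cmod (g z))\<^sup>2 * opn (mat 1 - cE z) \<le> \<kappa>\<^sup>2 * 1"
      using r(2)[OF True] by (intro mult_mono power_mono) (auto simp: \<kappa>_def)
    then show ?thesis by simp
  next
    case False
    then have dz: "d z < 1/4" using z by (simp add: S_def)
    then have "\<theta> z = 1" by (simp add: \<theta>_def)
    then have "opn (mat 1 - cE z) \<le> 1/4" using dz by (simp add: cE_def d_def)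
    then have "(cmod (g z))\<^sup>2 * opn (mat 1 - cE z) \<le> N\<^sup>2 * (1/4)"
      using gN[OF z] by (intro mult_mono power_mono) auto
    also have "\<dots> = (N/2)\<^sup>2" by (simp add: power2_eq_square)
    also have "\<dots> \<le> \<kappa>\<^sup>2" using rN r(1) by (intro power_mono) (auto simp: \<kappa>_def)
    finally show ?thesis .
  qed
  let ?C = "cstar_quot B J"
  have J_image: "J = sec ` {j \<in> EF. sec j \<in> J}"
  proof (intro equalityI subsetI)
    fix h assume h: "h \<in> J"
    then have "h \<in> carrier B" using a_subset by blast
    then obtain j where "j \<in> EF" "h = sec j" by (rule carrierE)
    then show "h \<in> sec ` {j \<in> EF. sec j \<in> J}" using h by blast
  qed blast
  let ?q = "\<lambda>F. J +>\<^bsub>B\<^esub> sec F"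
  have coset: "?q F = {sec (\<lambda>z. j z + F z) | j. j \<in> EF \<and> sec j \<in> J}" for F
  proof -
    have "?q F = (\<lambda>h. h \<oplus>\<^bsub>B\<^esub> sec F) ` J" by (auto simp: a_r_coset_def')
    also have "\<dots> = (\<lambda>j. sec j \<oplus>\<^bsub>B\<^esub> sec F) ` {j \<in> EF. sec j \<in> J}"
      by (subst (1) J_image) (simp only: image_image)
    finally show ?thesis by (simp only: sec_add image_def) blast
  qed
  have Cnorm_le: "cnorm ?C (?q F) \<le> cnorm B (sec (\<lambda>z. j z + F z))" if "F \<in> EF" "j \<in> EF" "sec j \<in> J" for F j
  proof -
    have "bdd_below (cnorm B ` ?q F)"
      unfolding coset using that(1) by (intro bdd_belowI[of _ 0]) (auto intro!: cnorm_nonneg EF_intros)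
    then show ?thesis unfolding cstar_quot_def using that
      by (auto simp: coset intro!: cInf_lower)
  qed
  have Cnorm_ge: "c \<le> cnorm ?C (?q F)" if "\<And>j. j \<in> EF \<Longrightarrow> sec j \<in> J \<Longrightarrow> c \<le> cnorm B (sec (\<lambda>z. j z + F z))" for F c
  proof -
    have "sec (\<lambda>z. 0) \<in> J" using J_zero by (simp add: sec_zero)
    then have "?q F \<noteq> {}" unfolding coset using EF_intros(7) by blast
    then show ?thesis unfolding cstar_quot_def using that by (auto simp: coset intro!: cInf_greatest)
  qed
  have shrink: "cnorm ?C (?q (sq b)) \<le> \<kappa>\<^sup>2 * cnorm ?C (?q b)" if b: "b \<in> EF" for b
  proof -
    have "cnorm ?C (?q (sq b)) / \<kappa>\<^sup>2 \<le> cnorm ?C (?q b)"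
    proof (rule Cnorm_ge)
      fix j assume j: "j \<in> EF" "sec j \<in> J"
      define b' where "b' z = j z + b z" for z
      have b'E: "b' \<in> EF" unfolding b'_def by (intro EF_intros j b)
      \<comment> \<open>The section \<open>i\<close> in the ideal is chosen so that \<open>i + \<bar>g\<bar>\<^sup>2 b = \<bar>g\<bar>\<^sup>2 b' (1 - \<theta> E)\<close>.\<close>
      define i where "i z = sq j z - sq b' z ** cE z" for z
      have iE: "i \<in> EF" unfolding i_def by (intro EF_intros sqE j b'E cEE)
      have "sec (\<lambda>z. mat (of_real ((cmod (g z))\<^sup>2))) \<otimes>\<^bsub>B\<^esub> sec j \<in> J"
        by (intro I_l_closed j sec_carrier EF_intros gIF)
      then have 1: "sec (sq j) \<in> J" by (simp add: sec_mult sq_def[abs_def] cscale_eq_mult(1))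
      have "sec (\<lambda>z. - sq b' z) \<otimes>\<^bsub>B\<^esub> sec cE \<in> J"
        by (intro I_l_closed cEJ sec_carrier EF_minus sqE b'E)
      then have "sec (sq j) \<oplus>\<^bsub>B\<^esub> sec (\<lambda>z. - sq b' z ** cE z) \<in> J"
        using J_add[OF 1] by (simp add: sec_mult)
      moreover have "- sq b' z ** cE z = - (sq b' z ** cE z)" for z
        using matrix_mult_diff(1)[of 0 "sq b' z" "cE z"] by (simp add: matrix_mult_diff(1)[of 0 0])
      ultimately have iJ: "sec i \<in> J" by (simp add: sec_add i_def[abs_def])
      have eq: "i z + sq b z = sq b' z ** (mat 1 - cE z)" for z
        by (simp add: i_def sq_def b'_def cscale_add matrix_mult_diff algebra_simps)
      have "cnorm ?C (?q (sq b)) \<le> cnorm B (sec (\<lambda>z. i z + sq b z))"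
        by (rule Cnorm_le[OF sqE[OF b] iE iJ])
      also have "\<dots> \<le> \<kappa>\<^sup>2 * cnorm B (sec b')"
      proof (rule cnorm_le)
        show "(\<lambda>z. i z + sq b z) \<in> EF" by (intro EF_intros iE sqE b)
        fix z assume z: "z \<in> PY"
        have "opn (i z + sq b z) \<le> opn (sq b' z) * opn (mat 1 - cE z)" unfolding eq by (rule opn_mult)
        also have "\<dots> = ((cmod (g z))\<^sup>2 * opn (mat 1 - cE z)) * opn (b' z)"
          unfolding sq_def opn_cscale norm_of_real by simp
        also have "\<dots> \<le> \<kappa>\<^sup>2 * cnorm B (sec b')"
          by (intro mult_mono factor z opn_le_cnorm b'E) auto
        finally show "opn (i z + sq b z) \<le> \<kappa>\<^sup>2 * cnorm B (sec b')" .
      qed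
      finally have "cnorm ?C (?q (sq b)) / \<kappa>\<^sup>2 \<le> cnorm B (sec b')"
        using \<kappa>(1) by (simp add: divide_le_eq mult.commute)
      then show "cnorm ?C (?q (sq b)) / \<kappa>\<^sup>2 \<le> cnorm B (sec (\<lambda>z. j z + b z))"
        unfolding b'_def[abs_def] .
    qed
    then show ?thesis using \<kappa>(1) by (simp add: field_simps)
  qed
  have C_mult: "?q F \<otimes>\<^bsub>?C\<^esub> ?q G = ?q (\<lambda>z. F z ** G z)" if "F \<in> EF" "G \<in> EF" for F G
    using rcoset_mult_add[OF sec_carrier[OF that(1)] sec_carrier[OF that(2)]]
    by (simp add: cstar_quot_simps FactRing_def sec_mult)
  have C_carrier: "carrier ?C = ?q ` EF"
    by (auto simp: cstar_quot_simps FactRing_def A_RCOSETS_def' carrier_sec)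
  have C_star: "star ?C (?q F) = ?q (\<lambda>z. adj (F z))" if F: "F \<in> EF" for F
  proof -
    have "star ?C (?q F) = {sec (\<lambda>z. i z + (adj (j z) + adj (F z))) | i j. i \<in> EF \<and> sec i \<in> J \<and> j \<in> EF \<and> sec j \<in> J}"
    proof -
      have "star ?C (?q F) = {h \<oplus>\<^bsub>B\<^esub> k | h k. h \<in> J \<and> k \<in> star B ` ?q F}"
        by (auto simp: cstar_quot_def set_add_def')
      also have "\<dots> = {h \<oplus>\<^bsub>B\<^esub> k | h k. h \<in> sec ` {i \<in> EF. sec i \<in> J} \<and> k \<in> star B ` ?q F}"
        by (subst (1) J_image) (rule refl)
      also have "\<dots> = {sec i \<oplus>\<^bsub>B\<^esub> star B (sec (\<lambda>z. j z + F z)) | i j. i \<in> EF \<and> sec i \<in> J \<and> j \<in> EF \<and> sec j \<in> J}"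
        unfolding coset by blast
      finally show ?thesis by (simp only: sec_star sec_add adj_add)
    qed
    also have "\<dots> = ?q (\<lambda>z. adj (F z))"
    proof (intro equalityI subsetI)
      fix x assume "x \<in> {sec (\<lambda>z. i z + (adj (j z) + adj (F z))) | i j. i \<in> EF \<and> sec i \<in> J \<and> j \<in> EF \<and> sec j \<in> J}"
      then obtain i j where ij: "i \<in> EF" "sec i \<in> J" "j \<in> EF" "sec j \<in> J" "x = sec (\<lambda>z. (i z + adj (j z)) + adj (F z))"
        by (auto simp: add.assoc)
      have "sec (\<lambda>z. i z + adj (j z)) \<in> J"
        using J_add[OF ij(2) closed_ideal_star[OF J ij(3,4)]] by (simp add: sec_add)
      moreover have "(\<lambda>z. i z + adj (j z)) \<in> EF" by (intro EF_intros ij)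
      ultimately show "x \<in> ?q (\<lambda>z. adj (F z))" unfolding coset ij(5)
        by (intro CollectI exI[of _ "\<lambda>z. i z + adj (j z)"]) auto
    next
      fix x assume "x \<in> ?q (\<lambda>z. adj (F z))"
      then obtain i where i: "i \<in> EF" "sec i \<in> J" "x = sec (\<lambda>z. i z + (adj 0 + adj (F z)))"
        unfolding coset by auto
      moreover have "sec (\<lambda>z. 0) \<in> J" using J_zero by (simp add: sec_zero)
      ultimately show "x \<in> {sec (\<lambda>z. i z + (adj (j z) + adj (F z))) | i j. i \<in> EF \<and> sec i \<in> J \<and> j \<in> EF \<and> sec j \<in> J}"
        using EF_intros(7) by (intro CollectI exI[of _ i] exI[of _ "\<lambda>z. 0"]) auto
    qed
    finally show ?thesis .
  qed
  have Cm: "abelian_monoid ?C" by (rule cstar_quot_abelian_monoid[OF J(1)])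
  have C_col: "column_norm 1 ?C y = sqrt (cnorm ?C (?q (\<lambda>z. adj (b z) ** b z)))" if "b \<in> EF" "y 0 = ?q b" for b y
  proof -
    have eq: "star ?C (y 0) \<otimes>\<^bsub>?C\<^esub> y 0 = ?q (\<lambda>z. adj (b z) ** b z)"
      unfolding that(2) using that(1) by (simp add: C_star C_mult EF_intros)
    have "?q (\<lambda>z. adj (b z) ** b z) \<in> carrier ?C"
      unfolding C_carrier by (intro imageI EF_intros that)
    then show ?thesis using column_norm_one[OF Cm, of y] unfolding eq by blast
  qed
  have B_col: "column_norm 1 B y = sqrt (cnorm B (sec (\<lambda>z. adj (b z) ** b z)))" if "b \<in> EF" "y 0 = sec b" for b y
  proof -
    have eq: "star B (y 0) \<otimes>\<^bsub>B\<^esub> y 0 = sec (\<lambda>z. adj (b z) ** b z)"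
      unfolding that(2) by (simp add: sec_star sec_mult)
    have "sec (\<lambda>z. adj (b z) ** b z) \<in> carrier B" by (intro sec_carrier EF_intros that)
    then show ?thesis using column_norm_one[OF B_abelian_monoid, of y] unfolding eq by blast
  qed
  have sq_eq: "(\<lambda>z. adj (gm z ** b z) ** (gm z ** b z)) = sq (\<lambda>z. adj (b z) ** b z)" for b
  proof
    fix z
    have "cnj (g z) * g z = of_real ((cmod (g z))\<^sup>2)" using complex_norm_square[of "g z"] by (simp add: mult.commute)
    then show "adj (gm z ** b z) ** (gm z ** b z) = sq (\<lambda>z. adj (b z) ** b z) z"
      by (simp add: gm_def sq_def cscale_eq_mult(1)[symmetric] cscale_mult_left cscale_mult_right mult.commute)
  qed
  define a1 where "a1 = (\<lambda>ij\<in>{..<1::nat} \<times> {..<1::nat}. sec gm)"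
  have "a1 \<in> {..<1} \<times> {..<1} \<rightarrow>\<^sub>E TA"
    unfolding a1_def TA_TF using trace_algebra_TF[OF gmT] by auto
  then have iso: "cnorm (mat_over 1 ?C) (entrywise 1 (\<lambda>b. J +>\<^bsub>B\<^esub> b) a1) = cnorm (mat_over 1 B) a1"
    using ci by (auto simp: completely_isometric_on_def)
  let ?a = "entrywise 1 (\<lambda>b. J +>\<^bsub>B\<^esub> b) a1"
  have "cnorm (mat_over 1 ?C) ?a \<le> \<kappa>"
  proof -
    have "(SUP x\<in>{x \<in> {..<1} \<rightarrow>\<^sub>E carrier ?C. column_norm 1 ?C x \<le> 1}.
       column_norm 1 ?C (\<lambda>i. \<Oplus>\<^bsub>?C\<^esub>j\<in>{..<1}. ?a (i, j) \<otimes>\<^bsub>?C\<^esub> x j)) \<le> \<kappa>"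
    proof (rule cSUP_least)
      define x where "x = (\<lambda>i\<in>{..<1::nat}. ?q (\<lambda>z. 0))"
      have "column_norm 1 ?C x = sqrt (cnorm ?C (?q (\<lambda>z. adj 0 ** 0)))"
        by (rule C_col[OF EF_intros(7)]) (simp add: x_def)
      moreover have "cnorm ?C (?q (\<lambda>z. 0)) \<le> cnorm B (sec (\<lambda>z. 0 + 0))"
        using J_zero by (intro Cnorm_le EF_intros) (simp add: sec_zero)
      moreover have "cnorm B (sec (\<lambda>z. 0)) = 0" using cnorm_eq_0[OF EF_intros(7)] by (simp add: sec_zero)
      ultimately have "column_norm 1 ?C x \<le> 1" by (simp add: order_trans[OF _ zero_le_one])
      moreover have "x \<in> {..<1} \<rightarrow>\<^sub>E carrier ?C" by (auto simp: x_def C_carrier EF_intros)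
      ultimately show "{x \<in> {..<1} \<rightarrow>\<^sub>E carrier ?C. column_norm 1 ?C x \<le> 1} \<noteq> {}" by blast
    next
      fix x assume "x \<in> {x \<in> {..<1::nat} \<rightarrow>\<^sub>E carrier ?C. column_norm 1 ?C x \<le> 1}"
      then have x: "x 0 \<in> carrier ?C" "column_norm 1 ?C x \<le> 1" by auto
      then obtain b where b: "b \<in> EF" "x 0 = ?q b" by (auto simp: C_carrier)
      have bbE: "(\<lambda>z. adj (b z) ** b z) \<in> EF" and gb: "(\<lambda>z. gm z ** b z) \<in> EF"
        by (intro EF_intros b gmE)+
      have le1: "cnorm ?C (?q (\<lambda>z. adj (b z) ** b z)) \<le> 1"
        using x(2) C_col[OF b(1), of x, OF b(2)] by simp
      have e0: "?a (0, 0) \<otimes>\<^bsub>?C\<^esub> x 0 = ?q (\<lambda>z. gm z ** b z)"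
        by (simp add: entrywise_def a1_def b C_mult gmE)
      have sum: "(\<Oplus>\<^bsub>?C\<^esub>j\<in>{..<1}. ?a (0, j) \<otimes>\<^bsub>?C\<^esub> x j) = ?q (\<lambda>z. gm z ** b z)"
        using abelian_monoid.finsum_two(2)[OF Cm, of "\<lambda>j. ?a (0, j) \<otimes>\<^bsub>?C\<^esub> x j"] gb
        unfolding e0 C_carrier by blast
      have "column_norm 1 ?C (\<lambda>i. \<Oplus>\<^bsub>?C\<^esub>j\<in>{..<1}. ?a (i, j) \<otimes>\<^bsub>?C\<^esub> x j)
        = sqrt (cnorm ?C (?q (sq (\<lambda>z. adj (b z) ** b z))))"
        unfolding sq_eq[symmetric] by (rule C_col[OF gb]) (rule sum)
      also have "\<dots> \<le> sqrt (\<kappa>\<^sup>2 * 1)"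
        by (intro real_sqrt_le_mono order_trans[OF shrink[OF bbE]] mult_left_mono le1) simp
      also have "\<dots> = \<kappa>" using \<kappa>(1) by simp
      finally show "column_norm 1 ?C (\<lambda>i. \<Oplus>\<^bsub>?C\<^esub>j\<in>{..<1}. ?a (i, j) \<otimes>\<^bsub>?C\<^esub> x j) \<le> \<kappa>" .
    qed
    then show ?thesis by (simp add: mat_over_def)
  qed
  moreover have "N \<le> cnorm (mat_over 1 B) a1"
  proof -
    let ?f = "\<lambda>x. column_norm 1 B (\<lambda>i. \<Oplus>\<^bsub>B\<^esub>j\<in>{..<1}. a1 (i, j) \<otimes>\<^bsub>B\<^esub> x j)"
    let ?X = "{x \<in> {..<1} \<rightarrow>\<^sub>E carrier B. column_norm 1 B x \<le> 1}"
    have val: "?f x = cnorm B (sec (\<lambda>z. gm z ** b z))" if b: "b \<in> EF" "x 0 = sec b" for x b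
    proof -
      have gb: "(\<lambda>z. gm z ** b z) \<in> EF" by (intro EF_intros b gmE)
      have sum: "(\<Oplus>\<^bsub>B\<^esub>j\<in>{..<1}. a1 (0, j) \<otimes>\<^bsub>B\<^esub> x j) = sec (\<lambda>z. gm z ** b z)"
        using abelian_monoid.finsum_two(2)[OF B_abelian_monoid, of "\<lambda>j. a1 (0, j) \<otimes>\<^bsub>B\<^esub> x j"] sec_carrier[OF gb]
        by (simp add: a1_def b sec_mult)
      have "?f x = sqrt (cnorm B (sec (\<lambda>z. adj (gm z ** b z) ** (gm z ** b z))))"
        by (rule B_col[OF gb]) (rule sum)
      also have "\<dots> = cnorm B (sec (\<lambda>z. gm z ** b z))"
        unfolding cnorm_cstar[OF gb] using cnorm_nonneg[OF gb] by simp
      finally show ?thesis .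
    qed
    have colB: "column_norm 1 B x = cnorm B (sec b)" if b: "b \<in> EF" "x 0 = sec b" for x b
      unfolding B_col[OF b(1), of x, OF b(2)] cnorm_cstar[OF b(1)] using cnorm_nonneg[OF b(1)] by simp
    define x1 where "x1 = (\<lambda>i\<in>{..<1::nat}. sec (\<lambda>z. mat 1))"
    have "column_norm 1 B x1 = cnorm B (sec (\<lambda>z. mat 1))" by (rule colB[OF EF_const]) (simp add: x1_def)
    also have "\<dots> \<le> 1" by (rule cnorm_le[OF EF_const]) simp
    finally have x1: "x1 \<in> ?X" by (auto simp: x1_def intro!: sec_carrier EF_const)
    have "bdd_above (?f ` ?X)"
    proof (rule bdd_aboveI2)
      fix x assume "x \<in> ?X"
      then have x: "x 0 \<in> carrier B" "column_norm 1 B x \<le> 1" by auto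
      obtain b where b: "b \<in> EF" "x 0 = sec b" using x(1) by (rule carrierE)
      have "?f x \<le> N * cnorm B (sec b)" unfolding val[OF b(1), of x, OF b(2)] N_def by (rule cnorm_mult[OF gmE b(1)])
      also have "\<dots> \<le> N * 1" using x(2) colB[OF b(1), of x, OF b(2)] \<kappa> by (intro mult_left_mono) auto
      finally show "?f x \<le> N * 1" .
    qed
    then have "?f x1 \<le> (SUP x\<in>?X. ?f x)" by (rule cSUP_upper[OF x1])
    moreover have "?f x1 = N"
      using val[OF EF_const[of 1], of x1] by (simp add: x1_def N_def)
    ultimately show ?thesis by (simp add: mat_over_def)
  qed
  ultimately show False using iso \<kappa>(2) by simp
qed

lemma shilov_ideal_zero: "is_shilov_boundary_ideal B TA {\<zero>\<^bsub>B\<^esub>}"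
  unfolding is_shilov_boundary_ideal_def
  using generating kernel_intersection zero_boundary_ideal boundary_ideal_trivial by blast

lemma envelope: "is_cstar_envelope B TA B (\<lambda>s. s)"
  unfolding is_cstar_envelope_def
proof (intro exI conjI ballI)
  show "is_shilov_boundary_ideal B TA {\<zero>\<^bsub>B\<^esub>}" by (rule shilov_ideal_zero)
  show "star_iso B0 B the_elem" by (rule quotient_by_zero_iso)
  fix a assume "a \<in> TA"
  then have "a \<in> carrier B" using generating by (auto simp: generating_subalgebra_def)
  then show "the_elem ({\<zero>\<^bsub>B\<^esub>} +>\<^bsub>B\<^esub> a) = a" by (simp add: zero_coset)
qed

end

theorem corollary1p7:
  fixes D :: "('n::finite, 'd::finite) mpoint set" and P :: "(complex^'n^'n^'d) set"
  assumes "CARD('d) \<ge> 2" and "CARD('n) \<ge> 2"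
    and "domain_in (subtopology Q_space Q0) D"
    and "compactin Q_space (Q_space closure_of D)"
    and "Q_space closure_of D \<subseteq> Q0"
    and "is_reduction P (Q_space closure_of D)"
  shows "is_shilov_boundary_ideal (section_algebra (boundary D) P)
           (tracial_function_algebra D P) {\<zero>\<^bsub>section_algebra (boundary D) P\<^esub>} \<and>
         is_cstar_envelope (section_algebra (boundary D) P)
           (tracial_function_algebra D P) (section_algebra (boundary D) P) (\<lambda>\<sigma>. \<sigma>)"
proof -
  have D: "D \<noteq> {}" "D \<subseteq> topspace Q_space"
    using assms(3) openin_subset unfolding domain_in_def by fastforce+
  interpret shilov_bundle P D
    by (intro shilov_bundle.intro reduced_bundle.intro assms(6) boundary_closedin boundary_nonempty[OF assms(6) D])
  have "tracial_function_algebra D P = TA"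
    by (simp add: tracial_function_algebra_def TA_def)
  then show ?thesis using shilov_ideal_zero envelope by simp
qed

end
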